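(* Any tracial state $\tau$ on $\mathcal A_\infty$ can be written uniquely as $$\tau=\lambda_\infty\tau_\infty+\sum_{j=1}^3\lambda_j\chi_j+\sum_{m\ge1}\sum_{j=1}^3\lambda_{m,j}\tau_{m,j}$$ with $\lambda_\infty,\lambda_j,\lambda_{m,j}\ge0$ and $\lambda_\infty+\sum_j\lambda_j+\sum_{j,m}\lambda_{m,j}=1$.
   Context: Indices $j\in\{1,2,3\}$ are taken mod $3$. $M_3(\mathbb C)$ has matrix units $e_{ij}$ and normalized trace $\tau_3$. $\mathrm{UHF}(3^\infty)$ is the $C^*$-inductive limit of $M_3(\mathbb C)^{\otimes n}$ under $x\mapsto x\otimes I_3$; each $M_3(\mathbb C)^{\otimes n}$ is regarded as a unital subalgebra of it. For $n\ge0$ put $\alpha^n_j=e_{jj}\otimes e_{22}^{\otimes n}\in M_3(\mathbb C)^{\otimes(n+1)}$, and for $k\ge1$ put $\beta^k_j=(e_{jj}\otimes e_{11}+e_{j+2,j+2}\otimes e_{33})\otimes e_{22}^{\otimes(k-1)}\in M_3(\mathbb C)^{\otimes(k+1)}$. The finite-dimensional $*$-algebra $\mathcal A_n\subset M_3(\mathbb C)^{\otimes(n+1)}$ is the linear span of the $\alpha^n_j$ and of the $x\otimes\beta^k_j$ with $j=1,2,3$, $k=1,\dots,n$, $x\in M_3(\mathbb C)^{\otimes(n-k)}$. $\mathcal A_\infty$ is the $C^*$-subalgebra of $\mathrm{UHF}(3^\infty)$ of all norm limits $\lim_n a_n$ with $a_n\in\mathcal A_n$. The slice map $\rho_m:\mathrm{UHF}(3^\infty)\to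 M_3(\mathbb C)^{\otimes(m+1)}$, identity on the first $m+1$ tensor factors and applying the state $x\mapsto x_{22}$ to each of the others, restricts to a $*$-homomorphism $\rho_m:\mathcal A_\infty\to\mathcal A_m$. Every $b\in\mathcal A_n$ can be written uniquely as $b=\sum_{j=1}^3\xi_j(b)\alpha^n_j+\sum_{k=0}^{n-1}\sum_{j=1}^3\eta_{k,j}(b)\otimes\beta^{n-k}_j$ with $\xi_j(b)\in\mathbb C$, $\eta_{k,j}(b)\in M_3(\mathbb C)^{\otimes k}$; this defines characters $\xi_j$ of $\mathcal A_n$ and $*$-homomorphisms $\eta_{k,j}:\mathcal A_n\to M_3(\mathbb C)^{\otimes k}$ (with $M_3(\mathbb C)^{\otimes0}=\mathbb C$). The tracial states above are: $\tau_\infty$, the restriction to $\mathcal A_\infty$ of the unique tracial state $\tau_3^{\otimes\mathbb N}$ of $\mathrm{UHF}(3^\infty)$; $\chi_j=\xi_j\circ\rho_0$, $j=1,2,3$; $\tau_{m,j}=\tau_3^{\otimes(m-1)}\circ\eta_{m-1,j}\circ\rho_m$, $j=1,2,3$, $m\ge1$. *)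

theory Defs
  imports "HOL-Analysis.Analysis" "HOL-Library.Function_Algebras" "HOL-Library.Numeral_Type"
begin

section \<open>Matrix algebras \<open>M\<^sub>3(\<complex>)\<^sup>\<otimes>\<^sup>n\<close>\<close>

text \<open>
  The rows and columns of \<open>M\<^sub>3(\<complex>)\<^sup>\<otimes>\<^sup>n\<close> are indexed by words of length \<open>n\<close> over the residues mod 3
  (so the index 3 is the residue 0), and tensoring is concatenation of words.
\<close>

type_synonym wmat = "3 list \<Rightarrow> 3 list \<Rightarrow> complex"

definition words :: "nat \<Rightarrow> 3 list set" where
  "words n = {u. length u = n}"

definition M3 :: "nat \<Rightarrow> wmat set" where
  "M3 n = {x. \<forall>u v. x u v \<noteq> 0 \<longrightarrow> u \<in> words n \<and> v \<in> words n}"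

definition smul :: "complex \<Rightarrow> wmat \<Rightarrow> wmat" where
  "smul c x = (\<lambda>u v. c * x u v)"

definition mmul :: "wmat \<Rightarrow> wmat \<Rightarrow> wmat" where
  "mmul x y = (\<lambda>u v. \<Sum>w\<in>words (length u). x u w * y w v)"

definition madj :: "wmat \<Rightarrow> wmat" where
  "madj x = (\<lambda>u v. cnj (x v u))"

definition mid :: "nat \<Rightarrow> wmat" where
  "mid n = (\<lambda>u v. if u = v \<and> u \<in> words n then 1 else 0)"

text \<open>
  Only one summand is nonzero when \<open>x \<in> M3 n\<close>, namely \<open>i = n\<close> (lemma \<open>tens_apply\<close>); summing over all
  splittings keeps \<open>n\<close> out of the notation.
\<close>

definition tens :: "wmat \<Rightarrow> wmat \<Rightarrow> wmat"  (infixr \<open>\<otimes>\<close> 75) where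
  "x \<otimes> y = (\<lambda>u v. \<Sum>i\<le>length u. x (take i u) (take i v) * y (drop i u) (drop i v))"

text \<open>
  The \<open>C\<^sup>*\<close>-norm on \<open>M3 n\<close> is the operator norm on \<open>\<complex>\<^sup>N\<close> with \<open>N = 3\<^sup>n\<close>; \<open>ntr n\<close> is \<open>\<tau>\<^sub>3\<^sup>\<otimes>\<^sup>n\<close>.
\<close>

definition vnorm :: "nat \<Rightarrow> (3 list \<Rightarrow> complex) \<Rightarrow> real" where
  "vnorm n v = L2_set (\<lambda>u. cmod (v u)) (words n)"

definition mvec :: "nat \<Rightarrow> wmat \<Rightarrow> (3 list \<Rightarrow> complex) \<Rightarrow> 3 list \<Rightarrow> complex" where
  "mvec n x v = (\<lambda>u. \<Sum>w\<in>words n. x u w * v w)"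

definition opnorm :: "nat \<Rightarrow> wmat \<Rightarrow> real" where
  "opnorm n x = (SUP v\<in>{v. vnorm n v \<le> 1}. vnorm n (mvec n x v))"

definition ntr :: "nat \<Rightarrow> wmat \<Rightarrow> complex" where
  "ntr n x = (\<Sum>u\<in>words n. x u u) / 3 ^ n"

lemma finite_words [simp]: "finite (words n)"
  using finite_lists_length_eq[of "UNIV :: 3 set" n] by (simp add: words_def)

lemma words_0 [simp]: "words 0 = {[]}"
  by (auto simp: words_def)

lemma card_words: "card (words n) = 3 ^ n"
  using card_lists_length_eq[of "UNIV :: 3 set" n] by (simp add: words_def)

lemma words_iff: "u \<in> words n \<longleftrightarrow> length u = n"
  by (simp add: words_def)

lemma M3_0: "x \<in> M3 n \<Longrightarrow> u \<notin> words n \<or> v \<notin> words n \<Longrightarrow> x u v = 0"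
  by (auto simp: M3_def)

lemma tens_apply:
  assumes "x \<in> M3 n"
  shows "(x \<otimes> y) u v = (if n \<le> length u then x (take n u) (take n v) * y (drop n u) (drop n v) else 0)"
proof -
  have "(x \<otimes> y) u v = (\<Sum>i\<le>length u. if i = n then x (take n u) (take n v) * y (drop n u) (drop n v) else 0)"
    unfolding tens_def
  proof (rule sum.cong)
    fix i assume "i \<in> {..length u}"
    then have "i \<noteq> n \<Longrightarrow> x (take i u) (take i v) = 0"
      by (intro M3_0[OF assms]) (auto simp: words_def)
    then show "x (take i u) (take i v) * y (drop i u) (drop i v) = (if i = n then x (take n u) (take n v) * y (drop n u) (drop n v) else 0)"
      by auto
  qed simp
  then show ?thesis by simp
qed

lemma M3_closed:
  shows "(0::wmat) \<in> M3 n" "mid n \<in> M3 n"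
    "x \<in> M3 n \<Longrightarrow> y \<in> M3 n \<Longrightarrow> x + y \<in> M3 n"
    "x \<in> M3 n \<Longrightarrow> y \<in> M3 n \<Longrightarrow> x - y \<in> M3 n"
    "x \<in> M3 n \<Longrightarrow> - x \<in> M3 n"
    "x \<in> M3 n \<Longrightarrow> smul c x \<in> M3 n"
    "x \<in> M3 n \<Longrightarrow> madj x \<in> M3 n"
  by (auto simp: M3_def mid_def smul_def madj_def) (metis add.right_neutral)+

lemma M3_mmul: assumes "x \<in> M3 n" "y \<in> M3 n" shows "mmul x y \<in> M3 n"
proof -
  have "mmul x y u v = 0" if "u \<notin> words n \<or> v \<notin> words n" for u v
    unfolding mmul_def by (rule sum.neutral) (use that assms M3_0 in \<open>fastforce simp: words_iff\<close>)
  then show ?thesis unfolding M3_def by auto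
qed

lemma M3_tens: assumes "x \<in> M3 n" "y \<in> M3 k" shows "x \<otimes> y \<in> M3 (n + k)"
proof -
  have "(x \<otimes> y) u v = 0" if "u \<notin> words (n+k) \<or> v \<notin> words (n+k)" for u v
  proof -
    have "length u \<noteq> n + k \<or> length v \<noteq> n + k" using that by (simp add: words_iff)
    then consider "n > length u" | "n \<le> length u" "take n u \<notin> words n \<or> take n v \<notin> words n"
      | "n \<le> length u" "drop n u \<notin> words k \<or> drop n v \<notin> words k" 
      by (simp add: words_iff) linarith
    then show ?thesis
      by cases (use M3_0[OF assms(1)] M3_0[OF assms(2)] in \<open>auto simp: tens_apply[OF assms(1)]\<close>)
  qed
  then show ?thesis unfolding M3_def by auto
qed

lemma sum_words_add: "sum f (words (n + k)) = (\<Sum>p\<in>words n. \<Sum>q\<in>words k. f (p @ q))"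
proof -
  have "sum f (words (n + k)) = (\<Sum>(p,q)\<in>words n \<times> words k. f (p @ q))"
    by (rule sum.reindex_bij_witness[where i="\<lambda>(p,q). p @ q" and j="\<lambda>u. (take n u, drop n u)"])
       (auto simp: words_def)
  then show ?thesis by (simp add: sum.cartesian_product)
qed

lemma vnorm_nonneg [simp]: "0 \<le> vnorm n v"
  by (simp add: vnorm_def)

lemma vnorm_sq: "(vnorm n v)\<^sup>2 = (\<Sum>u\<in>words n. (cmod (v u))\<^sup>2)"
  by (simp add: vnorm_def L2_set_def sum_nonneg)

lemma vnorm_cong: "(\<And>u. u \<in> words n \<Longrightarrow> v u = w u) \<Longrightarrow> vnorm n v = vnorm n w"
  unfolding vnorm_def by (rule L2_set_cong) auto

lemma vnorm_0 [simp]: "vnorm n (\<lambda>u. 0) = 0"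
  by (simp add: vnorm_def L2_set_def)

lemma vnorm_scale: "vnorm n (\<lambda>u. c * v u) = cmod c * vnorm n v"
  by (simp add: vnorm_def norm_mult L2_set_right_distrib)

lemma vnorm_triangle: "vnorm n (\<lambda>u. v u + w u) \<le> vnorm n v + vnorm n w"
proof -
  have "vnorm n (\<lambda>u. v u + w u) \<le> L2_set (\<lambda>u. cmod (v u) + cmod (w u)) (words n)"
    unfolding vnorm_def by (rule L2_set_mono) (auto intro: norm_triangle_ineq)
  also have "\<dots> \<le> vnorm n v + vnorm n w"
    unfolding vnorm_def by (rule L2_set_triangle_ineq)
  finally show ?thesis .
qed

lemma vnorm_coord: "u \<in> words n \<Longrightarrow> cmod (v u) \<le> vnorm n v"
  unfolding vnorm_def by (rule member_le_L2_set) auto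

lemma vnorm_le_sum: "vnorm n v \<le> (\<Sum>u\<in>words n. cmod (v u))"
  unfolding vnorm_def by (rule L2_set_le_sum) auto

lemma vnorm_eq_0: "vnorm n v = 0 \<Longrightarrow> u \<in> words n \<Longrightarrow> v u = 0"
  using vnorm_coord[of u n v] by simp

lemma vnorm_unit: "u \<in> words n \<Longrightarrow> vnorm n (\<lambda>w. if w = u then 1 else 0) = 1"
proof -
  assume "u \<in> words n"
  then have "(vnorm n (\<lambda>w. if w = u then 1 else 0))\<^sup>2 = 1"
    unfolding vnorm_sq by (simp add: if_distrib[of "\<lambda>x. cmod x ^ 2"] cong: if_cong)
  then show ?thesis using power2_eq_iff_nonneg[of "vnorm n (\<lambda>w. if w = u then 1 else 0)" 1] by simp
qed

lemma mvec_bdd: assumes "vnorm n v \<le> 1"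
  shows "vnorm n (mvec n x v) \<le> (\<Sum>u\<in>words n. \<Sum>w\<in>words n. cmod (x u w))"
proof -
  have "cmod (mvec n x v u) \<le> (\<Sum>w\<in>words n. cmod (x u w))" for u
    unfolding mvec_def
  proof (rule sum_norm_le)
    fix w assume "w \<in> words n"
    then have "cmod (v w) \<le> 1" using vnorm_coord[of w n v] assms by simp
    then show "cmod (x u w * v w) \<le> cmod (x u w)" by (simp add: norm_mult mult_left_le)
  qed
  then show ?thesis using vnorm_le_sum[of n "mvec n x v"] by (meson order_trans sum_mono)
qed

lemma opn_bdd: "bdd_above ((\<lambda>v. vnorm n (mvec n x v)) ` {v. vnorm n v \<le> 1})"
  by (rule bdd_aboveI2) (use mvec_bdd in auto)

lemma opn_upper: "vnorm n v \<le> 1 \<Longrightarrow> vnorm n (mvec n x v) \<le> opnorm n x"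
  unfolding opnorm_def by (rule cSUP_upper[OF _ opn_bdd]) auto

lemma opn_nonneg [simp]: "0 \<le> opnorm n x"
  using order_trans[OF vnorm_nonneg opn_upper[of n "\<lambda>u. 0" x]] by simp

lemma mvec_scale: "mvec n x (\<lambda>u. c * v u) = (\<lambda>u. c * mvec n x v u)"
  by (simp add: mvec_def sum_distrib_left algebra_simps)

lemma opn_bound: "vnorm n (mvec n x v) \<le> opnorm n x * vnorm n v"
proof (cases "vnorm n v = 0")
  case True
  then have "mvec n x v = (\<lambda>u. 0)"
    by (auto simp: mvec_def vnorm_eq_0[OF True])
  then show ?thesis using True by simp
next
  case False
  let ?c = "complex_of_real (inverse (vnorm n v))"
  have "vnorm n (\<lambda>u. ?c * v u) = 1"
    using False unfolding vnorm_scale by (simp add: norm_inverse)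
  then have "vnorm n (mvec n x (\<lambda>u. ?c * v u)) \<le> opnorm n x"
    by (intro opn_upper) simp
  then have "inverse (vnorm n v) * vnorm n (mvec n x v) \<le> opnorm n x"
    unfolding mvec_scale vnorm_scale by (simp add: norm_inverse)
  moreover have "vnorm n v > 0" using False vnorm_nonneg[of n v] by linarith
  ultimately show ?thesis by (simp add: field_simps)
qed

lemma opn_least: assumes "\<And>v. vnorm n (mvec n x v) \<le> C * vnorm n v" "0 \<le> C"
  shows "opnorm n x \<le> C"
  unfolding opnorm_def
proof (rule cSUP_least)
  show "{v. vnorm n v \<le> 1} \<noteq> {}" using vnorm_0[of n] by (auto intro!: exI[of _ "\<lambda>u. 0"])
  fix v assume "v \<in> {v. vnorm n v \<le> 1}"
  then have "C * vnorm n v \<le> C" using assms(2) by (simp add: mult_left_le)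
  then show "vnorm n (mvec n x v) \<le> C" using assms(1)[of v] by linarith
qed

lemma opn_0 [simp]: "opnorm n 0 = 0"
proof -
  have "opnorm n 0 \<le> 0" by (rule opn_least) (auto simp: mvec_def)
  then show ?thesis using opn_nonneg[of n 0] by linarith
qed

lemma opn_triangle: "opnorm n (x + y) \<le> opnorm n x + opnorm n y"
proof (rule opn_least)
  fix v
  have "mvec n (x + y) v = (\<lambda>u. mvec n x v u + mvec n y v u)"
    by (simp add: mvec_def sum.distrib algebra_simps)
  then show "vnorm n (mvec n (x + y) v) \<le> (opnorm n x + opnorm n y) * vnorm n v"
    using vnorm_triangle[of n "mvec n x v" "mvec n y v"] opn_bound[of n x v] opn_bound[of n y v]
    by (simp add: algebra_simps)
qed simp

lemma opn_smul_le: "opnorm n (smul c x) \<le> cmod c * opnorm n x"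
proof (rule opn_least)
  fix v
  have "mvec n (smul c x) v = (\<lambda>u. c * mvec n x v u)"
    by (simp add: mvec_def smul_def sum_distrib_left algebra_simps)
  then show "vnorm n (mvec n (smul c x) v) \<le> cmod c * opnorm n x * vnorm n v"
    using opn_bound[of n x v] by (simp add: vnorm_scale mult.assoc mult_left_mono)
qed simp

lemma smul_smul: "smul c (smul d x) = smul (c * d) x" by (simp add: smul_def mult.assoc)
lemma smul_1: "smul 1 x = x" by (simp add: smul_def)
lemma smul_0: "smul 0 x = 0" by (simp add: smul_def zero_fun_def)

lemma opn_smul: "opnorm n (smul c x) = cmod c * opnorm n x"
proof (cases "c = 0")
  case False
  have "opnorm n x = opnorm n (smul (inverse c) (smul c x))" using False by (simp add: smul_smul smul_1)
  also have "\<dots> \<le> inverse (cmod c) * opnorm n (smul c x)"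
    using opn_smul_le[of n "inverse c" "smul c x"] by (simp add: norm_inverse)
  finally have "cmod c * opnorm n x \<le> opnorm n (smul c x)" using False by (simp add: field_simps)
  then show ?thesis using opn_smul_le[of n c x] by simp
qed (simp add: smul_0)

lemma opn_uminus [simp]: "opnorm n (- x) = opnorm n x"
  using opn_smul[of n "-1" x] by (simp add: smul_def fun_Compl_def)

lemma opn_minus_commute: "opnorm n (x - y) = opnorm n (y - x)"
  by (metis minus_diff_eq opn_uminus)

lemma opn_triangle_minus: "opnorm n (x - z) \<le> opnorm n (x - y) + opnorm n (y - z)"
  using opn_triangle[of n "x - y" "y - z"] by (simp add: algebra_simps)

lemma opn_mmul: "opnorm n (mmul x y) \<le> opnorm n x * opnorm n y"
proof (rule opn_least)
  fix v
  have "vnorm n (mvec n (mmul x y) v) = vnorm n (mvec n x (mvec n y v))"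
  proof (rule vnorm_cong)
    fix u assume "u \<in> words n"
    then have "length u = n" by (simp add: words_iff)
    then have "mvec n (mmul x y) v u = (\<Sum>w\<in>words n. \<Sum>w'\<in>words n. x u w' * y w' w * v w)"
      by (simp add: mvec_def mmul_def sum_distrib_right)
    also have "\<dots> = (\<Sum>w'\<in>words n. \<Sum>w\<in>words n. x u w' * y w' w * v w)"
      by (rule sum.swap)
    finally show "mvec n (mmul x y) v u = mvec n x (mvec n y v) u"
      by (simp add: mvec_def sum_distrib_left mult.assoc)
  qed
  also have "\<dots> \<le> opnorm n x * (opnorm n y * vnorm n v)"
    by (rule order_trans[OF opn_bound]) (simp add: opn_bound mult_left_mono)
  finally show "vnorm n (mvec n (mmul x y) v) \<le> opnorm n x * opnorm n y * vnorm n v"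
    by (simp add: mult.assoc)
qed simp

lemma opn_entry: assumes "u \<in> words n" "v \<in> words n" shows "cmod (x u v) \<le> opnorm n x"
proof -
  have "mvec n x (\<lambda>w. if w = v then 1 else 0) u = x u v"
    using assms by (simp add: mvec_def if_distrib cong: if_cong)
  then have "cmod (x u v) \<le> vnorm n (mvec n x (\<lambda>w. if w = v then 1 else 0))"
    using vnorm_coord[OF assms(1), of "mvec n x (\<lambda>w. if w = v then 1 else 0)"] by simp
  then show ?thesis using opn_upper[of n "\<lambda>w. if w = v then 1 else 0" x] vnorm_unit[OF assms(2)]
    by simp
qed

lemma opn_mid [simp]: "opnorm n (mid n) = 1"
proof (rule antisym)
  show "opnorm n (mid n) \<le> 1"
  proof (rule opn_least)
    fix v
    have "vnorm n (mvec n (mid n) v) = vnorm n v"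
      by (rule vnorm_cong) (simp add: mvec_def mid_def if_distrib if_distribR cong: if_cong)
    then show "vnorm n (mvec n (mid n) v) \<le> 1 * vnorm n v" by simp
  qed simp
  have "replicate n 1 \<in> words n" by (simp add: words_iff)
  from opn_entry[OF this this, of "mid n"] this show "1 \<le> opnorm n (mid n)" by (simp add: mid_def)
qed

lemma inner_mvec_madj:
  "(\<Sum>u\<in>words n. mvec n (madj x) v u * cnj (w u)) = (\<Sum>u\<in>words n. v u * cnj (mvec n x w u))"
proof -
  have "(\<Sum>u\<in>words n. mvec n (madj x) v u * cnj (w u))
      = (\<Sum>u\<in>words n. \<Sum>p\<in>words n. cnj (x p u) * v p * cnj (w u))"
    by (simp add: mvec_def madj_def sum_distrib_right)
  also have "\<dots> = (\<Sum>p\<in>words n. \<Sum>u\<in>words n. cnj (x p u) * v p * cnj (w u))"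
    by (rule sum.swap)
  also have "\<dots> = (\<Sum>u\<in>words n. v u * cnj (mvec n x w u))"
    by (simp add: mvec_def sum_distrib_left algebra_simps)
  finally show ?thesis .
qed

lemma inner_self: "(\<Sum>u\<in>words n. v u * cnj (v u)) = of_real ((vnorm n v)\<^sup>2)"
  by (simp add: vnorm_sq complex_norm_square[symmetric])

lemma inner_le: "cmod (\<Sum>u\<in>words n. v u * cnj (w u)) \<le> vnorm n v * vnorm n w"
proof -
  have "cmod (\<Sum>u\<in>words n. v u * cnj (w u)) \<le> (\<Sum>u\<in>words n. \<bar>cmod (v u)\<bar> * \<bar>cmod (w u)\<bar>)"
    by (rule sum_norm_le) (simp add: norm_mult)
  also have "\<dots> \<le> vnorm n v * vnorm n w" unfolding vnorm_def by (rule L2_set_mult_ineq)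
  finally show ?thesis .
qed

lemma opn_madj_le: "opnorm n (madj x) \<le> opnorm n x"
proof (rule opn_least)
  fix v
  let ?w = "mvec n (madj x) v"
  have "(vnorm n ?w)\<^sup>2 = cmod (\<Sum>u\<in>words n. ?w u * cnj (?w u))"
    unfolding inner_self by (simp only: norm_of_real) simp
  also have "\<dots> = cmod (\<Sum>u\<in>words n. v u * cnj (mvec n x ?w u))"
    unfolding inner_mvec_madj ..
  also have "\<dots> \<le> vnorm n v * vnorm n (mvec n x ?w)" by (rule inner_le)
  also have "\<dots> \<le> vnorm n v * (opnorm n x * vnorm n ?w)" by (simp add: opn_bound mult_left_mono)
  finally have "vnorm n ?w * vnorm n ?w \<le> (opnorm n x * vnorm n v) * vnorm n ?w"
    by (simp add: power2_eq_square algebra_simps)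
  then show "vnorm n ?w \<le> opnorm n x * vnorm n v"
    by (metis mult_nonneg_nonneg mult_right_le_imp_le opn_nonneg vnorm_nonneg order_le_less)
qed simp

lemma madj_madj [simp]: "madj (madj x) = x" by (simp add: madj_def)

lemma opn_madj [simp]: "opnorm n (madj x) = opnorm n x"
  using opn_madj_le[of n x] opn_madj_le[of n "madj x"] by simp

lemma opn_cstar: "opnorm n (mmul (madj x) x) = (opnorm n x)\<^sup>2"
proof (rule antisym)
  show "opnorm n (mmul (madj x) x) \<le> (opnorm n x)\<^sup>2"
    using opn_mmul[of n "madj x" x] by (simp add: power2_eq_square)
  have "opnorm n x \<le> sqrt (opnorm n (mmul (madj x) x))"
  proof (rule opn_least)
    fix v
    let ?w = "mvec n x v" and ?y = "mmul (madj x) x"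
    have e: "mvec n (madj x) ?w u = mvec n ?y v u" if "u \<in> words n" for u
    proof -
      have "length u = n" using that by (simp add: words_iff)
      then have "mvec n ?y v u = (\<Sum>w\<in>words n. \<Sum>w'\<in>words n. madj x u w' * x w' w * v w)"
        by (simp add: mvec_def mmul_def sum_distrib_right)
      also have "\<dots> = (\<Sum>w'\<in>words n. \<Sum>w\<in>words n. madj x u w' * x w' w * v w)"
        by (rule sum.swap)
      finally show ?thesis by (simp add: mvec_def sum_distrib_left mult.assoc)
    qed
    have "(vnorm n ?w)\<^sup>2 = cmod (\<Sum>u\<in>words n. ?w u * cnj (?w u))"
      unfolding inner_self by (simp only: norm_of_real) simp
    also have "\<dots> = cmod (\<Sum>u\<in>words n. mvec n (madj x) ?w u * cnj (v u))"
      unfolding inner_mvec_madj ..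
    also have "\<dots> = cmod (\<Sum>u\<in>words n. mvec n ?y v u * cnj (v u))" by (simp add: e)
    also have "\<dots> \<le> vnorm n (mvec n ?y v) * vnorm n v" by (rule inner_le)
    also have "\<dots> \<le> (opnorm n ?y * vnorm n v) * vnorm n v" by (simp add: opn_bound mult_right_mono)
    finally have "(vnorm n ?w)\<^sup>2 \<le> (sqrt (opnorm n ?y) * vnorm n v)\<^sup>2"
      by (simp add: power_mult_distrib) (simp add: power2_eq_square mult.assoc)
    then show "vnorm n ?w \<le> sqrt (opnorm n ?y) * vnorm n v"
      by (rule power2_le_imp_le) simp
  qed simp
  then show "(opnorm n x)\<^sup>2 \<le> opnorm n (mmul (madj x) x)"
    using power_mono[of "opnorm n x" "sqrt (opnorm n (mmul (madj x) x))" 2] by simp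
qed

lemma tens_mid_append:
  assumes "x \<in> M3 n" "p \<in> words n" "q \<in> words k" "p' \<in> words n" "q' \<in> words k"
  shows "(x \<otimes> mid k) (p @ q) (p' @ q') = (if q = q' then x p p' else 0)"
  using assms by (simp add: tens_apply[OF assms(1)] words_iff mid_def)

lemma vnorm_add_sq: "(vnorm (n + k) v)\<^sup>2 = (\<Sum>q\<in>words k. (vnorm n (\<lambda>p. v (p @ q)))\<^sup>2)"
  unfolding vnorm_sq sum_words_add by (rule sum.swap)

lemma mvec_tens_mid:
  assumes "x \<in> M3 n" "p \<in> words n" "q \<in> words k"
  shows "mvec (n + k) (x \<otimes> mid k) v (p @ q) = mvec n x (\<lambda>p. v (p @ q)) p"
  unfolding mvec_def sum_words_add
  by (rule sum.cong) (use assms in \<open>auto simp: tens_mid_append if_distrib[of "\<lambda>x. x * _"] cong: if_cong\<close>)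

lemma opn_tens_mid: assumes x: "x \<in> M3 n" shows "opnorm (n + k) (x \<otimes> mid k) = opnorm n x"
proof (rule antisym)
  have *: "(vnorm (n + k) (mvec (n + k) (x \<otimes> mid k) v))\<^sup>2
        = (\<Sum>q\<in>words k. (vnorm n (mvec n x (\<lambda>p. v (p @ q))))\<^sup>2)" for v
    unfolding vnorm_add_sq
    by (rule sum.cong) (auto intro!: arg_cong[of _ _ "\<lambda>x. x\<^sup>2"] vnorm_cong simp: mvec_tens_mid[OF x])
  show "opnorm (n + k) (x \<otimes> mid k) \<le> opnorm n x"
  proof (rule opn_least)
    fix v
    have "(vnorm (n + k) (mvec (n + k) (x \<otimes> mid k) v))\<^sup>2
        \<le> (\<Sum>q\<in>words k. (opnorm n x * vnorm n (\<lambda>p. v (p @ q)))\<^sup>2)"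
      unfolding * by (intro sum_mono power_mono opn_bound) simp
    also have "\<dots> = (opnorm n x * vnorm (n + k) v)\<^sup>2"
      by (simp add: power_mult_distrib vnorm_add_sq sum_distrib_left)
    finally show "vnorm (n + k) (mvec (n + k) (x \<otimes> mid k) v) \<le> opnorm n x * vnorm (n + k) v"
      by (rule power2_le_imp_le) simp
  qed simp
  show "opnorm n x \<le> opnorm (n + k) (x \<otimes> mid k)"
  proof (rule opn_least)
    fix v
    let ?q = "replicate k (1::3)" and ?v = "\<lambda>u. if drop n u = replicate k (1::3) then v (take n u) else (0::complex)"
    have q: "?q \<in> words k" by (simp add: words_iff)
    have v: "vnorm n (\<lambda>p. ?v (p @ q)) = (if q = ?q then vnorm n v else 0)" for q
    proof -
      have "vnorm n (\<lambda>p. ?v (p @ q)) = vnorm n (\<lambda>p. if q = ?q then v p else 0)"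
        by (rule vnorm_cong) (simp add: words_iff)
      then show ?thesis by simp
    qed
    have "(vnorm (n + k) ?v)\<^sup>2 = (vnorm n v)\<^sup>2"
      unfolding vnorm_add_sq v using q by (simp add: if_distrib[of "\<lambda>x. x\<^sup>2"] cong: if_cong)
    then have vv: "vnorm (n + k) ?v = vnorm n v" by (simp add: power2_eq_iff_nonneg)
    have "vnorm n (mvec n x v) = vnorm n (mvec n x (\<lambda>p. ?v (p @ ?q)))"
      unfolding mvec_def by (intro vnorm_cong sum.cong) (simp_all add: words_iff)
    then have "(vnorm n (mvec n x v))\<^sup>2 \<le> (vnorm (n + k) (mvec (n + k) (x \<otimes> mid k) ?v))\<^sup>2"
      unfolding * using member_le_sum[of ?q "words k" "\<lambda>q. (vnorm n (mvec n x (\<lambda>p. ?v (p @ q))))\<^sup>2"] q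
      by simp
    then have "vnorm n (mvec n x v) \<le> vnorm (n + k) (mvec (n + k) (x \<otimes> mid k) ?v)"
      by (rule power2_le_imp_le) simp
    also have "\<dots> \<le> opnorm (n + k) (x \<otimes> mid k) * vnorm n v"
      using opn_bound[of "n + k" "x \<otimes> mid k" ?v] by (simp add: vv)
    finally show "vnorm n (mvec n x v) \<le> opnorm (n + k) (x \<otimes> mid k) * vnorm n v" .
  qed simp
qed

lemma tens_add: "(x + y) \<otimes> z = x \<otimes> z + y \<otimes> z"
  by (simp add: tens_def algebra_simps sum.distrib fun_eq_iff)
lemma tens_minus: "(x - y) \<otimes> z = x \<otimes> z - y \<otimes> z"
  by (simp add: tens_def algebra_simps sum_subtractf fun_eq_iff)
lemma tens_smul: "smul c x \<otimes> z = smul c (x \<otimes> z)"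
  by (simp add: tens_def smul_def sum_distrib_left algebra_simps)

lemma tens_mmul: assumes "x \<in> M3 n" "y \<in> M3 n"
  shows "mmul x y \<otimes> mid k = mmul (x \<otimes> mid k) (y \<otimes> mid k)"
proof (intro ext)
  fix u v
  have xy: "mmul x y \<otimes> mid k \<in> M3 (n + k)" "mmul (x \<otimes> mid k) (y \<otimes> mid k) \<in> M3 (n + k)"
    by (intro M3_tens M3_mmul M3_closed assms)+
  show "(mmul x y \<otimes> mid k) u v = mmul (x \<otimes> mid k) (y \<otimes> mid k) u v"
  proof (cases "u \<in> words (n + k) \<and> v \<in> words (n + k)")
    case False then show ?thesis using xy M3_0 by metis
  next
    case True
    define p q p' q' where d: "p = take n u" "q = drop n u" "p' = take n v" "q' = drop n v"
    have uv: "u = p @ q" "v = p' @ q'" and w: "p \<in> words n" "p' \<in> words n" "q \<in> words k" "q' \<in> words k"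
      using True by (auto simp: d words_iff)
    have l: "length (p @ q) = n + k" "length p = n" using w by (auto simp: words_iff)
    have "mmul (x \<otimes> mid k) (y \<otimes> mid k) u v
      = (\<Sum>a\<in>words n. \<Sum>b\<in>words k. (if q = b then x p a else 0) * (if b = q' then y a p' else 0))"
      unfolding mmul_def uv l sum_words_add
      by (intro sum.cong refl) (use w assms in \<open>simp add: tens_mid_append\<close>)
    also have "\<dots> = (if q = q' then mmul x y p p' else 0)"
      using w l by (auto simp: mmul_def if_distrib[of "\<lambda>x. x * _"] cong: if_cong)
    also have "\<dots> = (mmul x y \<otimes> mid k) u v"
      unfolding uv using w M3_mmul[OF assms] by (simp add: tens_mid_append)
    finally show ?thesis ..
  qed
qed

lemma tens_madj: assumes "x \<in> M3 n" shows "madj x \<otimes> mid k = madj (x \<otimes> mid k)"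
proof (intro ext)
  fix u v
  have xy: "madj x \<otimes> mid k \<in> M3 (n + k)" "madj (x \<otimes> mid k) \<in> M3 (n + k)"
    by (intro M3_tens M3_mmul M3_closed assms)+
  show "(madj x \<otimes> mid k) u v = madj (x \<otimes> mid k) u v"
  proof (cases "u \<in> words (n + k) \<and> v \<in> words (n + k)")
    case False then show ?thesis using xy M3_0 by metis
  next
    case True
    then show ?thesis 
      using assms M3_closed(7)[OF assms]
      by (auto simp: tens_apply[of _ n] madj_def words_iff mid_def)
  qed
qed

lemma tens_mid_mid: "mid n \<otimes> mid k = mid (n + k)"
proof (intro ext)
  fix u v
  show "(mid n \<otimes> mid k) u v = mid (n + k) u v"
  proof (cases "u = v")
    case True then show ?thesis
      unfolding tens_apply[OF M3_closed(2)] by (auto simp: mid_def words_iff)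
  next
    case False
    then have "take n u \<noteq> take n v \<or> drop n u \<noteq> drop n v"
      by (metis append_take_drop_id)
    then show ?thesis using False unfolding tens_apply[OF M3_closed(2)] by (auto simp: mid_def)
  qed
qed

lemma tens_mid_0: assumes "x \<in> M3 n" shows "x \<otimes> mid 0 = x"
proof (intro ext)
  fix u v
  show "(x \<otimes> mid 0) u v = x u v"
    using M3_0[OF assms, of u v] by (cases "length u = n"; cases "length v = n")
      (auto simp: tens_apply[OF assms] mid_def words_iff)
qed

lemma tens_mid_add: assumes "x \<in> M3 n" shows "(x \<otimes> mid j) \<otimes> mid k = x \<otimes> mid (j + k)"
proof (intro ext)
  fix u v
  have x': "x \<otimes> mid j \<in> M3 (n + j)" by (intro M3_tens M3_closed assms)
  have "(x \<otimes> (mid j \<otimes> mid k)) u v = ((x \<otimes> mid j) \<otimes> mid k) u v"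
    unfolding tens_apply[OF x'] tens_apply[OF assms] tens_apply[OF M3_closed(2)]
    by (auto simp: add.commute[of n j] take_drop)
  then show "((x \<otimes> mid j) \<otimes> mid k) u v = (x \<otimes> mid (j + k)) u v" by (simp add: tens_mid_mid)
qed

lemma cmod_ntr: "cmod (ntr n x) \<le> opnorm n x"
proof -
  have "cmod (\<Sum>u\<in>words n. x u u) \<le> (\<Sum>u\<in>words n. opnorm n x)"
    by (intro sum_norm_le opn_entry)
  then show ?thesis by (simp add: ntr_def card_words norm_divide norm_power field_simps)
qed


section \<open>The UHF algebra\<close>

text \<open>
  Completion of the algebraic inductive limit of the \<open>M3 n\<close> under \<open>x \<mapsto> x \<otimes> mid 1\<close>. A point is a
  sequence \<open>a n \<in> M3 n\<close> that is Cauchy after identifying \<open>x\<close> with \<open>x \<otimes> mid k\<close>, modulo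
  sequences tending to 0 in norm.
\<close>

definition uhf_seq :: "(nat \<Rightarrow> wmat) set" where
  "uhf_seq = {a. (\<forall>n. a n \<in> M3 n) \<and>
     (\<forall>e>0. \<exists>N. \<forall>n\<ge>N. \<forall>k. opnorm (n + k) (a (n + k) - a n \<otimes> mid k) < e)}"

definition uhf_rel :: "(nat \<Rightarrow> wmat) \<Rightarrow> (nat \<Rightarrow> wmat) \<Rightarrow> bool" where
  "uhf_rel a b \<longleftrightarrow> a \<in> uhf_seq \<and> b \<in> uhf_seq \<and> (\<lambda>n. opnorm n (a n - b n)) \<longlonglongrightarrow> 0"

lemma uhf_seq_M3: "a \<in> uhf_seq \<Longrightarrow> a n \<in> M3 n"
  by (simp add: uhf_seq_def)

lemma uhf_seqD:
  assumes "a \<in> uhf_seq" "e > 0"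
  obtains N where "\<And>n k. n \<ge> N \<Longrightarrow> opnorm (n + k) (a (n + k) - a n \<otimes> mid k) < e"
  using assms unfolding uhf_seq_def by blast

lemma opn_abs_diff: "\<bar>opnorm n x - opnorm n y\<bar> \<le> opnorm n (x - y)"
  using opn_triangle[of n "x - y" y] opn_triangle[of n "y - x" x] opn_minus_commute[of n x y]
  by simp

lemma opn_abs_le: "\<bar>opnorm n x\<bar> \<le> y \<longleftrightarrow> opnorm n x \<le> y"
  using opn_nonneg[of n x] by linarith

lemma opn_tendsto_0I: "(\<And>n. opnorm n (x n) \<le> f n) \<Longrightarrow> f \<longlonglongrightarrow> 0 \<Longrightarrow> (\<lambda>n. opnorm n (x n)) \<longlonglongrightarrow> 0"
  by (rule tendsto_sandwich[of "\<lambda>_. 0" _ _ f]) auto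

lemma opn_tendsto_0_add:
  "(\<lambda>n. opnorm n (x n)) \<longlonglongrightarrow> 0 \<Longrightarrow> (\<lambda>n. opnorm n (y n)) \<longlonglongrightarrow> 0 \<Longrightarrow> (\<lambda>n. opnorm n (x n + y n)) \<longlonglongrightarrow> 0"
  by (rule opn_tendsto_0I[OF opn_triangle]) (rule tendsto_add_zero)

lemma uhf_seq_convergent: assumes "a \<in> uhf_seq" shows "convergent (\<lambda>n. opnorm n (a n))"
proof -
  have "Cauchy (\<lambda>n. opnorm n (a n))"
  proof (rule metric_CauchyI)
    fix e :: real assume "e > 0"
    then have "e / 2 > 0" by simp
    then obtain N where N: "\<And>n k. n \<ge> N \<Longrightarrow> opnorm (n + k) (a (n + k) - a n \<otimes> mid k) < e/2"
      using uhf_seqD[OF assms] by blast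
    have *: "\<bar>opnorm m (a m) - opnorm N (a N)\<bar> < e/2" if "m \<ge> N" for m
    proof -
      have "\<bar>opnorm m (a m) - opnorm m (a N \<otimes> mid (m - N))\<bar> \<le> opnorm m (a m - a N \<otimes> mid (m - N))"
        by (rule opn_abs_diff)
      moreover have "opnorm m (a m - a N \<otimes> mid (m - N)) < e/2" using N[of N "m - N"] that by simp
      moreover have "opnorm m (a N \<otimes> mid (m - N)) = opnorm N (a N)"
        using opn_tens_mid[OF uhf_seq_M3[OF assms], of N "m - N"] that by simp
      ultimately show ?thesis by linarith
    qed
    show "\<exists>M. \<forall>m\<ge>M. \<forall>n\<ge>M. dist (opnorm m (a m)) (opnorm n (a n)) < e"
    proof (intro exI allI impI)
      fix m n assume "N \<le> m" "N \<le> n"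
      then show "dist (opnorm m (a m)) (opnorm n (a n)) < e"
        using *[of m] *[of n] unfolding dist_real_def by linarith
    qed
  qed
  then show ?thesis by (simp add: Cauchy_convergent_iff)
qed

lemma uhf_seq_bounded: assumes "a \<in> uhf_seq"
  obtains B where "B > 0" "\<And>n. opnorm n (a n) \<le> B"
proof -
  have "Bseq (\<lambda>n. opnorm n (a n))" using uhf_seq_convergent[OF assms] by (rule convergent_imp_Bseq)
  then show ?thesis using that by (auto elim!: BseqE)
qed

lemma uhf_seqI:
  assumes "\<And>n. a n \<in> M3 n"
    and "\<And>e. e > 0 \<Longrightarrow> \<exists>N. \<forall>n\<ge>N. \<forall>k. opnorm (n + k) (a (n + k) - a n \<otimes> mid k) < e"
  shows "a \<in> uhf_seq"
  using assms by (auto simp: uhf_seq_def)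

definition const_seq :: "nat \<Rightarrow> wmat \<Rightarrow> nat \<Rightarrow> wmat" where
  "const_seq n x = (\<lambda>m. if n \<le> m then x \<otimes> mid (m - n) else 0)"

lemma uhf_seq_const: assumes "x \<in> M3 n" shows "const_seq n x \<in> uhf_seq"
proof (rule uhf_seqI)
  show "const_seq n x m \<in> M3 m" for m
    using M3_tens[OF assms M3_closed(2), of "m - n"] M3_closed(1)
    by (cases "n \<le> m") (simp_all add: const_seq_def)
next
  fix e :: real assume "e > 0"
  have "const_seq n x (m + k) - const_seq n x m \<otimes> mid k = 0" if "m \<ge> n" for m k
    using that by (simp add: const_seq_def tens_mid_add[OF assms])
  with \<open>e > 0\<close> show "\<exists>N. \<forall>m\<ge>N. \<forall>k. opnorm (m + k) (const_seq n x (m + k) - const_seq n x m \<otimes> mid k) < e"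
    by (intro exI[of _ n]) simp
qed

lemma uhf_seq_0: "(\<lambda>n. 0) \<in> uhf_seq"
  using uhf_seq_const[OF M3_closed(1), of 0] by (simp add: const_seq_def tens_def zero_fun_def)

lemma uhf_seq_mid: "mid \<in> uhf_seq"
  using uhf_seq_const[OF M3_closed(2), of 0] by (simp add: const_seq_def tens_mid_mid)

lemma uhf_seq_add: assumes "a \<in> uhf_seq" "b \<in> uhf_seq" shows "(\<lambda>n. a n + b n) \<in> uhf_seq"
proof (rule uhf_seqI)
  show "a n + b n \<in> M3 n" for n using assms by (intro M3_closed uhf_seq_M3)
  fix e :: real assume "e > 0" then have e: "e / 2 > 0" by simp
  obtain N where N: "\<And>n k. n \<ge> N \<Longrightarrow> opnorm (n + k) (a (n + k) - a n \<otimes> mid k) < e/2"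
    using uhf_seqD[OF assms(1) e] by blast
  obtain N' where N': "\<And>n k. n \<ge> N' \<Longrightarrow> opnorm (n + k) (b (n + k) - b n \<otimes> mid k) < e/2"
    using uhf_seqD[OF assms(2) e] by blast
  show "\<exists>N. \<forall>n\<ge>N. \<forall>k. opnorm (n + k) (a (n + k) + b (n + k) - (a n + b n) \<otimes> mid k) < e"
  proof (intro exI allI impI)
    fix n k assume n: "max N N' \<le> n"
    have *: "a (n + k) + b (n + k) - (a n + b n) \<otimes> mid k
      = (a (n + k) - a n \<otimes> mid k) + (b (n + k) - b n \<otimes> mid k)"
      by (simp add: tens_add)
    show "opnorm (n + k) (a (n + k) + b (n + k) - (a n + b n) \<otimes> mid k) < e"
      using N[of n k] N'[of n k] n
        opn_triangle[of "n+k" "a (n + k) - a n \<otimes> mid k" "b (n + k) - b n \<otimes> mid k"]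
      unfolding * by linarith
  qed
qed

lemma uhf_seq_smul: assumes "a \<in> uhf_seq" shows "(\<lambda>n. smul c (a n)) \<in> uhf_seq"
proof (rule uhf_seqI)
  show "smul c (a n) \<in> M3 n" for n using assms by (intro M3_closed uhf_seq_M3)
  have c: "cmod c + 1 > 0" by (simp add: add_nonneg_pos)
  fix e :: real assume "e > 0" then have e: "e / (cmod c + 1) > 0" using c by simp
  obtain N where N: "\<And>n k. n \<ge> N \<Longrightarrow> opnorm (n + k) (a (n + k) - a n \<otimes> mid k) < e / (cmod c + 1)"
    using uhf_seqD[OF assms e] by blast
  show "\<exists>N. \<forall>n\<ge>N. \<forall>k. opnorm (n + k) (smul c (a (n + k)) - smul c (a n) \<otimes> mid k) < e"
  proof (intro exI allI impI)
    fix n k assume n: "N \<le> n"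
    have "smul c (a (n + k)) - smul c (a n) \<otimes> mid k = smul c (a (n + k) - a n \<otimes> mid k)"
      unfolding tens_smul by (simp add: smul_def fun_eq_iff algebra_simps)
    then have "opnorm (n + k) (smul c (a (n + k)) - smul c (a n) \<otimes> mid k)
       \<le> (cmod c + 1) * opnorm (n + k) (a (n + k) - a n \<otimes> mid k)"
      by (simp add: opn_smul mult_right_mono)
    also have "\<dots> < (cmod c + 1) * (e / (cmod c + 1))"
      using N[OF n, of k] by (intro mult_strict_left_mono) (auto intro: add_nonneg_pos)
    also have "\<dots> = e" using c by simp
    finally show "opnorm (n + k) (smul c (a (n + k)) - smul c (a n) \<otimes> mid k) < e" .
  qed
qed

lemma uhf_seq_uminus: assumes "a \<in> uhf_seq" shows "(\<lambda>n. - a n) \<in> uhf_seq"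
proof -
  have "smul (-1) x = - x" for x by (simp add: smul_def fun_eq_iff)
  then show ?thesis using uhf_seq_smul[OF assms, of "-1"] by simp
qed

lemma uhf_seq_diff: assumes "a \<in> uhf_seq" "b \<in> uhf_seq" shows "(\<lambda>n. a n - b n) \<in> uhf_seq"
  using uhf_seq_add[OF assms(1) uhf_seq_uminus[OF assms(2)]] by simp

lemma uhf_seq_madj: assumes "a \<in> uhf_seq" shows "(\<lambda>n. madj (a n)) \<in> uhf_seq"
proof (rule uhf_seqI)
  show "madj (a n) \<in> M3 n" for n using assms by (intro M3_closed uhf_seq_M3)
  fix e :: real assume e: "e > 0"
  have "madj (a (n + k)) - madj (a n) \<otimes> mid k = madj (a (n + k) - a n \<otimes> mid k)" for n k
    unfolding tens_madj[OF uhf_seq_M3[OF assms]] by (simp add: madj_def fun_eq_iff)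
  then show "\<exists>N. \<forall>n\<ge>N. \<forall>k. opnorm (n + k) (madj (a (n + k)) - madj (a n) \<otimes> mid k) < e"
    using uhf_seqD[OF assms e] by (metis opn_madj)
qed

lemma mmul_diff: "mmul a b - mmul c d = mmul (a - c) b + mmul c (b - d)"
  by (simp add: mmul_def fun_eq_iff sum_subtractf[symmetric] sum.distrib[symmetric] algebra_simps)

lemma uhf_seq_mmul: assumes "a \<in> uhf_seq" "b \<in> uhf_seq" shows "(\<lambda>n. mmul (a n) (b n)) \<in> uhf_seq"
proof (rule uhf_seqI)
  show "mmul (a n) (b n) \<in> M3 n" for n using assms by (intro M3_mmul uhf_seq_M3)
  obtain A where A: "A > 0" "\<And>n. opnorm n (a n) \<le> A" using uhf_seq_bounded[OF assms(1)] by blast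
  obtain B where B: "B > 0" "\<And>n. opnorm n (b n) \<le> B" using uhf_seq_bounded[OF assms(2)] by blast
  fix e :: real assume e: "e > 0"
  have eA: "e / (2 * A) > 0" and eB: "e / (2 * B) > 0" using e A B by auto
  obtain N where N: "\<And>n k. n \<ge> N \<Longrightarrow> opnorm (n + k) (a (n + k) - a n \<otimes> mid k) < e / (2 * B)"
    using uhf_seqD[OF assms(1) eB] by blast
  obtain N' where N': "\<And>n k. n \<ge> N' \<Longrightarrow> opnorm (n + k) (b (n + k) - b n \<otimes> mid k) < e / (2 * A)"
    using uhf_seqD[OF assms(2) eA] by blast
  show "\<exists>N. \<forall>n\<ge>N. \<forall>k. opnorm (n + k) (mmul (a (n + k)) (b (n + k)) - mmul (a n) (b n) \<otimes> mid k) < e"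
  proof (intro exI allI impI)
    fix n k assume n: "max N N' \<le> n"
    let ?da = "a (n + k) - a n \<otimes> mid k" and ?db = "b (n + k) - b n \<otimes> mid k"
    have "opnorm (n + k) (mmul (a (n + k)) (b (n + k)) - mmul (a n) (b n) \<otimes> mid k)
      = opnorm (n + k) (mmul ?da (b (n + k)) + mmul (a n \<otimes> mid k) ?db)"
      unfolding tens_mmul[OF uhf_seq_M3[OF assms(1)] uhf_seq_M3[OF assms(2)]]
      by (subst mmul_diff) simp
    also have "\<dots> \<le> opnorm (n + k) ?da * opnorm (n + k) (b (n + k)) + opnorm (n + k) (a n \<otimes> mid k) * opnorm (n + k) ?db"
      by (intro order_trans[OF opn_triangle] add_mono opn_mmul)
    also have "\<dots> \<le> opnorm (n + k) ?da * B + A * opnorm (n + k) ?db"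
      unfolding opn_tens_mid[OF uhf_seq_M3[OF assms(1)]]
      by (intro add_mono mult_left_mono mult_right_mono A B) auto
    also have "\<dots> < (e / (2 * B)) * B + A * (e / (2 * A))"
      using N[of n k] N'[of n k] n A B
      by (intro add_strict_mono mult_strict_left_mono mult_strict_right_mono) auto
    also have "\<dots> = e" using A B by (simp add: field_simps)
    finally show "opnorm (n + k) (mmul (a (n + k)) (b (n + k)) - mmul (a n) (b n) \<otimes> mid k) < e" .
  qed
qed

lemma uhf_rel_refl: "a \<in> uhf_seq \<Longrightarrow> uhf_rel a a"
  by (simp add: uhf_rel_def)

lemma uhf_relD: "uhf_rel a b \<Longrightarrow> a \<in> uhf_seq" "uhf_rel a b \<Longrightarrow> b \<in> uhf_seq"
  "uhf_rel a b \<Longrightarrow> (\<lambda>n. opnorm n (a n - b n)) \<longlonglongrightarrow> 0"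
  by (simp_all add: uhf_rel_def)

quotient_type uhf = "nat \<Rightarrow> wmat" / partial: uhf_rel
proof (rule part_equivpI)
  show "\<exists>x. uhf_rel x x" using uhf_rel_refl[OF uhf_seq_0] by blast
  show "symp uhf_rel"
    by (rule sympI) (simp add: uhf_rel_def opn_minus_commute)
  show "transp uhf_rel"
  proof (rule transpI)
    fix a b c assume *: "uhf_rel a b" "uhf_rel b c"
    have "(\<lambda>n. opnorm n ((a n - b n) + (b n - c n))) \<longlonglongrightarrow> 0"
      using * by (intro opn_tendsto_0_add) (simp_all add: uhf_rel_def)
    then show "uhf_rel a c" using * by (simp add: uhf_rel_def)
  qed
qed

text \<open>
  The embedding of \<open>M3 n\<close>; only meaningful for \<open>x \<in> M3 n\<close>.
\<close>

definition iota :: "nat \<Rightarrow> wmat \<Rightarrow> uhf" where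
  "iota n x = abs_uhf (const_seq n x)"

lemma uhf_lim_eq:
  fixes f g :: "nat \<Rightarrow> 'a::real_normed_vector"
  assumes "uhf_rel a b" "\<And>n. norm (f n - g n) \<le> opnorm (n + k) (a (n + k) - b (n + k))"
  shows "lim f = lim g"
proof -
  have "(\<lambda>n. opnorm (n + k) (a (n + k) - b (n + k))) \<longlonglongrightarrow> 0"
    using uhf_relD(3)[OF assms(1)] by (rule LIMSEQ_ignore_initial_segment)
  then have *: "(\<lambda>n. f n - g n) \<longlonglongrightarrow> 0" by (rule Lim_null_comparison[rotated]) (simp add: assms(2))
  have "f \<longlonglongrightarrow> L \<longleftrightarrow> g \<longlonglongrightarrow> L" for L
    using Lim_transform[OF _ *, of L] Lim_transform2[OF _ *, of L] by blast
  then show ?thesis by (simp add: lim_def)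
qed

lemma mmul_assoc_n:
  assumes "y \<in> M3 n" "x \<in> M3 n"
  shows "mmul (mmul x y) z = mmul x (mmul y z)"
proof (intro ext)
  fix u v
  show "mmul (mmul x y) z u v = mmul x (mmul y z) u v"
  proof (cases "length u = n")
    case True
    have "mmul x (mmul y z) u v = (\<Sum>w\<in>words n. \<Sum>w'\<in>words n. x u w * (y w w' * z w' v))"
      by (auto simp: mmul_def True words_iff sum_distrib_left intro!: sum.cong)
    also have "\<dots> = (\<Sum>w'\<in>words n. \<Sum>w\<in>words n. x u w * (y w w' * z w' v))" by (rule sum.swap)
    also have "\<dots> = mmul (mmul x y) z u v"
      by (simp add: mmul_def True sum_distrib_right mult.assoc)
    finally show ?thesis ..
  next
    case False
    then have "x u w = 0" for w using M3_0[OF assms(2)] by (simp add: words_iff)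
    then show ?thesis by (simp add: mmul_def)
  qed
qed

lemma mmul_mid_n: assumes "x \<in> M3 n" shows "mmul (mid n) x = x" "mmul x (mid n) = x"
proof -
  show "mmul (mid n) x = x"
  proof (intro ext)
    fix u v show "mmul (mid n) x u v = x u v"
      using M3_0[OF assms, of u v]
      by (cases "u \<in> words n") (auto simp: mmul_def mid_def words_iff if_distrib[of "\<lambda>x. x * _"] cong: if_cong)
  qed
  show "mmul x (mid n) = x"
  proof (intro ext)
    fix u v 
    have "mmul x (mid n) u v = (\<Sum>w\<in>words (length u). if w = v then x u v * of_bool (v \<in> words n) else 0)"
      unfolding mmul_def by (rule sum.cong) (auto simp: mid_def)
    then show "mmul x (mid n) u v = x u v"
      using M3_0[OF assms, of u v] by (auto simp: words_iff)
  qed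
qed

lemma norm_uhf_tendsto: "a \<in> uhf_seq \<Longrightarrow> (\<lambda>n. opnorm n (a n)) \<longlonglongrightarrow> lim (\<lambda>n. opnorm n (a n))"
  using uhf_seq_convergent by (simp add: convergent_LIMSEQ_iff)

instantiation uhf :: real_normed_algebra_1
begin

lift_definition zero_uhf :: uhf is "\<lambda>n. 0" by (intro uhf_rel_refl uhf_seq_0)
lift_definition one_uhf :: uhf is mid by (intro uhf_rel_refl uhf_seq_mid)

lift_definition plus_uhf :: "uhf \<Rightarrow> uhf \<Rightarrow> uhf" is "\<lambda>a b n. a n + b n"
proof -
  fix a a' b b' assume *: "uhf_rel a a'" "uhf_rel b b'"
  have "(\<lambda>n. opnorm n ((a n - a' n) + (b n - b' n))) \<longlonglongrightarrow> 0"
    using * by (intro opn_tendsto_0_add uhf_relD)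
  then show "uhf_rel (\<lambda>n. a n + b n) (\<lambda>n. a' n + b' n)"
    using * by (simp add: uhf_rel_def uhf_seq_add algebra_simps)
qed

lift_definition uminus_uhf :: "uhf \<Rightarrow> uhf" is "\<lambda>a n. - a n"
proof -
  fix a a' assume *: "uhf_rel a a'"
  have "opnorm n (a n - a' n) = opnorm n (- a n - - a' n)" for n by (simp add: opn_minus_commute)
  then show "uhf_rel (\<lambda>n. - a n) (\<lambda>n. - a' n)" using * by (simp add: uhf_rel_def uhf_seq_uminus)
qed

lift_definition minus_uhf :: "uhf \<Rightarrow> uhf \<Rightarrow> uhf" is "\<lambda>a b n. a n - b n"
proof -
  fix a a' b b' assume *: "uhf_rel a a'" "uhf_rel b b'"
  have "(\<lambda>n. opnorm n (b' n - b n)) \<longlonglongrightarrow> 0"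
    using uhf_relD(3)[OF *(2)] by (subst opn_minus_commute)
  then have "(\<lambda>n. opnorm n ((a n - a' n) + (b' n - b n))) \<longlonglongrightarrow> 0"
    by (intro opn_tendsto_0_add uhf_relD(3)[OF *(1)])
  then show "uhf_rel (\<lambda>n. a n - b n) (\<lambda>n. a' n - b' n)"
    using * by (simp add: uhf_rel_def uhf_seq_diff algebra_simps)
qed

lift_definition times_uhf :: "uhf \<Rightarrow> uhf \<Rightarrow> uhf" is "\<lambda>a b n. mmul (a n) (b n)"
proof -
  fix a a' b b' assume *: "uhf_rel a a'" "uhf_rel b b'"
  obtain A where A: "A > 0" "\<And>n. opnorm n (a' n) \<le> A" using uhf_seq_bounded[OF uhf_relD(2)[OF *(1)]] by blast
  obtain B where B: "B > 0" "\<And>n. opnorm n (b n) \<le> B" using uhf_seq_bounded[OF uhf_relD(1)[OF *(2)]] by blast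
  have "opnorm n (mmul (a n) (b n) - mmul (a' n) (b' n))
     \<le> opnorm n (a n - a' n) * B + A * opnorm n (b n - b' n)" for n
    unfolding mmul_diff
    by (intro order_trans[OF opn_triangle] add_mono order_trans[OF opn_mmul]
        mult_left_mono mult_right_mono A B) auto
  moreover have "(\<lambda>n. opnorm n (a n - a' n) * B + A * opnorm n (b n - b' n)) \<longlonglongrightarrow> 0"
    using tendsto_add[OF tendsto_mult_right[OF uhf_relD(3)[OF *(1)], of B]
       tendsto_mult_left[OF uhf_relD(3)[OF *(2)], of A]] by simp
  ultimately have "(\<lambda>n. opnorm n (mmul (a n) (b n) - mmul (a' n) (b' n))) \<longlonglongrightarrow> 0"
    by (rule opn_tendsto_0I)
  then show "uhf_rel (\<lambda>n. mmul (a n) (b n)) (\<lambda>n. mmul (a' n) (b' n))"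
    using * by (simp add: uhf_rel_def uhf_seq_mmul)
qed

lift_definition scaleR_uhf :: "real \<Rightarrow> uhf \<Rightarrow> uhf" is "\<lambda>r a n. smul (complex_of_real r) (a n)"
proof -
  fix r :: real and a a' assume *: "uhf_rel a a'"
  have "opnorm n (smul (of_real r) (a n) - smul (of_real r) (a' n)) = \<bar>r\<bar> * opnorm n (a n - a' n)" for n
    using opn_smul[of n "of_real r" "a n - a' n"] by (simp add: smul_def fun_diff_def algebra_simps)
  then show "uhf_rel (\<lambda>n. smul (of_real r) (a n)) (\<lambda>n. smul (of_real r) (a' n))"
    using * tendsto_mult_left[OF uhf_relD(3)[OF *], of "\<bar>r\<bar>"] by (simp add: uhf_rel_def uhf_seq_smul)
qed

lift_definition norm_uhf :: "uhf \<Rightarrow> real" is "\<lambda>a. lim (\<lambda>n. opnorm n (a n))"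
  by (rule uhf_lim_eq[where k = 0]) (auto simp: opn_abs_diff)

definition sgn_uhf :: "uhf \<Rightarrow> uhf" where "sgn_uhf x = scaleR (inverse (norm x)) x"
definition dist_uhf :: "uhf \<Rightarrow> uhf \<Rightarrow> real" where "dist_uhf x y = norm (x - y)"
definition uniformity_uhf :: "(uhf \<times> uhf) filter" where
  "uniformity_uhf = (INF e\<in>{0<..}. principal {(x, y). dist x y < e})"
definition open_uhf :: "uhf set \<Rightarrow> bool" where
  "open_uhf U \<longleftrightarrow> (\<forall>x\<in>U. \<forall>\<^sub>F (x', y) in uniformity. x' = x \<longrightarrow> y \<in> U)"

instance
proof
  fix x y z :: uhf and r s :: real
  show "x + y + z = x + (y + z)"
    by transfer (simp add: uhf_rel_refl uhf_seq_add add.assoc uhf_relD)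
  show "x + y = y + x"
    by transfer (simp add: uhf_rel_refl uhf_seq_add add.commute uhf_relD)
  show "0 + x = x" by transfer (simp add: uhf_rel_refl uhf_relD)
  show "- x + x = 0" by transfer (simp add: uhf_rel_refl uhf_seq_0)
  show "x - y = x + - y" by transfer (simp add: uhf_rel_refl uhf_seq_diff uhf_relD)
  show "r *\<^sub>R (x + y) = r *\<^sub>R x + r *\<^sub>R y"
  proof transfer
    fix r :: real and a b assume "uhf_rel a a" "uhf_rel b b"
    moreover have "smul (of_real r) (a n + b n) = smul (of_real r) (a n) + smul (of_real r) (b n)" for n
      by (simp add: smul_def fun_eq_iff algebra_simps)
    ultimately show "uhf_rel (\<lambda>n. smul (of_real r) (a n + b n)) (\<lambda>n. smul (of_real r) (a n) + smul (of_real r) (b n))"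
      by (simp add: uhf_rel_refl uhf_seq_add uhf_seq_smul uhf_relD)
  qed
  show "(r + s) *\<^sub>R x = r *\<^sub>R x + s *\<^sub>R x"
  proof transfer
    fix r s :: real and a assume "uhf_rel a a"
    moreover have "smul (of_real (r + s)) (a n) = smul (of_real r) (a n) + smul (of_real s) (a n)" for n
      by (simp add: smul_def fun_eq_iff algebra_simps)
    ultimately show "uhf_rel (\<lambda>n. smul (of_real (r + s)) (a n)) (\<lambda>n. smul (of_real r) (a n) + smul (of_real s) (a n))"
      by (simp add: uhf_rel_refl uhf_seq_add uhf_seq_smul uhf_relD)
  qed
  show "r *\<^sub>R s *\<^sub>R x = (r * s) *\<^sub>R x"
    by transfer (simp add: smul_smul uhf_rel_refl uhf_seq_smul uhf_relD)
  show "1 *\<^sub>R x = x" by transfer (simp add: smul_1 uhf_rel_refl uhf_relD)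
  show "x * y * z = x * (y * z)"
  proof transfer
    fix a b c assume *: "uhf_rel a a" "uhf_rel b b" "uhf_rel c c"
    then have "mmul (mmul (a n) (b n)) (c n) = mmul (a n) (mmul (b n) (c n))" for n
      by (meson mmul_assoc_n uhf_seq_M3 uhf_relD)
    with * show "uhf_rel (\<lambda>n. mmul (mmul (a n) (b n)) (c n)) (\<lambda>n. mmul (a n) (mmul (b n) (c n)))"
      by (simp add: uhf_rel_refl uhf_seq_mmul uhf_relD)
  qed
  show "(x + y) * z = x * z + y * z"
  proof transfer
    fix a b c assume *: "uhf_rel a a" "uhf_rel b b" "uhf_rel c c"
    have "mmul (a n + b n) (c n) = mmul (a n) (c n) + mmul (b n) (c n)" for n
      by (simp add: mmul_def fun_eq_iff sum.distrib algebra_simps)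
    with * show "uhf_rel (\<lambda>n. mmul (a n + b n) (c n)) (\<lambda>n. mmul (a n) (c n) + mmul (b n) (c n))"
      by (simp add: uhf_rel_refl uhf_seq_mmul uhf_seq_add uhf_relD)
  qed
  show "x * (y + z) = x * y + x * z"
  proof transfer
    fix a b c assume *: "uhf_rel a a" "uhf_rel b b" "uhf_rel c c"
    have "mmul (a n) (b n + c n) = mmul (a n) (b n) + mmul (a n) (c n)" for n
      by (simp add: mmul_def fun_eq_iff sum.distrib algebra_simps)
    with * show "uhf_rel (\<lambda>n. mmul (a n) (b n + c n)) (\<lambda>n. mmul (a n) (b n) + mmul (a n) (c n))"
      by (simp add: uhf_rel_refl uhf_seq_mmul uhf_seq_add uhf_relD)
  qed
  show "r *\<^sub>R x * y = r *\<^sub>R (x * y)"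
  proof transfer
    fix r :: real and a b assume *: "uhf_rel a a" "uhf_rel b b"
    have "mmul (smul (of_real r) (a n)) (b n) = smul (of_real r) (mmul (a n) (b n))" for n
      by (simp add: mmul_def smul_def fun_eq_iff sum_distrib_left algebra_simps)
    with * show "uhf_rel (\<lambda>n. mmul (smul (of_real r) (a n)) (b n)) (\<lambda>n. smul (of_real r) (mmul (a n) (b n)))"
      by (simp add: uhf_rel_refl uhf_seq_mmul uhf_seq_smul uhf_relD)
  qed
  show "x * r *\<^sub>R y = r *\<^sub>R (x * y)"
  proof transfer
    fix r :: real and a b assume *: "uhf_rel a a" "uhf_rel b b"
    have "mmul (a n) (smul (of_real r) (b n)) = smul (of_real r) (mmul (a n) (b n))" for n
      by (simp add: mmul_def smul_def fun_eq_iff sum_distrib_left algebra_simps)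
    with * show "uhf_rel (\<lambda>n. mmul (a n) (smul (of_real r) (b n))) (\<lambda>n. smul (of_real r) (mmul (a n) (b n)))"
      by (simp add: uhf_rel_refl uhf_seq_mmul uhf_seq_smul uhf_relD)
  qed
  show "1 * x = x"
    by transfer (simp add: mmul_mid_n(1)[OF uhf_seq_M3] uhf_rel_refl uhf_relD)
  show "x * 1 = x"
    by transfer (simp add: mmul_mid_n(2)[OF uhf_seq_M3] uhf_rel_refl uhf_relD)
  show "dist x y = norm (x - y)" by (rule dist_uhf_def)
  show "sgn x = inverse (norm x) *\<^sub>R x" by (rule sgn_uhf_def)
  show "uniformity = (INF e\<in>{0<..}. principal {(x :: uhf, y). dist x y < e})"
    by (rule uniformity_uhf_def)
  show "open U \<longleftrightarrow> (\<forall>x\<in>U. \<forall>\<^sub>F (x', y) in uniformity. x' = x \<longrightarrow> y \<in> U)" for U :: "uhf set"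
    by (rule open_uhf_def)
  show n1: "norm (1::uhf) = 1" by transfer simp
  have "norm (0::uhf) = 0" by transfer simp
  then show "(0::uhf) \<noteq> 1" using n1 by force
  show "(norm x = 0) = (x = 0)"
  proof transfer
    fix a assume a: "uhf_rel a a"
    then have l: "(\<lambda>n. opnorm n (a n)) \<longlonglongrightarrow> lim (\<lambda>n. opnorm n (a n))" by (simp add: norm_uhf_tendsto uhf_relD)
    have "uhf_rel a (\<lambda>n. 0) \<longleftrightarrow> (\<lambda>n. opnorm n (a n)) \<longlonglongrightarrow> 0"
      using a uhf_seq_0 by (simp add: uhf_rel_def)
    then show "(lim (\<lambda>n. opnorm n (a n)) = 0) = uhf_rel a (\<lambda>n. 0)"
      using l limI by metis
  qed
  show "norm (x + y) \<le> norm x + norm y"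
  proof transfer
    fix a b assume "uhf_rel a a" "uhf_rel b b"
    then have *: "a \<in> uhf_seq" "b \<in> uhf_seq" by (simp_all add: uhf_relD)
    show "lim (\<lambda>n. opnorm n (a n + b n)) \<le> lim (\<lambda>n. opnorm n (a n)) + lim (\<lambda>n. opnorm n (b n))"
      by (rule LIMSEQ_le[OF norm_uhf_tendsto[OF uhf_seq_add[OF *]]
         tendsto_add[OF norm_uhf_tendsto[OF *(1)] norm_uhf_tendsto[OF *(2)]]])
         (simp add: opn_triangle)
  qed
  show "norm (x * y) \<le> norm x * norm y"
  proof transfer
    fix a b assume "uhf_rel a a" "uhf_rel b b"
    then have *: "a \<in> uhf_seq" "b \<in> uhf_seq" by (simp_all add: uhf_relD)
    show "lim (\<lambda>n. opnorm n (mmul (a n) (b n))) \<le> lim (\<lambda>n. opnorm n (a n)) * lim (\<lambda>n. opnorm n (b n))"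
      by (rule LIMSEQ_le[OF norm_uhf_tendsto[OF uhf_seq_mmul[OF *]]
         tendsto_mult[OF norm_uhf_tendsto[OF *(1)] norm_uhf_tendsto[OF *(2)]]])
         (simp add: opn_mmul)
  qed
  show "norm (r *\<^sub>R x) = \<bar>r\<bar> * norm x"
  proof transfer
    fix r :: real and a assume "uhf_rel a a"
    then have *: "a \<in> uhf_seq" by (simp add: uhf_relD)
    show "lim (\<lambda>n. opnorm n (smul (of_real r) (a n))) = \<bar>r\<bar> * lim (\<lambda>n. opnorm n (a n))"
      by (simp add: opn_smul) (rule limI, rule tendsto_mult_left, rule norm_uhf_tendsto[OF *])
  qed
qed

end

lift_definition scaleC :: "complex \<Rightarrow> uhf \<Rightarrow> uhf" is "\<lambda>c a n. smul c (a n)"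
proof -
  fix c and a a' assume *: "uhf_rel a a'"
  have "opnorm n (smul c (a n) - smul c (a' n)) = cmod c * opnorm n (a n - a' n)" for n
    using opn_smul[of n c "a n - a' n"] by (simp add: smul_def fun_diff_def algebra_simps)
  then show "uhf_rel (\<lambda>n. smul c (a n)) (\<lambda>n. smul c (a' n))"
    using * tendsto_mult_left[OF uhf_relD(3)[OF *], of "cmod c"] by (simp add: uhf_rel_def uhf_seq_smul)
qed

lift_definition star :: "uhf \<Rightarrow> uhf" is "\<lambda>a n. madj (a n)"
proof -
  fix a a' assume *: "uhf_rel a a'"
  have "opnorm n (madj (a n) - madj (a' n)) = opnorm n (a n - a' n)" for n
    using opn_madj[of n "a n - a' n"] by (simp add: madj_def fun_diff_def)
  then show "uhf_rel (\<lambda>n. madj (a n)) (\<lambda>n. madj (a' n))"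
    using * by (simp add: uhf_rel_def uhf_seq_madj)
qed

lemma uhf_cstar_identity: "norm (star x * x) = (norm x)\<^sup>2"
proof transfer
  fix a assume "uhf_rel a a"
  then have *: "a \<in> uhf_seq" by (simp add: uhf_relD)
  show "lim (\<lambda>n. opnorm n (mmul (madj (a n)) (a n))) = (lim (\<lambda>n. opnorm n (a n)))\<^sup>2"
    by (simp add: opn_cstar) (rule limI, rule tendsto_power, rule norm_uhf_tendsto[OF *])
qed

lemma Quotient_rep: "rep_uhf a \<in> uhf_seq" "abs_uhf (rep_uhf a) = a"
  using Quotient3_rep_reflp[OF Quotient3_uhf] Quotient3_abs_rep[OF Quotient3_uhf]
  by (auto simp: uhf_rel_def)

lemma norm_abs_uhf_diff:
  assumes "a \<in> uhf_seq" "b \<in> uhf_seq"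
  shows "norm (abs_uhf a - abs_uhf b) = lim (\<lambda>n. opnorm n (a n - b n))"
  using assms by (simp add: minus_uhf.abs_eq norm_uhf.abs_eq uhf_rel_refl uhf_seq_diff)

lemma norm_iota_diff:
  assumes "x \<in> M3 n" "y \<in> M3 (n + k)"
  shows "norm (iota (n + k) y - iota n x) = opnorm (n + k) (y - x \<otimes> mid k)"
proof -
  have "\<forall>\<^sub>F m in sequentially. opnorm m (const_seq (n + k) y m - const_seq n x m) = opnorm (n + k) (y - x \<otimes> mid k)"
    unfolding eventually_sequentially
  proof (intro exI allI impI)
    fix m assume m: "n + k \<le> m"
    then have "const_seq (n + k) y m - const_seq n x m = (y - x \<otimes> mid k) \<otimes> mid (m - (n + k))"
      by (simp add: const_seq_def tens_minus tens_mid_add[OF assms(1)])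
    then show "opnorm m (const_seq (n + k) y m - const_seq n x m) = opnorm (n + k) (y - x \<otimes> mid k)"
      using opn_tens_mid[of "y - x \<otimes> mid k" "n + k" "m - (n + k)"] m assms
      by (simp add: M3_closed M3_tens)
  qed
  then have "lim (\<lambda>m. opnorm m (const_seq (n + k) y m - const_seq n x m)) = opnorm (n + k) (y - x \<otimes> mid k)"
    by (intro limI) (rule tendsto_eventually)
  then show ?thesis
    using assms by (simp add: iota_def norm_abs_uhf_diff uhf_seq_const)
qed

lemma iota_tens_mid: assumes "x \<in> M3 n" shows "iota (n + k) (x \<otimes> mid k) = iota n x"
  using norm_iota_diff[OF assms M3_tens[OF assms M3_closed(2)], of k] by simp

lemma tens_0: "(0::wmat) \<otimes> x = 0"
  by (simp add: tens_def fun_eq_iff)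

lemma norm_iota: assumes "x \<in> M3 n" shows "norm (iota n x) = opnorm n x"
proof -
  have "iota n (0::wmat) = 0"
  proof -
    have "const_seq n (0::wmat) = (\<lambda>n. 0)" by (rule ext) (simp add: const_seq_def tens_0)
    then show ?thesis by (simp add: iota_def zero_uhf_def)
  qed
  moreover have "(0::wmat) \<otimes> mid 0 = 0" by (rule tens_0)
  ultimately show ?thesis
    using norm_iota_diff[of 0 n x 0] assms M3_closed(1)[of n] by simp
qed

lemma norm_abs_iota_diff:
  assumes "a \<in> uhf_seq" "\<And>k. opnorm (n + k) (a (n + k) - a n \<otimes> mid k) \<le> e"
  shows "norm (abs_uhf a - iota n (a n)) \<le> e"
proof -
  have c: "const_seq n (a n) \<in> uhf_seq" by (intro uhf_seq_const uhf_seq_M3 assms)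
  have "(\<lambda>m. opnorm m (a m - const_seq n (a n) m)) \<longlonglongrightarrow> norm (abs_uhf a - iota n (a n))"
    unfolding iota_def norm_abs_uhf_diff[OF assms(1) c]
    by (rule norm_uhf_tendsto) (intro uhf_seq_diff assms c)
  then show ?thesis
  proof (rule LIMSEQ_le_const2, intro exI allI impI)
    fix m assume "n \<le> m"
    then show "opnorm m (a m - const_seq n (a n) m) \<le> e"
      using assms(2)[of "m - n"] by (simp add: const_seq_def)
  qed
qed

lemma iota_tendsto: assumes "a \<in> uhf_seq" shows "(\<lambda>n. iota n (a n)) \<longlonglongrightarrow> abs_uhf a"
proof (rule metric_LIMSEQ_I)
  fix e :: real assume "e > 0"
  then have "e / 2 > 0" by simp
  then obtain N where N: "\<And>n k. n \<ge> N \<Longrightarrow> opnorm (n + k) (a (n + k) - a n \<otimes> mid k) < e / 2"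
    using uhf_seqD[OF assms] by blast
  have "dist (iota n (a n)) (abs_uhf a) < e" if "n \<ge> N" for n
    using norm_abs_iota_diff[OF assms, of n "e / 2"] N[OF that] \<open>e > 0\<close>
    by (auto simp: dist_norm norm_minus_commute less_imp_le)
  then show "\<exists>no. \<forall>n\<ge>no. dist (iota n (a n)) (abs_uhf a) < e" by blast
qed

lemma Cauchy_iota:
  assumes "\<And>n. b n \<in> M3 n" "Cauchy (\<lambda>n. iota n (b n))"
  shows "b \<in> uhf_seq"
proof (rule uhf_seqI[OF assms(1)])
  fix e :: real assume "e > 0"
  then obtain N where N: "\<And>m n. m \<ge> N \<Longrightarrow> n \<ge> N \<Longrightarrow> dist (iota m (b m)) (iota n (b n)) < e"
    using assms(2) unfolding Cauchy_def by blast
  show "\<exists>N. \<forall>n\<ge>N. \<forall>k. opnorm (n + k) (b (n + k) - b n \<otimes> mid k) < e"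
    using N by (intro exI[of _ N]) (simp add: norm_iota_diff[OF assms(1) assms(1), symmetric] dist_norm)
qed

instance uhf :: banach
proof
  fix X :: "nat \<Rightarrow> uhf" assume X: "Cauchy X"
  define P where "P m i \<longleftrightarrow> (\<exists>b\<in>M3 m. dist (X i) (iota m b) < 1 / Suc i)" for m i
  have P: "\<forall>\<^sub>F m in sequentially. P m i" for i
  proof -
    have "(\<lambda>n. iota n (rep_uhf (X i) n)) \<longlonglongrightarrow> X i"
      using iota_tendsto[OF Quotient_rep(1)] by (simp add: Quotient_rep)
    then have "\<forall>\<^sub>F m in sequentially. dist (iota m (rep_uhf (X i) m)) (X i) < 1 / Suc i"
      by (rule tendstoD) simp
    then show ?thesis
      by (rule eventually_mono)
        (use uhf_seq_M3[OF Quotient_rep(1)] in \<open>auto simp: P_def dist_commute\<close>)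
  qed
  define I where "I m = Max (insert 0 {i. i \<le> m \<and> P m i})" for m
  have I_ge: "\<forall>\<^sub>F m in sequentially. P m (I m) \<and> i \<le> I m" for i
    using P[of i] eventually_ge_at_top[of i]
  proof eventually_elim
    case (elim m)
    let ?S = "{i. i \<le> m \<and> P m i}"
    have ne: "i \<in> ?S" "finite ?S" using elim by auto
    have "I m \<in> insert 0 ?S" unfolding I_def by (rule Max_in) auto
    moreover have "i \<le> I m" unfolding I_def by (rule Max_ge) (use ne in auto)
    ultimately show ?case using elim(1) by auto
  qed
  have I: "filterlim I at_top sequentially"
    unfolding filterlim_at_top by (intro allI eventually_mono[OF I_ge]) auto
  define b where "b m = (if P m (I m) then SOME b. b \<in> M3 m \<and> dist (X (I m)) (iota m b) < 1 / Suc (I m) else 0)" for m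
  have b: "b m \<in> M3 m \<and> dist (X (I m)) (iota m (b m)) < 1 / Suc (I m)" if "P m (I m)" for m
    using someI_ex[of "\<lambda>b. b \<in> M3 m \<and> dist (X (I m)) (iota m b) < 1 / Suc (I m)"] that
    by (auto simp: b_def P_def)
  then have bM: "b m \<in> M3 m" for m using M3_closed(1) by (cases "P m (I m)") (auto simp: b_def)
  have *: "(\<lambda>m. 1 / Suc (I m)) \<longlonglongrightarrow> 0"
    using filterlim_compose[OF LIMSEQ_inverse_real_of_nat I] by (simp add: inverse_eq_divide)
  have d: "(\<lambda>m. X (I m) - iota m (b m)) \<longlonglongrightarrow> 0"
    by (rule Lim_null_comparison[OF _ *], rule eventually_mono[OF I_ge[of 0]])
       (use b in \<open>auto simp: dist_norm intro: less_imp_le\<close>)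
  have XI: "Cauchy (\<lambda>m. X (I m))"
  proof (rule metric_CauchyI)
    fix e :: real assume "e > 0"
    then obtain N where N: "\<And>m n. m \<ge> N \<Longrightarrow> n \<ge> N \<Longrightarrow> dist (X m) (X n) < e"
      using X unfolding Cauchy_def by blast
    obtain M where "\<And>m. m \<ge> M \<Longrightarrow> N \<le> I m"
      using I unfolding filterlim_at_top eventually_sequentially by blast
    then show "\<exists>M. \<forall>m\<ge>M. \<forall>n\<ge>M. dist (X (I m)) (X (I n)) < e" using N by blast
  qed
  have "Cauchy (\<lambda>m. iota m (b m))"
  proof (rule metric_CauchyI)
    fix e :: real assume e: "e > 0"
    then obtain M where M: "\<And>m n. m \<ge> M \<Longrightarrow> n \<ge> M \<Longrightarrow> dist (X (I m)) (X (I n)) < e / 3"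
      using XI unfolding Cauchy_def by (meson divide_pos_pos zero_less_numeral)
    obtain M' where M': "\<And>m. m \<ge> M' \<Longrightarrow> dist (X (I m)) (iota m (b m)) < e / 3"
      using tendstoD[OF d, of "e / 3"] e by (auto simp: eventually_sequentially dist_norm)
    show "\<exists>M. \<forall>m\<ge>M. \<forall>n\<ge>M. dist (iota m (b m)) (iota n (b n)) < e"
    proof (intro exI allI impI)
      fix m n assume "max M M' \<le> m" "max M M' \<le> n"
      then show "dist (iota m (b m)) (iota n (b n)) < e"
        using M[of m n] M'[of m] M'[of n] dist_triangle[of "iota m (b m)" "iota n (b n)" "X (I m)"]
          dist_triangle[of "X (I m)" "iota n (b n)" "X (I n)"]
        by (simp add: dist_commute)
    qed
  qed
  then have "b \<in> uhf_seq" using bM by (intro Cauchy_iota)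
  from tendsto_add[OF iota_tendsto[OF this] d] have L: "(\<lambda>m. X (I m)) \<longlonglongrightarrow> abs_uhf b" by simp
  have "X \<longlonglongrightarrow> abs_uhf b"
  proof (rule metric_LIMSEQ_I)
    fix e :: real assume e: "e > 0"
    then obtain N where N: "\<And>m n. m \<ge> N \<Longrightarrow> n \<ge> N \<Longrightarrow> dist (X m) (X n) < e/2"
      using X unfolding Cauchy_def by (meson half_gt_zero)
    have "\<forall>\<^sub>F m in sequentially. dist (X (I m)) (abs_uhf b) < e/2"
      using e by (intro tendstoD[OF L]) simp
    with I_ge[of N] have "\<forall>\<^sub>F m in sequentially. N \<le> I m \<and> dist (X (I m)) (abs_uhf b) < e/2"
      by eventually_elim auto
    then obtain m where m: "N \<le> I m" "dist (X (I m)) (abs_uhf b) < e/2"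
      by (auto simp: eventually_sequentially)
    show "\<exists>no. \<forall>n\<ge>no. dist (X n) (abs_uhf b) < e"
    proof (intro exI allI impI)
      fix n assume "n \<ge> N"
      then show "dist (X n) (abs_uhf b) < e"
        using N[of n "I m"] m dist_triangle[of "X n" "abs_uhf b" "X (I m)"] by linarith
    qed
  qed
  then show "convergent X" by (auto simp: convergent_def)
qed

text \<open>
  The trace \<open>\<tau>\<^sub>3\<^sup>\<otimes>\<^sup>\<nat>\<close>; see \<open>tau_inf_iota\<close> below.
\<close>

lift_definition tau_inf :: "uhf \<Rightarrow> complex" is "\<lambda>a. lim (\<lambda>n. ntr n (a n))"
proof (rule uhf_lim_eq[where k = 0])
  fix a b :: "nat \<Rightarrow> wmat" and n
  have "ntr n (a n) - ntr n (b n) = ntr n (a n - b n)"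
    by (simp add: ntr_def sum_subtractf diff_divide_distrib)
  then show "cmod (ntr n (a n) - ntr n (b n)) \<le> opnorm (n + 0) (a (n + 0) - b (n + 0))"
    using cmod_ntr[of n "a n - b n"] by simp
qed

text \<open>
  \<open>slice n p\<close> maps \<open>M3 (n + p)\<close> to \<open>M3 n\<close>, applying \<open>x \<mapsto> x\<^sub>2\<^sub>2\<close> to the last \<open>p\<close> tensor
  factors (lemma \<open>slice_tens\<close>); \<open>rho m\<close> is its extension to the completion (lemma \<open>rho_iota\<close>).
\<close>

definition slice :: "nat \<Rightarrow> nat \<Rightarrow> wmat \<Rightarrow> wmat" where
  "slice n p x = (\<lambda>u v. if u \<in> words n \<and> v \<in> words n
     then x (u @ replicate p 2) (v @ replicate p 2) else 0)"

lift_definition rho :: "nat \<Rightarrow> uhf \<Rightarrow> wmat" is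
  "\<lambda>m a u v. lim (\<lambda>p. slice (m + 1) p (a (p + (m + 1))) u v)"
proof (intro ext)
  fix m u v and a b assume ab: "uhf_rel a b"
  show "lim (\<lambda>p. slice (m + 1) p (a (p + (m + 1))) u v) = lim (\<lambda>p. slice (m + 1) p (b (p + (m + 1))) u v)"
  proof (rule uhf_lim_eq[OF ab, where k = "m + 1"])
    fix p
    show "norm (slice (m + 1) p (a (p + (m + 1))) u v - slice (m + 1) p (b (p + (m + 1))) u v)
       \<le> opnorm (p + (m + 1)) (a (p + (m + 1)) - b (p + (m + 1)))"
      using opn_entry[of "u @ replicate p 2" "p + (m + 1)" "v @ replicate p 2" "a (p + (m + 1)) - b (p + (m + 1))"]
      by (auto simp: slice_def words_iff)
  qed
qed

lemma vector_space_smul: "vector_space smul"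
  by unfold_locales (auto simp: smul_def fun_eq_iff algebra_simps)

lemma ntr_tens_mid: assumes "x \<in> M3 n" shows "ntr (n + k) (x \<otimes> mid k) = ntr n x"
proof -
  have "(\<Sum>u\<in>words (n + k). (x \<otimes> mid k) u u) = (\<Sum>p\<in>words n. \<Sum>q\<in>words k. x p p)"
    unfolding sum_words_add by (intro sum.cong refl) (simp add: tens_mid_append[OF assms])
  then show ?thesis by (simp add: ntr_def card_words power_add sum_distrib_left[symmetric])
qed

lemma tau_inf_iota: assumes "x \<in> M3 n" shows "tau_inf (iota n x) = ntr n x"
proof -
  have "\<forall>\<^sub>F m in sequentially. ntr m (const_seq n x m) = ntr n x"
    unfolding eventually_sequentially
  proof (intro exI allI impI)
    fix m assume "n \<le> m"
    then show "ntr m (const_seq n x m) = ntr n x"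
      using ntr_tens_mid[OF assms, of "m - n"] by (simp add: const_seq_def)
  qed
  then have "lim (\<lambda>m. ntr m (const_seq n x m)) = ntr n x"
    by (intro limI) (rule tendsto_eventually)
  then show ?thesis
    by (simp add: iota_def tau_inf.abs_eq uhf_rel_refl uhf_seq_const assms)
qed

lemma slice_tens:
  assumes "x \<in> M3 n"
  shows "slice n p (x \<otimes> y) = smul (y (replicate p 2) (replicate p 2)) x"
  using M3_0[OF assms] by (auto simp: slice_def smul_def tens_apply[OF assms] fun_eq_iff words_iff)

lemma slice_tens_mid:
  assumes "x \<in> M3 (n + p)"
  shows "slice n (p + k) (x \<otimes> mid k) = slice n p x"
  by (auto simp: slice_def tens_apply[OF assms] fun_eq_iff words_iff replicate_add mid_def)

lemma rho_iota:
  assumes "x \<in> M3 (m + 1 + p)"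
  shows "rho m (iota (m + 1 + p) x) = slice (m + 1) p x"
proof -
  have "lim (\<lambda>q. slice (m + 1) q (const_seq (m + 1 + p) x (q + (m + 1))) u v) = slice (m + 1) p x u v" for u v
  proof (rule limI, rule tendsto_eventually)
    show "\<forall>\<^sub>F q in sequentially. slice (m + 1) q (const_seq (m + 1 + p) x (q + (m + 1))) u v = slice (m + 1) p x u v"
      unfolding eventually_sequentially
    proof (intro exI allI impI)
      fix q assume "p \<le> q"
      then show "slice (m + 1) q (const_seq (m + 1 + p) x (q + (m + 1))) u v = slice (m + 1) p x u v"
        using slice_tens_mid[OF assms, of "q - p"] by (simp add: const_seq_def)
    qed
  qed
  moreover have "uhf_rel (const_seq (m + 1 + p) x) (const_seq (m + 1 + p) x)"
    by (intro uhf_rel_refl uhf_seq_const assms)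
  ultimately show ?thesis
    unfolding iota_def by (simp only: rho.abs_eq fun_eq_iff simp_thms)
qed

section \<open>The algebras \<open>calA n\<close> and \<open>calA_inf\<close>\<close>

definition munit :: "3 \<Rightarrow> 3 \<Rightarrow> wmat" where
  "munit i j = (\<lambda>u v. if u = [i] \<and> v = [j] then 1 else 0)"

primrec tpow :: "wmat \<Rightarrow> nat \<Rightarrow> wmat" where
  "tpow x 0 = mid 0"
| "tpow x (Suc n) = x \<otimes> tpow x n"

definition alpha :: "nat \<Rightarrow> 3 \<Rightarrow> wmat" where
  "alpha n j = munit j j \<otimes> tpow (munit 2 2) n"

definition beta :: "nat \<Rightarrow> 3 \<Rightarrow> wmat" where
  "beta k j = (munit j j \<otimes> munit 1 1 + munit (j + 2) (j + 2) \<otimes> munit 3 3) \<otimes> tpow (munit 2 2) (k - 1)"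

text \<open>
  The elements of \<open>calA n\<close> lie in \<open>M3 (n + 1)\<close>, whence the shift in \<open>calA_inf\<close>.
\<close>

definition calA :: "nat \<Rightarrow> wmat set" where
  "calA n = module.span smul
     (range (alpha n) \<union> {x \<otimes> beta k j | x k j. 1 \<le> k \<and> k \<le> n \<and> x \<in> M3 (n - k)})"

definition calA_inf :: "uhf set" where
  "calA_inf = {a. \<exists>x. (\<forall>n. x n \<in> calA n) \<and> (\<lambda>n. iota (n + 1) (x n)) \<longlonglongrightarrow> a}"

definition is_expansion :: "nat \<Rightarrow> wmat \<Rightarrow> (3 \<Rightarrow> complex) \<Rightarrow> (nat \<Rightarrow> 3 \<Rightarrow> wmat) \<Rightarrow> bool" where
  "is_expansion n b x y \<longleftrightarrow> (\<forall>k<n. \<forall>j. y k j \<in> M3 k) \<and>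
     b = (\<Sum>j\<in>UNIV. smul (x j) (alpha n j)) + (\<Sum>k<n. \<Sum>j\<in>UNIV. y k j \<otimes> beta (n - k) j)"

text \<open>
  Coefficients of the unique expansion of \<open>b \<in> calA n\<close>; \<open>eta n k j\<close> is for \<open>k < n\<close> only.
  The value \<open>eta n 0 j b\<close> is a complex number regarded as an element of \<open>M3 0\<close>.
\<close>

definition xi :: "nat \<Rightarrow> 3 \<Rightarrow> wmat \<Rightarrow> complex" where
  "xi n j b = (THE c. \<exists>x y. is_expansion n b x y \<and> c = x j)"

definition eta :: "nat \<Rightarrow> nat \<Rightarrow> 3 \<Rightarrow> wmat \<Rightarrow> wmat" where
  "eta n k j b = (THE z. \<exists>x y. is_expansion n b x y \<and> z = y k j)"

section \<open>Tracial states\<close>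

definition chi :: "3 \<Rightarrow> uhf \<Rightarrow> complex" where
  "chi j a = xi 0 j (rho 0 a)"

definition tau_fin :: "nat \<Rightarrow> 3 \<Rightarrow> uhf \<Rightarrow> complex" where
  "tau_fin m j a = ntr (m - 1) (eta m (m - 1) j (rho m a))"

text \<open>
  \<open>B\<close> is a \<open>C\<^sup>*\<close>-subalgebra containing 1, where a positive functional is a state iff it is unital.
  This applies to \<open>calA_inf\<close>: the unit of \<open>M3 (n + 1)\<close> is the sum of all \<open>alpha n j\<close> and all
  \<open>mid (n - k) \<otimes> beta k j\<close>.
\<close>

definition tracial_state_on :: "uhf set \<Rightarrow> (uhf \<Rightarrow> complex) \<Rightarrow> bool" where
  "tracial_state_on B \<phi> \<longleftrightarrow>
     (\<forall>a\<in>B. \<forall>b\<in>B. \<phi> (a + b) = \<phi> a + \<phi> b) \<and>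
     (\<forall>c. \<forall>a\<in>B. \<phi> (scaleC c a) = c * \<phi> a) \<and>
     (\<forall>a\<in>B. \<phi> (star a * a) \<in> \<real>\<^sub>\<ge>\<^sub>0) \<and>
     \<phi> 1 = 1 \<and>
     (\<forall>a\<in>B. \<forall>b\<in>B. \<phi> (a * b) = \<phi> (b * a))"

text \<open>
  The values \<open>lm 0 j\<close> and \<open>tau_fin 0 j\<close> are never used.
\<close>

definition is_decomposition ::
    "(uhf \<Rightarrow> complex) \<Rightarrow> real \<Rightarrow> (3 \<Rightarrow> real) \<Rightarrow> (nat \<Rightarrow> 3 \<Rightarrow> real) \<Rightarrow> bool" where
  "is_decomposition \<phi> l_inf l lm \<longleftrightarrow>
     0 \<le> l_inf \<and> (\<forall>j. 0 \<le> l j) \<and> (\<forall>m\<ge>1. \<forall>j. 0 \<le> lm m j) \<and>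
     (\<lambda>(m, j). lm m j) summable_on {1..} \<times> UNIV \<and>
     l_inf + (\<Sum>j\<in>UNIV. l j) + (\<Sum>\<^sub>\<infinity>(m, j)\<in>{1..} \<times> UNIV. lm m j) = 1 \<and>
     (\<forall>a\<in>calA_inf.
        (\<lambda>(m, j). of_real (lm m j) * tau_fin m j a) summable_on {1..} \<times> UNIV \<and>
        \<phi> a = of_real l_inf * tau_inf a + (\<Sum>j\<in>UNIV. of_real (l j) * chi j a)
          + (\<Sum>\<^sub>\<infinity>(m, j)\<in>{1..} \<times> UNIV. of_real (lm m j) * tau_fin m j a))"

end

theory Submission
  imports Defs
begin

text \<open>
  The algebra \<open>calA m\<close> is a direct sum of three copies of the complex numbers and of three copies of
  each \<open>M3 k\<close>, \<open>k < m\<close>, so its traces are combinations of the characters \<open>xi\<close> and of the normalized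
  traces of these copies. Let \<open>J\<^sub>m\<close> be the kernel of \<open>rho m\<close> on \<open>calA_inf\<close>. A tracial state
  \<open>\<tau>\<close> splits as \<open>\<omega> + f\<close>, where \<open>f x = lim \<tau> (c x)\<close> along an approximate unit \<open>c\<close> of \<open>J\<^sub>m\<close> (in
  the trace seminorm) and \<open>\<omega>\<close> vanishes on \<open>J\<^sub>m\<close>. Hence \<open>\<omega>\<close> is a trace of \<open>calA m\<close>, and its
  coefficients turn out not to depend on \<open>m\<close>. The functional \<open>f\<close> makes sense and is tracial on all
  multipliers of \<open>J\<^sub>m\<close> in the UHF algebra; these include \<open>M3 m\<close>, on which \<open>f\<close> is therefore a
  multiple of \<open>ntr m\<close>. As \<open>m\<close> grows, every element of \<open>calA_inf\<close> is approximated by \<open>M3 m\<close>, so the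
  remainders converge to a multiple of \<open>tau_inf\<close>.

  For uniqueness, the decomposition is evaluated at norm-one lifts of the unit of a fixed summand of
  \<open>calA m\<close>: as \<open>m\<close> grows, all terms but one become small, since that unit has small trace in
  \<open>M3 (m + 1)\<close>.
\<close>

section \<open>Positivity and square roots in the UHF algebra\<close>

text \<open>The obstacle is that \<open>M3 m\<close> is not contained in \<open>calA_inf\<close>, so
  a tracial state \<open>\<tau>\<close> gives no values there, and since the UHF algebra has only
  one tracial state, \<open>\<tau>\<close> has in general no tracial extension. What helps is the
  shape of \<open>J\<^sub>m\<close>: if the slice to level \<open>m\<close> of an element of
  \<open>calA n\<close> is 0, then only expansion coefficients in \<open>M3 k\<close> with
  \<open>k \<ge> m\<close> survive, and these may be multiplied by \<open>M3 m\<close>.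

  Splitting a trace along an ideal is usually done by a central projection in the weak closure of
  the GNS representation. Here a variational argument inside the UHF algebra replaces it: among the
  contractions \<open>t\<close> congruent to 1 modulo the ideal, \<open>\<tau> (star t * t)\<close>
  is nearly minimized. A further factor that differs from 1 by an element of the ideal can then
  lower the value only slightly, which forces \<open>\<tau> (star t * t * z)\<close> to be small for
  \<open>z\<close> in the ideal. The only functional calculus required is the binomial series of a
  square root.\<close>

lemma star_star [simp]: "star (star a) = a"
  by transfer (simp add: uhf_rel_refl uhf_relD)

lemma star_add: "star (a + b) = star a + star b"
proof transfer
  fix a b assume *: "uhf_rel a a" "uhf_rel b b"
  have "madj (x + y) = madj x + madj y" for x y by (simp add: madj_def fun_eq_iff)
  then show "uhf_rel (\<lambda>n. madj (a n + b n)) (\<lambda>n. madj (a n) + madj (b n))"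
    using * by (simp add: uhf_rel_refl uhf_seq_add uhf_seq_madj uhf_relD)
qed

lemma star_scaleC: "star (scaleC c a) = scaleC (cnj c) (star a)"
proof transfer
  fix c a assume *: "uhf_rel a a"
  have "madj (smul c x) = smul (cnj c) (madj x)" for x by (simp add: madj_def smul_def fun_eq_iff)
  then show "uhf_rel (\<lambda>n. madj (smul c (a n))) (\<lambda>n. smul (cnj c) (madj (a n)))"
    using * by (simp add: uhf_rel_refl uhf_seq_smul uhf_seq_madj uhf_relD)
qed

lemma madj_mmul: "x \<in> M3 n \<Longrightarrow> y \<in> M3 n \<Longrightarrow> madj (mmul x y) = mmul (madj y) (madj x)"
proof (intro ext)
  fix u v assume xy: "x \<in> M3 n" "y \<in> M3 n"
  have M: "madj (mmul x y) \<in> M3 n" "mmul (madj y) (madj x) \<in> M3 n"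
    using xy by (simp_all add: M3_closed M3_mmul)
  show "madj (mmul x y) u v = mmul (madj y) (madj x) u v"
  proof (cases "u \<in> words n \<and> v \<in> words n")
    case True
    then show ?thesis by (simp add: mmul_def madj_def words_iff mult.commute)
  next
    case False
    then show ?thesis using M3_0[OF M(1)] M3_0[OF M(2)] by metis
  qed
qed

lemma star_mult: "star (a * b) = star b * star a"
proof transfer
  fix a b assume *: "uhf_rel a a" "uhf_rel b b"
  then have "madj (mmul (a n) (b n)) = mmul (madj (b n)) (madj (a n))" for n
    by (intro madj_mmul[of _ n] uhf_seq_M3 uhf_relD(1))
  then show "uhf_rel (\<lambda>n. madj (mmul (a n) (b n))) (\<lambda>n. mmul (madj (b n)) (madj (a n)))"
    using * by (simp add: uhf_rel_refl uhf_seq_mmul uhf_seq_madj uhf_relD)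
qed

lemma norm_star [simp]: "norm (star a) = norm a"
  by transfer simp

lemma scaleC_1 [simp]: "scaleC 1 a = a"
  by transfer (simp add: smul_1 uhf_rel_refl uhf_relD)

lemma scaleR_scaleC: "r *\<^sub>R a = scaleC (of_real r) a"
  by transfer (simp add: uhf_rel_refl uhf_seq_smul uhf_relD)

lemma scaleC_mult: "scaleC c a * b = scaleC c (a * b)" "a * scaleC c b = scaleC c (a * b)"
proof -
  have "mmul (smul c x) y = smul c (mmul x y)" "mmul x (smul c y) = smul c (mmul x y)" for x y
    by (simp_all add: mmul_def smul_def sum_distrib_left algebra_simps)
  then show "scaleC c a * b = scaleC c (a * b)" "a * scaleC c b = scaleC c (a * b)"
    by (transfer, simp add: uhf_rel_refl uhf_seq_smul uhf_seq_mmul uhf_relD)+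
qed

lemma scaleC_add: "scaleC c (a + b) = scaleC c a + scaleC c b"
proof -
  have *: "scaleC c x = scaleC c 1 * x" for x by (simp add: scaleC_mult)
  show ?thesis unfolding *[of "a + b"] *[of a] *[of b] by (rule distrib_left)
qed

lemma scaleC_scaleC: "scaleC c (scaleC d a) = scaleC (c * d) a"
  by transfer (simp add: smul_smul uhf_rel_refl uhf_seq_smul uhf_relD)

lemma norm_scaleC: "norm (scaleC c a) = cmod c * norm a"
proof transfer
  fix c a assume "uhf_rel a a"
  then show "lim (\<lambda>n. opnorm n (smul c (a n))) = cmod c * lim (\<lambda>n. opnorm n (a n))"
    by (simp add: opn_smul) (intro limI tendsto_mult_left norm_uhf_tendsto uhf_relD)
qed

lemma star_scaleR: "star (r *\<^sub>R a) = r *\<^sub>R star a"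
  by (simp add: scaleR_scaleC star_scaleC)

lemma bounded_linear_star: "bounded_linear star"
  by (rule bounded_linear_intro[where K = 1]) (simp_all add: star_add star_scaleR)

lemmas star_diff = linear_diff[OF bounded_linear.linear[OF bounded_linear_star]]
lemmas tendsto_star = bounded_linear.tendsto[OF bounded_linear_star]

lemma star_1 [simp]: "star 1 = 1"
  by (metis mult_1_right star_mult star_star)

lemma star_power: "star (a ^ n) = star a ^ n"
  by (induction n) (simp_all add: star_mult power_commutes)

text \<open>For a matrix \<open>x\<close> and a vector \<open>v\<close>, the squared norm of
  \<open>r v - x\<^sup>* x v\<close> is \<open>r\<^sup>2 |v|\<^sup>2 - 2 r |x v|\<^sup>2 +
  |x\<^sup>* x v|\<^sup>2\<close>, and the last term is at most \<open>r |x v|\<^sup>2\<close> if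
  \<open>r\<close> bounds the squared norm of \<open>x\<close>. In the completion,
  \<open>norm z \<le> 1\<close> does not bound the members of a representing sequence by 1, whence
  the detour through \<open>norm z < 1\<close>.\<close>

lemma norm_one_minus_star_mult:
  assumes "norm z \<le> 1" shows "norm (1 - star z * z) \<le> 1"
proof -
  have M: "opnorm n (smul (of_real r) (mid n) - mmul (madj x) x) \<le> r" 
    if x: "x \<in> M3 n" and r: "(opnorm n x)\<^sup>2 \<le> r" for n x r
  proof (rule opn_least)
    show r0: "0 \<le> r" using r by (meson order_trans zero_le_power2)
    fix v
    let ?w = "mvec n x v" and ?y = "mvec n (mmul (madj x) x) v"
    have e: "?y u = mvec n (madj x) ?w u" if "u \<in> words n" for u
    proof -
      have "length u = n" using that by (simp add: words_iff)
      then have "?y u = (\<Sum>w\<in>words n. \<Sum>w'\<in>words n. madj x u w' * x w' w * v w)"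
        by (simp add: mvec_def mmul_def sum_distrib_right)
      also have "\<dots> = (\<Sum>w'\<in>words n. \<Sum>w\<in>words n. madj x u w' * x w' w * v w)"
        by (rule sum.swap)
      finally show ?thesis by (simp add: mvec_def sum_distrib_left mult.assoc)
    qed
    have l: "mvec n (smul (of_real r) (mid n) - mmul (madj x) x) v u = of_real r * v u - ?y u"
      if "u \<in> words n" for u
    proof -
      have "(\<Sum>w\<in>words n. mid n u w * v w) = v u"
        using that by (simp add: mid_def if_distrib[of "\<lambda>x. x * _"] cong: if_cong)
      then have "of_real r * v u = (\<Sum>w\<in>words n. of_real r * (mid n u w * v w))"
        by (simp only: sum_distrib_left[symmetric])
      then show ?thesis
        by (simp add: mvec_def smul_def left_diff_distrib sum_subtractf mult.assoc)
    qed
    have p: "(cmod (of_real r * a - b))\<^sup>2 = r\<^sup>2 * (cmod a)\<^sup>2 - 2 * r * Re (b * cnj a) + (cmod b)\<^sup>2" for a b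
      by (simp only: cmod_power2) (simp add: power2_eq_square algebra_simps)
    have "(\<Sum>u\<in>words n. ?y u * cnj (v u)) = (\<Sum>u\<in>words n. ?w u * cnj (?w u))"
      using inner_mvec_madj[where v = ?w and w = v and x = x and n = n] by (simp only: e cong: sum.cong)
    then have i: "(\<Sum>u\<in>words n. Re (?y u * cnj (v u))) = (vnorm n ?w)\<^sup>2"
      unfolding inner_self by (metis Re_complex_of_real Re_sum)
    have "vnorm n ?y = vnorm n (mvec n (madj x) ?w)" by (rule vnorm_cong) (simp add: e)
    also have "\<dots> \<le> opnorm n x * vnorm n ?w" using opn_bound[of n "madj x" ?w] by simp
    finally have "(vnorm n ?y)\<^sup>2 \<le> (opnorm n x * vnorm n ?w)\<^sup>2" by (intro power_mono) auto
    also have "\<dots> \<le> r * (vnorm n ?w)\<^sup>2" unfolding power_mult_distrib by (intro mult_right_mono r) auto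
    finally have y: "(vnorm n ?y)\<^sup>2 \<le> r * (vnorm n ?w)\<^sup>2" .
    have "(vnorm n (mvec n (smul (of_real r) (mid n) - mmul (madj x) x) v))\<^sup>2
        = (\<Sum>u\<in>words n. r\<^sup>2 * (cmod (v u))\<^sup>2 - 2 * r * Re (?y u * cnj (v u)) + (cmod (?y u))\<^sup>2)"
      unfolding vnorm_sq by (rule sum.cong) (simp_all only: l p)
    then have s: "(vnorm n (mvec n (smul (of_real r) (mid n) - mmul (madj x) x) v))\<^sup>2
        = r\<^sup>2 * (vnorm n v)\<^sup>2 - 2 * r * (vnorm n ?w)\<^sup>2 + (vnorm n ?y)\<^sup>2"
      unfolding sum.distrib sum_subtractf sum_distrib_left[symmetric] i vnorm_sq .
    have le: "c - 2 * r * B + A \<le> c" if "A \<le> r * B" "0 \<le> B" for A B c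
      using that mult_nonneg_nonneg[OF r0 that(2)] by (simp add: mult.assoc)
    have "(vnorm n (mvec n (smul (of_real r) (mid n) - mmul (madj x) x) v))\<^sup>2 \<le> (r * vnorm n v)\<^sup>2"
      unfolding power_mult_distrib s by (rule le[OF y zero_le_power2])
    then show "vnorm n (mvec n (smul (of_real r) (mid n) - mmul (madj x) x) v) \<le> r * vnorm n v"
      by (rule power2_le_imp_le) (intro mult_nonneg_nonneg r0 vnorm_nonneg)
  qed
  \<comment> \<open>The scalar 1 is kept as a variable \<open>r\<close> so that transfer yields the
    matrix expression bounded in \<open>M\<close>. Strictness of \<open>norm z < 1\<close> makes
    that bound available for almost all members of the sequence.\<close>
  have gen: "norm (r *\<^sub>R 1 - star z * z) \<le> r" if "norm z < 1" "r = 1" for r z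
    using that
  proof (transfer, goal_cases)
    case (1 z r)
    then have z: "z \<in> uhf_seq" by (simp add: uhf_relD)
    have "\<forall>\<^sub>F n in sequentially. opnorm n (z n) < 1"
      using order_tendstoD(2)[OF norm_uhf_tendsto[OF z]] 1 by blast
    then have "\<forall>\<^sub>F n in sequentially. opnorm n (smul (of_real r) (mid n) - mmul (madj (z n)) (z n)) \<le> r"
    proof eventually_elim
      case (elim n)
      then show ?case
        using M[OF uhf_seq_M3[OF z, of n], of 1] 1 by (simp add: abs_square_le_1)
    qed
    then show ?case
      by (intro tendsto_upperbound[OF norm_uhf_tendsto] uhf_seq_diff uhf_seq_smul uhf_seq_mid
         uhf_seq_mmul uhf_seq_madj z) auto
  qed
  define r where "r n = 1 - inverse (real (Suc n))" for n
  have "norm (1 - star (r n *\<^sub>R z) * (r n *\<^sub>R z)) \<le> 1" for n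
  proof -
    have "\<bar>r n\<bar> < 1" by (simp add: r_def field_simps)
    then have "\<bar>r n\<bar> * norm z < 1"
      using assms by (smt (verit) mult_left_le norm_ge_zero)
    then show ?thesis using gen[of "r n *\<^sub>R z" 1] by simp
  qed
  moreover have "r \<longlonglongrightarrow> 1 - 0"
    unfolding r_def by (intro tendsto_diff tendsto_const LIMSEQ_inverse_real_of_nat)
  then have "(\<lambda>n. norm (1 - star (r n *\<^sub>R z) * (r n *\<^sub>R z))) \<longlonglongrightarrow> norm (1 - star ((1 - 0) *\<^sub>R z) * ((1 - 0) *\<^sub>R z))"
    by (intro tendsto_norm tendsto_diff tendsto_mult tendsto_star tendsto_scaleR tendsto_const)
  ultimately show ?thesis
    using tendsto_upperbound[of _ "norm (1 - star z * z)" sequentially 1] by simp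
qed

text \<open>The binomial series of the square root of \<open>1 - h\<close> converges absolutely
  because \<open>norm h < 1\<close>. Its constant term is 1 and its other terms are real multiples
  of positive powers of \<open>h\<close>; the last clause uses this to place \<open>s - 1\<close> in
  whichever algebra or ideal contains \<open>h\<close>.\<close>

lemma sqrt_one_minus:
  assumes h: "star h = h" "norm h < 1"
  obtains s where "star s = s" "s * s = 1 - h"
    "\<And>V. closed V \<Longrightarrow> subspace V \<Longrightarrow> (\<And>n. h ^ Suc n \<in> V) \<Longrightarrow> s - 1 \<in> V"
proof -
  define a where "a n = ((1/2 :: real) gchoose n) * (-1) ^ n" for n
  define F where "F n = a n *\<^sub>R h ^ n" for n
  have sa: "summable (\<lambda>n. norm (a n * norm h ^ n))"
  proof (rule powser_insidea)
    \<comment> \<open>The midpoint of \<open>norm h\<close> and 1 still lies inside the disc of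
      convergence.\<close>
    show "norm (norm h) < norm ((1 + norm h) / 2)" using h(2) by simp
    have "summable (\<lambda>n. ((1/2 :: real) gchoose n) * (- ((1 + norm h) / 2)) ^ n)"
    proof (rule sums_summable[OF gen_binomial_real])
      have "0 \<le> norm h" by simp
      then show "\<bar>- ((1 + norm h) / 2)\<bar> < 1" using h(2) by (simp add: abs_less_iff)
    qed
    moreover have "((1/2 :: real) gchoose n) * (- ((1 + norm h) / 2)) ^ n = a n * ((1 + norm h) / 2) ^ n" for n
      unfolding a_def power_minus[of "(1 + norm h) / 2"] by simp
    ultimately show "summable (\<lambda>n. a n * ((1 + norm h) / 2) ^ n)" by simp
  qed
  have sF: "summable (\<lambda>n. norm (F n))"
    by (rule summable_comparison_test'[OF sa, of 0])
      (auto simp: F_def abs_mult intro!: mult_left_mono norm_power_ineq)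
  define s where "s = (\<Sum>n. F n)"
  have Fs: "F sums s" unfolding s_def by (rule summable_sums[OF summable_norm_cancel[OF sF]])
  have "star s = s"
  proof -
    have "(\<lambda>n. star (F n)) sums star s" by (rule bounded_linear.sums[OF bounded_linear_star Fs])
    moreover have "star (F n) = F n" for n by (simp add: F_def star_scaleR star_power h)
    ultimately show ?thesis using Fs sums_unique2 by simp
  qed
  moreover have "s * s = 1 - h"
  proof -
    have "(\<lambda>k. \<Sum>i\<le>k. F i * F (k - i)) sums (s * s)"
      unfolding s_def by (rule Cauchy_product_sums[OF sF sF])
    \<comment> \<open>By Vandermonde's identity the convolution of the coefficients is
      \<open>1 gchoose k\<close> up to sign, which is 0 from \<open>k = 2\<close> on.\<close>
    moreover have "(\<Sum>i\<le>k. F i * F (k - i)) = (if k = 0 then 1 else if k = 1 then - h else 0)" for k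
    proof -
      have "(\<Sum>i\<le>k. F i * F (k - i)) = (\<Sum>i\<le>k. (((1/2) gchoose i) * ((1/2) gchoose (k - i)) * (-1)^k) *\<^sub>R h ^ k)"
        by (rule sum.cong)
          (auto simp: F_def a_def power_add[symmetric] mult.assoc mult.left_commute)
      also have "\<dots> = ((1 gchoose k) * (-1) ^ k) *\<^sub>R h ^ k"
        using gbinomial_Vandermonde[of "1/2 :: real" "1/2" k]
        by (simp add: scaleR_sum_left[symmetric] sum_distrib_right[symmetric] atLeast0AtMost)
      also have "(1 gchoose k :: real) = of_nat (1 choose k)" by (simp add: binomial_gbinomial)
      finally show ?thesis by (auto simp: binomial_eq_0)
    qed
    moreover have "(\<lambda>k. if k = 0 then 1 else if k = 1 then - h else 0) sums (\<Sum>k\<in>{0,1::nat}. if k = 0 then 1 else if k = 1 then - h else 0)"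
      by (rule sums_finite) auto
    ultimately show ?thesis by (simp add: sums_iff)
  qed
  moreover have "s - 1 \<in> V" if V: "closed V" "subspace V" "\<And>n. h ^ Suc n \<in> V" for V
  proof -
    have "(\<lambda>n. F (Suc n)) sums (s - 1)"
      using Fs sums_Suc_iff[of F "s - 1"] by (simp add: F_def a_def)
    then have "(\<lambda>N. \<Sum>n<N. F (Suc n)) \<longlonglongrightarrow> s - 1" by (simp add: sums_def)
    moreover have "(\<Sum>n<N. F (Suc n)) \<in> V" for N
      unfolding F_def by (intro subspace_sum[OF V(2)] subspace_scale[OF V(2)] V(3))
    ultimately show ?thesis by (rule closed_sequentially[OF V(1), rotated])
  qed
  ultimately show ?thesis by (rule that)
qed

section \<open>Tracial states and ideals\<close>

locale tracial_algebra =
  fixes A :: "uhf set" and \<tau> :: "uhf \<Rightarrow> complex"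
  assumes closed_A: "closed A"
    and one_A: "1 \<in> A"
    and add_A: "a \<in> A \<Longrightarrow> b \<in> A \<Longrightarrow> a + b \<in> A"
    and scaleC_A: "a \<in> A \<Longrightarrow> scaleC c a \<in> A"
    and mult_A: "a \<in> A \<Longrightarrow> b \<in> A \<Longrightarrow> a * b \<in> A"
    and star_A: "a \<in> A \<Longrightarrow> star a \<in> A"
    and tracial: "tracial_state_on A \<tau>"
begin

lemma scaleR_A: "a \<in> A \<Longrightarrow> r *\<^sub>R a \<in> A"
  by (simp add: scaleR_scaleC scaleC_A)

lemma zero_A: "0 \<in> A"
  using scaleR_A[OF one_A, of 0] by simp

lemma minus_A: "a \<in> A \<Longrightarrow> - a \<in> A"
  using scaleR_A[of a "-1"] by simp

lemma diff_A: "a \<in> A \<Longrightarrow> b \<in> A \<Longrightarrow> a - b \<in> A"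
  using add_A[of a "- b"] minus_A[of b] by simp

lemma subspace_A: "subspace A"
  by (rule subspaceI) (auto simp: zero_A add_A scaleR_A)

lemma power_A: "a \<in> A \<Longrightarrow> a ^ n \<in> A"
  by (induction n) (simp_all add: one_A mult_A)

lemmas A_intros = one_A add_A scaleC_A mult_A star_A scaleR_A zero_A minus_A diff_A power_A

lemma tau_add: "a \<in> A \<Longrightarrow> b \<in> A \<Longrightarrow> \<tau> (a + b) = \<tau> a + \<tau> b"
  and tau_scaleC: "a \<in> A \<Longrightarrow> \<tau> (scaleC c a) = c * \<tau> a"
  and tau_one: "\<tau> 1 = 1"
  and tau_commute: "a \<in> A \<Longrightarrow> b \<in> A \<Longrightarrow> \<tau> (a * b) = \<tau> (b * a)"
  and tau_pos: "a \<in> A \<Longrightarrow> \<tau> (star a * a) \<in> \<real>\<^sub>\<ge>\<^sub>0"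
  using tracial unfolding tracial_state_on_def by blast+

lemma tau_scaleR: "a \<in> A \<Longrightarrow> \<tau> (r *\<^sub>R a) = of_real r * \<tau> a"
  by (simp add: scaleR_scaleC tau_scaleC)

lemma tau_minus: "a \<in> A \<Longrightarrow> \<tau> (- a) = - \<tau> a"
  using tau_scaleR[of a "-1"] by simp

lemma tau_diff: "a \<in> A \<Longrightarrow> b \<in> A \<Longrightarrow> \<tau> (a - b) = \<tau> a - \<tau> b"
  using tau_add[of a "- b"] by (simp add: tau_minus minus_A)

lemma tau_zero: "\<tau> 0 = 0"
  using tau_scaleR[OF one_A, of 0] by simp

lemma tau_star_mult: "a \<in> A \<Longrightarrow> 0 \<le> Re (\<tau> (star a * a))" "a \<in> A \<Longrightarrow> Im (\<tau> (star a * a)) = 0"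
    "a \<in> A \<Longrightarrow> \<tau> (star a * a) = of_real (Re (\<tau> (star a * a)))"
  using tau_pos[of a] by (auto simp: nonneg_Reals_def complex_eq_iff)

lemma tau_sesq:
  assumes "a \<in> A" "b \<in> A"
  shows "\<tau> (star (a + scaleC z b) * (a + scaleC z b))
    = \<tau> (star a * a) + z * \<tau> (star a * b) + cnj z * \<tau> (star b * a) + of_real ((cmod z)\<^sup>2) * \<tau> (star b * b)"
proof -
  have "star (a + scaleC z b) * (a + scaleC z b)
     = star a * a + scaleC z (star a * b) + scaleC (cnj z) (star b * a) + scaleC (of_real ((cmod z)\<^sup>2)) (star b * b)"
    unfolding complex_norm_square
    by (simp add: star_add star_scaleC algebra_simps scaleC_mult scaleC_scaleC scaleC_add)
  then show ?thesis
    using assms by (simp add: tau_add tau_scaleC A_intros)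
qed

text \<open>Polarization: \<open>\<tau> (star c * c)\<close> is real for \<open>c = a + b\<close>
  and for \<open>c = a + i b\<close>; the first fact settles the imaginary part, the second the real
  part.\<close>

lemma tau_hermitian:
  assumes "a \<in> A" "b \<in> A" shows "\<tau> (star b * a) = cnj (\<tau> (star a * b))"
proof -
  have "Im (\<tau> (star (a + scaleC z b) * (a + scaleC z b))) = 0" for z
    using assms by (intro tau_star_mult A_intros)
  note this[unfolded tau_sesq[OF assms]]
  from this[of 1] this[of \<i>] show ?thesis
    using tau_star_mult(2)[OF assms(1)] tau_star_mult(2)[OF assms(2)]
    by (simp add: complex_eq_iff)
qed

lemma Cauchy_Schwarz:
  assumes "a \<in> A" "b \<in> A"
  shows "(cmod (\<tau> (star a * b)))\<^sup>2 \<le> Re (\<tau> (star a * a)) * Re (\<tau> (star b * b))"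
proof -
  define r p q where "r = \<tau> (star a * b)" "p = Re (\<tau> (star a * a))" "q = Re (\<tau> (star b * b))"
  have *: "0 \<le> p - 2 * x * (cmod r)\<^sup>2 + x\<^sup>2 * (cmod r)\<^sup>2 * q" for x :: real
  proof -
    \<comment> \<open>The factor \<open>cnj r\<close> makes both mixed terms real and equal, which
      leaves a polynomial of degree at most 2 in the real variable \<open>x\<close>.\<close>
    define z where "z = - of_real x * cnj r"
    have "0 \<le> Re (\<tau> (star (a + scaleC z b) * (a + scaleC z b)))"
      using assms by (intro tau_star_mult A_intros)
    also have "\<dots> = p - 2 * x * (cmod r)\<^sup>2 + x\<^sup>2 * (cmod r)\<^sup>2 * q"
    proof -
      have "z * r + cnj z * cnj r = - of_real (2 * x * (cmod r)\<^sup>2)"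
        unfolding of_real_mult complex_norm_square by (simp add: z_def)
      then have "Re (z * r) + Re (cnj z * cnj r) = - (2 * x * (cmod r)\<^sup>2)"
        by (metis Re_complex_of_real of_real_minus plus_complex.sel(1))
      moreover have "(cmod z)\<^sup>2 = x\<^sup>2 * (cmod r)\<^sup>2"
        by (simp add: z_def norm_mult power_mult_distrib)
      moreover have "Re (of_real c * w) = c * Re w" for c w by simp
      moreover have "\<tau> (star b * a) = cnj r" unfolding r_p_q_def by (rule tau_hermitian[OF assms])
      ultimately show ?thesis
        unfolding tau_sesq[OF assms] plus_complex.sel r_p_q_def(2,3) by (simp only: r_p_q_def(1)[symmetric])
    qed
    finally show ?thesis .
  qed
  have q: "0 \<le> q" using assms by (simp add: r_p_q_def tau_star_mult(1))
  have "(cmod r)\<^sup>2 \<le> p * q"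
  proof (cases "q = 0")
    case True
    have "(cmod r)\<^sup>2 = 0"
    proof (rule ccontr)
      assume "(cmod r)\<^sup>2 \<noteq> 0"
      \<comment> \<open>With \<open>q = 0\<close> the polynomial is linear, and at this point its
        value is -1.\<close>
      then show False using *[of "(p + 1) / (2 * (cmod r)\<^sup>2)"] *[of 0] True by (simp add: field_simps)
    qed
    then show ?thesis using True by simp
  next
    case False
    then have "q * (p - 2 * (1/q) * (cmod r)\<^sup>2 + (1/q)\<^sup>2 * (cmod r)\<^sup>2 * q) = p * q - (cmod r)\<^sup>2"
      by (simp add: field_simps power2_eq_square)
    then show ?thesis using mult_nonneg_nonneg[OF q *[of "1/q"]] by linarith
  qed
  then show ?thesis by (simp add: r_p_q_def)
qed

text \<open>For \<open>r < 1\<close> the element \<open>1 - r (star t * t)\<close> has a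
  self-adjoint square root \<open>s\<close> in \<open>A\<close>, so the right side minus
  \<open>r\<close> times the left side is the real part of
  \<open>\<tau> (star (s * a) * (s * a))\<close> and hence nonnegative. The factor \<open>r\<close>
  brings the norm below 1, where the square root series applies, and then tends to 1.\<close>

lemma tau_one_minus_star_mult:
  assumes "a \<in> A" "t \<in> A" "norm t \<le> 1"
  shows "Re (\<tau> (star a * (star t * t) * a)) \<le> Re (\<tau> (star a * a))"
proof -
  have *: "r * Re (\<tau> (star a * (star t * t) * a)) \<le> Re (\<tau> (star a * a))" if r: "0 \<le> r" "r < 1" for r
  proof -
    let ?h = "r *\<^sub>R (star t * t)"
    have "norm (star t * t) \<le> 1" using assms(3) by (simp add: uhf_cstar_identity abs_square_le_1)
    then have n: "norm ?h < 1" using r mult_left_le[of "norm (star t * t)" r] by auto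
    obtain s where s: "star s = s" "s * s = 1 - ?h" and V: "\<And>V. closed V \<Longrightarrow> subspace V \<Longrightarrow> (\<And>n. ?h ^ Suc n \<in> V) \<Longrightarrow> s - 1 \<in> V"
      using sqrt_one_minus[of ?h] n by (auto simp: star_scaleR star_mult)
    have "s - 1 \<in> A" by (intro V closed_A subspace_A power_A scaleR_A mult_A star_A assms)
    then have sA: "s \<in> A" using add_A[OF _ one_A] by force
    have "0 \<le> Re (\<tau> (star (s * a) * (s * a)))"
      by (intro tau_star_mult mult_A sA assms)
    also have "star (s * a) * (s * a) = star a * a - r *\<^sub>R (star a * (star t * t) * a)"
    proof -
      have "star (s * a) * (s * a) = star a * (s * s) * a" by (simp add: star_mult s(1) mult.assoc)
      then show ?thesis by (simp add: s(2) algebra_simps)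
    qed
    also have "Re (\<tau> \<dots>) = Re (\<tau> (star a * a)) - r * Re (\<tau> (star a * (star t * t) * a))"
      using assms by (simp add: tau_diff tau_scaleR A_intros)
    finally show ?thesis by simp
  qed
  have "((\<lambda>r. r * Re (\<tau> (star a * (star t * t) * a))) \<longlongrightarrow> 1 * Re (\<tau> (star a * (star t * t) * a))) (at_left 1)"
    by (intro tendsto_intros)
  moreover have "\<forall>\<^sub>F r in at_left 1. r * Re (\<tau> (star a * (star t * t) * a)) \<le> Re (\<tau> (star a * a))"
    using * eventually_at_left_real[of 0 1] by (auto elim!: eventually_mono)
  ultimately have "1 * Re (\<tau> (star a * (star t * t) * a)) \<le> Re (\<tau> (star a * a))"
    by (rule tendsto_upperbound) simp
  then show ?thesis by simp
qed

lemma tau_compress: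
  assumes "a \<in> A" "b \<in> A"
  shows "Re (\<tau> (star a * (star b * b) * a)) \<le> (norm b)\<^sup>2 * Re (\<tau> (star a * a))"
proof (cases "b = 0")
  case True
  then show ?thesis by (simp add: tau_zero)
next
  case False
  define r where "r = inverse (norm b)"
  have "star a * (star (r *\<^sub>R b) * (r *\<^sub>R b)) * a = r\<^sup>2 *\<^sub>R (star a * (star b * b) * a)"
    by (simp add: star_scaleR power2_eq_square)
  moreover have "Re (\<tau> (star a * (star (r *\<^sub>R b) * (r *\<^sub>R b)) * a)) \<le> Re (\<tau> (star a * a))"
    using False assms by (intro tau_one_minus_star_mult A_intros) (auto simp: r_def)
  ultimately have "r\<^sup>2 * Re (\<tau> (star a * (star b * b) * a)) \<le> Re (\<tau> (star a * a))"
    using assms by (simp add: tau_scaleR A_intros)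
  then show ?thesis using False by (simp add: field_simps r_def)
qed

lemma tau_bounded:
  assumes "b \<in> A" shows "cmod (\<tau> b) \<le> norm b"
proof (rule power2_le_imp_le)
  show "(cmod (\<tau> b))\<^sup>2 \<le> (norm b)\<^sup>2"
    using Cauchy_Schwarz[OF one_A assms] tau_compress[OF one_A assms]
    by (simp only: tau_one star_1 mult_1_left mult_1_right one_complex.sel)
qed (rule norm_ge_zero)

end

text \<open>
  The infimum of \<open>\<tau> (star t * t)\<close> over \<open>appr\<close> is the mass that \<open>\<tau>\<close> does not place on the
  ideal \<open>I\<close>; elements \<open>1 - star t * t\<close> with nearly minimal \<open>t\<close> act as an approximate unit of \<open>I\<close>
  in the trace seminorm.
\<close>

locale tracial_ideal = tracial_algebra +
  fixes I :: "uhf set"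
  assumes I_sub: "I \<subseteq> A"
    and closed_I: "closed I"
    and add_I: "a \<in> I \<Longrightarrow> b \<in> I \<Longrightarrow> a + b \<in> I"
    and zero_I: "0 \<in> I"
    and mult_I: "a \<in> A \<Longrightarrow> b \<in> I \<Longrightarrow> a * b \<in> I"
    and star_I: "a \<in> I \<Longrightarrow> star a \<in> I"
begin

lemma I_A: "a \<in> I \<Longrightarrow> a \<in> A" using I_sub by blast

lemma mult_I_right: "b \<in> I \<Longrightarrow> a \<in> A \<Longrightarrow> b * a \<in> I"
  using star_I[OF mult_I[of "star a" "star b"]] by (simp add: star_mult star_I star_A)

lemma scaleC_I: "a \<in> I \<Longrightarrow> scaleC c a \<in> I"
  using mult_I[OF scaleC_A[OF one_A], of a c] by (simp add: scaleC_mult)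

lemma scaleR_I: "a \<in> I \<Longrightarrow> r *\<^sub>R a \<in> I"
  by (simp add: scaleR_scaleC scaleC_I)

lemma minus_I: "a \<in> I \<Longrightarrow> - a \<in> I"
  using scaleR_I[of a "-1"] by simp

lemma subspace_I: "subspace I"
  by (rule subspaceI) (auto simp: zero_I add_I scaleR_I)

definition appr :: "uhf set" where
  "appr = {t \<in> A. t - 1 \<in> I \<and> norm t \<le> 1}"

definition mass :: "uhf \<Rightarrow> real" where
  "mass t = Re (\<tau> (star t * t))"

definition mass_inf :: real where
  "mass_inf = (INF t\<in>appr. mass t)"

definition cut :: "uhf \<Rightarrow> uhf" where
  "cut t = 1 - star t * t"

lemma one_appr: "1 \<in> appr"
  by (simp add: appr_def one_A zero_I)

lemma appr_A: "t \<in> appr \<Longrightarrow> t \<in> A"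
  by (simp add: appr_def)

lemma mass_nonneg: "t \<in> appr \<Longrightarrow> 0 \<le> mass t"
  by (simp add: mass_def tau_star_mult(1) appr_A)

lemma mass_inf_le: "t \<in> appr \<Longrightarrow> mass_inf \<le> mass t"
  unfolding mass_inf_def by (rule cINF_lower) (auto intro!: bdd_belowI[of _ 0] mass_nonneg)

lemma mass_le_1: "t \<in> appr \<Longrightarrow> mass t \<le> 1"
  using tau_one_minus_star_mult[OF one_A, of t] by (simp add: appr_def mass_def tau_one)

lemma norm_cut: "t \<in> appr \<Longrightarrow> norm (cut t) \<le> 1"
  by (simp add: cut_def appr_def norm_one_minus_star_mult)

lemma cut_I: assumes "t \<in> appr" shows "cut t \<in> I"
proof -
  have "cut t = - (star (t - 1) * t + (t - 1))"
    by (simp add: cut_def star_diff algebra_simps)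
  moreover have "t - 1 \<in> I" "t \<in> A" using assms by (simp_all add: appr_def)
  ultimately show ?thesis by (simp only:) (intro minus_I add_I mult_I_right star_I)
qed

lemma cut_A: "t \<in> appr \<Longrightarrow> cut t \<in> A"
  by (rule I_A[OF cut_I])

lemma mass_cut: "t \<in> appr \<Longrightarrow> \<tau> (cut t) = 1 - of_real (mass t)"
  unfolding mass_def cut_def
  by (simp add: tau_diff A_intros appr_A tau_one tau_star_mult(3)[symmetric])

text \<open>If \<open>s\<^sup>2 = 1 - z z\<^sup>*\<close> then \<open>t s\<close> is again in \<open>appr\<close>, and comparing masses gives the bound.\<close>

lemma tau_appr_small:
  assumes t: "t \<in> appr" and z: "z \<in> I" "norm z < 1"
  shows "Re (\<tau> (star t * t * (z * star z))) \<le> mass t - mass_inf"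
proof -
  let ?h = "z * star z"
  have h: "?h \<in> I" using z by (intro mult_I_right star_A I_A)
  have "norm ?h = (norm z)\<^sup>2" using uhf_cstar_identity[of "star z"] by simp
  also have "\<dots> < 1" using z(2) by (simp add: abs_square_less_1)
  finally have "norm ?h < 1" .
  then obtain s where s: "star s = s" "s * s = 1 - ?h"
    and V: "\<And>V. closed V \<Longrightarrow> subspace V \<Longrightarrow> (\<And>n. ?h ^ Suc n \<in> V) \<Longrightarrow> s - 1 \<in> V"
    using sqrt_one_minus[of ?h] by (auto simp: star_mult)
  have hn: "?h ^ Suc n \<in> I" for n
    using mult_I[OF power_A[OF I_A[OF h]] h, of n] by (simp add: power_commutes)
  have s1: "s - 1 \<in> I" by (intro V closed_I subspace_I hn)
  have sA: "s \<in> A" using add_A[OF I_A[OF s1] one_A] by simp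
  have tA: "t \<in> A" using t by (rule appr_A)
  have hA: "?h \<in> A" by (rule I_A[OF h])
  have "(norm s)\<^sup>2 = norm (1 - star (star z) * star z)"
    using uhf_cstar_identity[of s] by (simp add: s)
  also have "\<dots> \<le> 1" using z by (intro norm_one_minus_star_mult) simp
  finally have ns: "norm s \<le> 1" by (simp add: abs_square_le_1)
  have "(t - 1) * s + (s - 1) \<in> I"
    using t s1 sA by (intro add_I mult_I_right) (auto simp: appr_def)
  then have "t * s - 1 \<in> I" by (simp add: algebra_simps)
  moreover have "norm (t * s) \<le> 1"
    using t ns mult_le_one[of "norm t" "norm s"] norm_mult_ineq[of t s] by (auto simp: appr_def)
  ultimately have "t * s \<in> appr" using mult_A[OF tA sA] by (simp add: appr_def)
  then have "mass_inf \<le> mass (t * s)" by (rule mass_inf_le)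
  also have "mass (t * s) = Re (\<tau> (s * (star t * t * s)))"
    by (simp add: mass_def star_mult s mult.assoc)
  also have "\<tau> (s * (star t * t * s)) = \<tau> (star t * t * s * s)"
    using tA sA by (intro tau_commute A_intros)
  also have "star t * t * s * s = star t * t - star t * t * ?h"
    by (simp add: mult.assoc s) (simp add: algebra_simps)
  also have "Re (\<tau> \<dots>) = mass t - Re (\<tau> (star t * t * ?h))"
    using tau_diff[of "star t * t" "star t * t * ?h"] tA hA by (simp add: A_intros mass_def)
  finally show ?thesis by linarith
qed

definition defect :: "uhf \<Rightarrow> real" where
  "defect t = sqrt (mass t - mass_inf)"

text \<open>By Cauchy-Schwarz for \<open>star t * (t * z)\<close> and traciality, the squared left
  side is at most \<open>\<tau> (star t * t * (z * star z))\<close>, which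
  \<open>tau_appr_small\<close> controls once \<open>z\<close> is scaled into the open unit ball.
  Scaling to norm 1/2 produces the factor 2.\<close>

lemma cut_approx:
  assumes t: "t \<in> appr" and z: "z \<in> I"
  shows "cmod (\<tau> (star t * t * z)) \<le> 2 * norm z * defect t"
proof (cases "z = 0")
  case True
  then show ?thesis by (simp add: tau_zero)
next
  case False
  have tA: "t \<in> A" and zA: "z \<in> A" using t z by (simp_all add: appr_A I_A)
  define r q where r_q_def: "r = 2 * norm z" "q = inverse r"
  have r: "r > 0" using False by (simp add: r_q_def)
  have "norm (q *\<^sub>R z) < 1" using False by (simp add: r_q_def)
  then have *: "Re (\<tau> (star t * t * (q *\<^sub>R z * star (q *\<^sub>R z)))) \<le> mass t - mass_inf"
    using t z by (intro tau_appr_small scaleR_I)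
  have "star t * t * (q *\<^sub>R z * star (q *\<^sub>R z)) = q\<^sup>2 *\<^sub>R (star t * t * (z * star z))"
    by (simp add: star_scaleR power2_eq_square)
  then have e: "Re (\<tau> (star t * t * (q *\<^sub>R z * star (q *\<^sub>R z)))) = q\<^sup>2 * Re (\<tau> (star t * t * (z * star z)))"
    using tA zA by (simp add: tau_scaleR A_intros)
  have "q\<^sup>2 * Re (\<tau> (star t * t * (z * star z))) \<le> mass t - mass_inf"
    using * unfolding e .
  then have **: "Re (\<tau> (star t * t * (z * star z))) \<le> r\<^sup>2 * (mass t - mass_inf)"
  proof -
    have "r\<^sup>2 * q\<^sup>2 = 1" using r by (simp add: r_q_def(2) power_mult_distrib[symmetric])
    moreover have "x \<le> r\<^sup>2 * m" if "q\<^sup>2 * x \<le> m" "r\<^sup>2 * q\<^sup>2 = 1" for x m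
      using mult_left_mono[OF that(1), of "r\<^sup>2"] that(2) by (simp add: mult.assoc[symmetric])
    ultimately show ?thesis using \<open>q\<^sup>2 * _ \<le> _\<close> by blast
  qed
  have "(cmod (\<tau> (star t * (t * z))))\<^sup>2 \<le> Re (\<tau> (star t * t)) * Re (\<tau> (star (t * z) * (t * z)))"
    using tA zA by (intro Cauchy_Schwarz A_intros)
  also have "\<dots> \<le> 1 * Re (\<tau> (star (t * z) * (t * z)))"
    using mass_le_1[OF t] tA zA unfolding mass_def by (intro mult_right_mono tau_star_mult A_intros) auto
  also have "\<tau> (star (t * z) * (t * z)) = \<tau> (star t * t * (z * star z))"
    using tau_commute[of "star z" "star t * t * z"] tA zA
    by (simp add: star_mult mult.assoc A_intros)
  finally have "(cmod (\<tau> (star t * t * z)))\<^sup>2 \<le> r\<^sup>2 * (mass t - mass_inf)"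
    using ** by (simp add: mult.assoc)
  also have "\<dots> = (r * defect t)\<^sup>2"
    using mass_inf_le[OF t] by (simp add: defect_def power_mult_distrib)
  finally have "(cmod (\<tau> (star t * t * z)))\<^sup>2 \<le> (r * defect t)\<^sup>2" .
  moreover have "0 \<le> r * defect t"
    using mass_inf_le[OF t] r by (intro mult_nonneg_nonneg) (simp_all add: defect_def)
  ultimately have "cmod (\<tau> (star t * t * z)) \<le> r * defect t" by (rule power2_le_imp_le)
  then show ?thesis by (simp only: r_q_def(1))
qed

section \<open>The part of the trace carried by the ideal, as a functional on multipliers\<close>

definition multipliers :: "uhf set" where
  "multipliers = {x. \<forall>b\<in>I. x * b \<in> I \<and> b * x \<in> I}"

lemma multipliers_I: "x \<in> multipliers \<Longrightarrow> b \<in> I \<Longrightarrow> x * b \<in> I" "x \<in> multipliers \<Longrightarrow> b \<in> I \<Longrightarrow> b * x \<in> I"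
  by (auto simp: multipliers_def)

lemma multipliers_A: "a \<in> A \<Longrightarrow> a \<in> multipliers"
  by (simp add: multipliers_def mult_I mult_I_right)

lemma multipliers_add: "x \<in> multipliers \<Longrightarrow> y \<in> multipliers \<Longrightarrow> x + y \<in> multipliers"
  by (simp add: multipliers_def algebra_simps add_I)

lemma multipliers_scaleC: "x \<in> multipliers \<Longrightarrow> scaleC c x \<in> multipliers"
  by (simp add: multipliers_def scaleC_mult scaleC_I)

lemma multipliers_mult: "x \<in> multipliers \<Longrightarrow> y \<in> multipliers \<Longrightarrow> x * y \<in> multipliers"
  by (auto simp: multipliers_def mult.assoc) (metis mult.assoc)


text \<open>The difference is the trace of \<open>a * (star t * t) * y\<close>. Moving
  \<open>a\<close> to the right end would reduce it to \<open>cut_approx\<close>, but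
  \<open>y\<close> need not lie in \<open>A\<close>, so traciality does not apply. A second factor
  \<open>cut t'\<close> puts \<open>y * cut t'\<close> into the ideal, where the exchange is
  allowed. The error this causes is governed by \<open>defect t'\<close> alone, and
  \<open>t'\<close> can be chosen after \<open>t\<close>.\<close>

lemma cut_approx_mult:
  assumes t: "t \<in> appr" and a: "a \<in> I" and y: "y \<in> multipliers"
  shows "cmod (\<tau> (a * y) - \<tau> (a * cut t * y)) \<le> 2 * norm a * norm y * defect t"
proof -
  let ?z = "a * (star t * t) * y"
  have tA: "t \<in> A" using t by (rule appr_A)
  have z: "?z \<in> I" "a * y \<in> I" "a * cut t * y \<in> I"
    using multipliers_I(2)[OF y] mult_I_right[OF a] mult_A[OF star_A[OF tA] tA] cut_A[OF t] a by auto
  have bound: "cmod (\<tau> ?z) \<le> 2 * norm a * norm y * defect t + 2 * norm ?z * defect t'"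
    if t': "t' \<in> appr" for t'
  proof -
    have t'A: "t' \<in> A" using t' by (rule appr_A)
    have w: "y * cut t' * a \<in> I" "norm (y * cut t' * a) \<le> norm y * norm a"
    proof -
      show "y * cut t' * a \<in> I"
        using y a cut_I[OF t'] by (intro mult_I_right multipliers_I I_A[of a])
      have "norm (y * cut t' * a) \<le> norm y * norm (cut t') * norm a"
        by (meson norm_mult_ineq mult_right_mono norm_ge_zero order_trans)
      also have "\<dots> \<le> norm y * 1 * norm a"
        by (intro mult_right_mono mult_left_mono norm_cut t') auto
      finally show "norm (y * cut t' * a) \<le> norm y * norm a" by simp
    qed
    have "?z * cut t' = a * (star t * t * (y * cut t'))" by (simp add: mult.assoc)
    also have "\<tau> \<dots> = \<tau> (star t * t * (y * cut t') * a)"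
      using a y tA cut_I[OF t'] by (intro tau_commute mult_A star_A I_A[OF a] I_A[OF multipliers_I(1)])
    also have "star t * t * (y * cut t') * a = star t * t * (y * cut t' * a)" by (simp add: mult.assoc)
    finally have "cmod (\<tau> (?z * cut t')) \<le> 2 * norm (y * cut t' * a) * defect t"
      using cut_approx[OF t w(1)] by simp
    also have "\<dots> \<le> 2 * (norm y * norm a) * defect t"
      using w(2) mass_inf_le[OF t] by (intro mult_right_mono mult_left_mono) (auto simp: defect_def)
    finally have 1: "cmod (\<tau> (?z * cut t')) \<le> 2 * norm a * norm y * defect t" by (simp add: mult.commute mult.left_commute)
    have "\<tau> (?z * cut t') = \<tau> (cut t' * ?z)"
      using z(1) by (intro tau_commute cut_A t' I_A)
    also have "cut t' * ?z = ?z - star t' * t' * ?z" by (simp add: cut_def left_diff_distrib)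
    also have "\<tau> \<dots> = \<tau> ?z - \<tau> (star t' * t' * ?z)"
      using I_A[OF z(1)] mult_A[OF mult_A[OF star_A[OF t'A] t'A] I_A[OF z(1)]] by (rule tau_diff)
    finally have "\<tau> ?z = \<tau> (?z * cut t') + \<tau> (star t' * t' * ?z)" by simp
    then have "cmod (\<tau> ?z) \<le> cmod (\<tau> (?z * cut t')) + cmod (\<tau> (star t' * t' * ?z))"
      by (simp only: norm_triangle_ineq)
    then show ?thesis using 1 cut_approx[OF t' z(1)] by linarith
  qed
  have "\<tau> (a * y) - \<tau> (a * cut t * y) = \<tau> (a * y - a * cut t * y)"
    using z by (simp add: tau_diff I_A)
  also have "a * y - a * cut t * y = ?z" by (simp add: cut_def algebra_simps)
  finally have e: "cmod (\<tau> (a * y) - \<tau> (a * cut t * y)) = cmod (\<tau> ?z)" by simp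
  have "cmod (\<tau> ?z) \<le> 2 * norm a * norm y * defect t + e" if "e > 0" for e
  proof -
    \<comment> \<open>\<open>sqrt d\<close> is the size of \<open>defect t'\<close> that makes the
      error at most \<open>e\<close>; adding 1 keeps the denominator positive when
      \<open>?z = 0\<close>.\<close>
    define d where "d = (e / (2 * norm ?z + 1))\<^sup>2"
    have p: "2 * norm ?z + 1 > 0" by (simp add: add_nonneg_pos)
    then have "d > 0" using \<open>e > 0\<close> by (simp add: d_def)
    moreover have "bdd_below (mass ` appr)" by (auto intro!: bdd_belowI[of _ 0] mass_nonneg)
    ultimately obtain t' where t': "t' \<in> appr" "mass t' < mass_inf + d"
      using cINF_less_iff[of appr mass "mass_inf + d"] one_appr unfolding mass_inf_def by auto
    then have "defect t' \<le> sqrt d" by (simp add: defect_def)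
    also have "sqrt d = e / (2 * norm ?z + 1)"
      using p \<open>e > 0\<close> by (simp add: d_def)
    finally have "defect t' \<le> e / (2 * norm ?z + 1)" .
    then have "2 * norm ?z * defect t' \<le> 2 * norm ?z * (e / (2 * norm ?z + 1))"
      by (rule mult_left_mono) simp
    also have "\<dots> \<le> e" using p \<open>e > 0\<close> by (simp add: divide_simps) 
    finally show ?thesis using bound[OF t'(1)] by linarith
  qed
  then show ?thesis unfolding e by (rule field_le_epsilon)
qed

text \<open>Inserting the other cut changes each of the two values only slightly, and afterwards
  they agree, because \<open>cut t * x\<close> and \<open>cut t' * y\<close> lie in the ideal, where
  \<open>\<tau>\<close> is tracial. With \<open>y = 1\<close> this shows that
  \<open>\<tau> (cut t * x)\<close> hardly depends on \<open>t\<close>; with \<open>t = t'\<close>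
  it makes the limit functional tracial.\<close>

lemma cut_commute:
  assumes t: "t \<in> appr" "t' \<in> appr" and x: "x \<in> multipliers" and y: "y \<in> multipliers"
  shows "cmod (\<tau> (cut t * x * y) - \<tau> (cut t' * y * x)) \<le> 2 * norm x * norm y * (defect t + defect t')"
proof -
  have c: "cut t * x \<in> I" "cut t' * y \<in> I" using t x y by (auto intro: multipliers_I cut_I)
  have n: "norm (cut s * z) \<le> norm z" if "s \<in> appr" for s z
    using norm_mult_ineq[of "cut s" z] mult_right_mono[OF norm_cut[OF that] norm_ge_zero[of z]] by simp
  have d: "0 \<le> defect t" "0 \<le> defect t'"
    using mass_inf_le t by (auto simp: defect_def)
  have 1: "cmod (\<tau> (cut t * x * y) - \<tau> (cut t * x * cut t' * y)) \<le> 2 * norm x * norm y * defect t'"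
    by (rule order_trans[OF cut_approx_mult[OF t(2) c(1) y]])
       (intro mult_right_mono mult_left_mono n t d, auto)
  have 2: "cmod (\<tau> (cut t' * y * x) - \<tau> (cut t' * y * cut t * x)) \<le> 2 * norm x * norm y * defect t"
  proof (rule order_trans[OF cut_approx_mult[OF t(1) c(2) x]])
    have "2 * norm (cut t' * y) * norm x * defect t \<le> 2 * norm y * norm x * defect t"
      by (intro mult_right_mono mult_left_mono n t d) auto
    then show "2 * norm (cut t' * y) * norm x * defect t \<le> 2 * norm x * norm y * defect t"
      by (simp add: mult.commute mult.left_commute)
  qed
  have "\<tau> (cut t * x * cut t' * y) = \<tau> (cut t' * y * cut t * x)"
    using tau_commute[OF I_A[OF c(1)] I_A[OF c(2)]] by (simp add: mult.assoc)
  then have "\<tau> (cut t * x * y) - \<tau> (cut t' * y * x) = (\<tau> (cut t * x * y) - \<tau> (cut t * x * cut t' * y))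
     - (\<tau> (cut t' * y * x) - \<tau> (cut t' * y * cut t * x))" by simp
  then have "cmod (\<tau> (cut t * x * y) - \<tau> (cut t' * y * x)) \<le> cmod (\<tau> (cut t * x * y) - \<tau> (cut t * x * cut t' * y))
     + cmod (\<tau> (cut t' * y * x) - \<tau> (cut t' * y * cut t * x))" by (simp only: norm_triangle_ineq4)
  also have "\<dots> \<le> 2 * norm x * norm y * defect t' + 2 * norm x * norm y * defect t"
    using 1 2 by (rule add_mono)
  finally show ?thesis by (simp add: algebra_simps)
qed

lemma ideal_part:
  obtains t f where "\<And>n. t n \<in> appr"
    "\<And>x. x \<in> multipliers \<Longrightarrow> (\<lambda>n. \<tau> (cut (t n) * x)) \<longlonglongrightarrow> f x"
    "\<And>x y. x \<in> multipliers \<Longrightarrow> y \<in> multipliers \<Longrightarrow> f (x + y) = f x + f y"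
    "\<And>x c. x \<in> multipliers \<Longrightarrow> f (scaleC c x) = c * f x"
    "\<And>x y. x \<in> multipliers \<Longrightarrow> y \<in> multipliers \<Longrightarrow> f (x * y) = f (y * x)"
    "\<And>x. x \<in> multipliers \<Longrightarrow> cmod (f x) \<le> norm x"
    "\<And>b. b \<in> I \<Longrightarrow> f b = \<tau> b"
proof -
  have "\<exists>t\<in>appr. mass t < mass_inf + inverse (real (Suc n))" for n
  proof -
    have "bdd_below (mass ` appr)" by (auto intro!: bdd_belowI[of _ 0] mass_nonneg)
    then show ?thesis
      using cINF_less_iff[of appr mass "mass_inf + inverse (real (Suc n))"] one_appr
      unfolding mass_inf_def by (auto simp del: of_nat_Suc)
  qed
  then obtain t where t: "t n \<in> appr" "mass (t n) < mass_inf + inverse (real (Suc n))" for n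
    by metis
  have d0: "(\<lambda>n. defect (t n)) \<longlonglongrightarrow> 0"
  proof (rule tendsto_sandwich[of "\<lambda>_. 0" _ _ "\<lambda>n. sqrt (inverse (real (Suc n)))"])
    show "(\<lambda>n. sqrt (inverse (real (Suc n)))) \<longlonglongrightarrow> 0"
      using tendsto_real_sqrt[OF LIMSEQ_inverse_real_of_nat] by simp
    show "\<forall>\<^sub>F n in sequentially. defect (t n) \<le> sqrt (inverse (real (Suc n)))"
      using t(2) by (auto simp: defect_def algebra_simps less_imp_le simp del: of_nat_Suc)
    show "\<forall>\<^sub>F n in sequentially. 0 \<le> defect (t n)"
      using mass_inf_le[OF t(1)] by (simp add: defect_def)
  qed simp
  define f where "f x = lim (\<lambda>n. \<tau> (cut (t n) * x))" for x
  have one: "1 \<in> multipliers" by (simp add: multipliers_def)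
  have cx: "cut (t n) * x \<in> A" if "x \<in> multipliers" for x n
    by (rule I_A[OF multipliers_I(2)[OF that cut_I[OF t(1)]]])
  have lim: "(\<lambda>n. \<tau> (cut (t n) * x)) \<longlonglongrightarrow> f x" if x: "x \<in> multipliers" for x
  proof -
    have "Cauchy (\<lambda>n. \<tau> (cut (t n) * x))"
    proof (rule metric_CauchyI)
      fix e :: real assume e: "e > 0"
      have "(\<lambda>n. 2 * norm x * defect (t n)) \<longlonglongrightarrow> 2 * norm x * 0"
        by (intro tendsto_intros d0)
      then have "\<forall>\<^sub>F n in sequentially. 2 * norm x * defect (t n) < e / 2"
        using e by (intro order_tendstoD(2)[of _ "2 * norm x * 0"]) auto
      then obtain N where N: "\<And>n. n \<ge> N \<Longrightarrow> 2 * norm x * defect (t n) < e / 2"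
        by (auto simp: eventually_sequentially)
      have "dist (\<tau> (cut (t m) * x)) (\<tau> (cut (t n) * x)) < e" if "m \<ge> N" "n \<ge> N" for m n
        using cut_commute[OF t(1)[of m] t(1)[of n] x one] N[OF that(1)] N[OF that(2)]
        by (simp add: dist_norm algebra_simps)
      then show "\<exists>M. \<forall>m\<ge>M. \<forall>n\<ge>M. dist (\<tau> (cut (t m) * x)) (\<tau> (cut (t n) * x)) < e" by blast
    qed
    then show ?thesis unfolding f_def by (simp add: Cauchy_convergent_iff convergent_LIMSEQ_iff)
  qed
  have add: "f (x + y) = f x + f y" if x: "x \<in> multipliers" and y: "y \<in> multipliers" for x y
  proof (rule LIMSEQ_unique[OF lim[OF multipliers_add[OF x y]]])
    show "(\<lambda>n. \<tau> (cut (t n) * (x + y))) \<longlonglongrightarrow> f x + f y"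
      using tendsto_add[OF lim[OF x] lim[OF y]] by (simp add: distrib_left tau_add cx x y)
  qed
  have scale: "f (scaleC c x) = c * f x" if x: "x \<in> multipliers" for x c
  proof (rule LIMSEQ_unique[OF lim[OF multipliers_scaleC[OF x]]])
    show "(\<lambda>n. \<tau> (cut (t n) * scaleC c x)) \<longlonglongrightarrow> c * f x"
      using tendsto_mult_left[OF lim[OF x], of c] by (simp add: scaleC_mult tau_scaleC cx x)
  qed
  have comm: "f (x * y) = f (y * x)" if x: "x \<in> multipliers" and y: "y \<in> multipliers" for x y
  proof (rule LIMSEQ_unique[OF lim[OF multipliers_mult[OF x y]]])
    have "(\<lambda>n. 2 * norm x * norm y * (defect (t n) + defect (t n))) \<longlonglongrightarrow> 2 * norm x * norm y * (0 + 0)"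
      by (intro tendsto_intros d0)
    then have b: "(\<lambda>n. 2 * norm x * norm y * (defect (t n) + defect (t n))) \<longlonglongrightarrow> 0" by simp
    have "(\<lambda>n. \<tau> (cut (t n) * x * y) - \<tau> (cut (t n) * y * x)) \<longlonglongrightarrow> 0"
      by (rule Lim_null_comparison[OF always_eventually b]) (rule allI, rule cut_commute[OF t(1) t(1) x y])
    from tendsto_add[OF this lim[OF multipliers_mult[OF y x]]]
    show "(\<lambda>n. \<tau> (cut (t n) * (x * y))) \<longlonglongrightarrow> f (y * x)" by (simp add: mult.assoc)
  qed
  have bound: "cmod (f x) \<le> norm x" if x: "x \<in> multipliers" for x
  proof (rule tendsto_upperbound[OF tendsto_norm[OF lim[OF x]]])
    have "cmod (\<tau> (cut (t n) * x)) \<le> norm x" for n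
      using tau_bounded[OF cx[OF x], of n] norm_mult_ineq[of "cut (t n)" x]
        mult_right_mono[OF norm_cut[OF t(1)[of n]] norm_ge_zero[of x]] by simp
    then show "\<forall>\<^sub>F n in sequentially. cmod (\<tau> (cut (t n) * x)) \<le> norm x" by simp
  qed simp
  have id: "f b = \<tau> b" if b: "b \<in> I" for b
  proof (rule LIMSEQ_unique[OF lim[OF multipliers_A[OF I_A[OF b]]]])
    have "(\<lambda>n. 2 * norm b * defect (t n)) \<longlonglongrightarrow> 2 * norm b * 0"
      by (intro tendsto_intros d0)
    then have n: "(\<lambda>n. 2 * norm b * defect (t n)) \<longlonglongrightarrow> 0" by simp
    have "(\<lambda>n. \<tau> (star (t n) * t n * b)) \<longlonglongrightarrow> 0"
      by (rule Lim_null_comparison[OF always_eventually n]) (rule allI, rule cut_approx[OF t(1) b])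
    from tendsto_diff[OF tendsto_const[of "\<tau> b"] this]
    have "(\<lambda>n. \<tau> b - \<tau> (star (t n) * t n * b)) \<longlonglongrightarrow> \<tau> b" by simp
    moreover have "\<tau> b - \<tau> (star (t n) * t n * b) = \<tau> (cut (t n) * b)" for n
      using appr_A[OF t(1)] I_A[OF b] by (simp add: cut_def left_diff_distrib tau_diff A_intros)
    ultimately show "(\<lambda>n. \<tau> (cut (t n) * b)) \<longlonglongrightarrow> \<tau> b" by simp
  qed
  show ?thesis by (rule that[OF t(1) lim add scale comm bound id])
qed

end

section \<open>Block structure of \<open>calA n\<close>\<close>

lemma tens_add_right: "x \<otimes> (y + z) = x \<otimes> y + x \<otimes> z"
  by (simp add: tens_def algebra_simps sum.distrib fun_eq_iff)

lemma tens_0_right: "x \<otimes> (0::wmat) = 0"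
  by (simp add: tens_def fun_eq_iff)

lemma sum_apply2: "(\<Sum>i\<in>S. f i) u v = (\<Sum>i\<in>S. f i u v :: complex)"
  by (induction S rule: infinite_finite_induct) auto

lemma M3_sum: assumes "\<And>i. f i \<in> M3 n" shows "(\<Sum>i\<in>S. f i) \<in> M3 n"
proof -
  have "(\<Sum>i\<in>S. f i) u v = 0" if "u \<notin> words n \<or> v \<notin> words n" for u v
    unfolding sum_apply2 using M3_0[OF assms that] by simp
  then show ?thesis unfolding M3_def by blast
qed

lemma tens_sum: "(\<Sum>i\<in>S. f i) \<otimes> z = (\<Sum>i\<in>S. f i \<otimes> z)"
  unfolding tens_def
  by (intro ext) (simp add: sum_distrib_right sum.swap[of _ S] sum_apply2)

lemma tens_assoc:
  assumes "x \<in> M3 n" "y \<in> M3 k"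
  shows "(x \<otimes> y) \<otimes> z = x \<otimes> (y \<otimes> z)"
proof (intro ext)
  fix u v
  show "((x \<otimes> y) \<otimes> z) u v = (x \<otimes> (y \<otimes> z)) u v"
    unfolding tens_apply[OF M3_tens[OF assms]] tens_apply[OF assms(1)] tens_apply[OF assms(2)]
    by (auto simp: add.commute[of n k] take_drop)
qed

lemma mid_0_tens: "mid 0 \<otimes> x = x"
  unfolding fun_eq_iff by (intro allI) (simp add: tens_apply[OF M3_closed(2)], simp add: mid_def)

lemma M3_munit: "munit i j \<in> M3 1"
  by (auto simp: M3_def munit_def words_iff)

lemma M3_tpow: "x \<in> M3 1 \<Longrightarrow> tpow x n \<in> M3 n"
proof (induction n)
  case (Suc n)
  then show ?case using M3_tens[of x 1 "tpow x n" n] by simp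
qed (simp add: M3_closed)

lemma tpow_Suc_right: assumes "x \<in> M3 1" shows "tpow x (Suc n) = tpow x n \<otimes> x"
proof (induction n)
  case 0
  show ?case using tens_mid_0[OF assms] by (simp add: mid_0_tens)
next
  case (Suc n)
  have "tpow x (Suc (Suc n)) = x \<otimes> (tpow x n \<otimes> x)" using Suc by simp
  then show ?case by (simp add: tens_assoc[OF assms M3_tpow[OF assms]])
qed

lemma alpha_Suc: "alpha (Suc n) j = alpha n j \<otimes> munit 2 2"
  unfolding alpha_def tpow_Suc_right[OF M3_munit] by (simp add: tens_assoc[OF M3_munit M3_tpow[OF M3_munit]])

lemma M3_munit2: "munit i j \<otimes> munit k l \<in> M3 2"
  using M3_tens[OF M3_munit M3_munit] by (simp add: numeral_2_eq_2)

lemma M3_beta: assumes "1 \<le> k" shows "beta k j \<in> M3 (Suc k)"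
  using M3_tens[OF M3_closed(3)[OF M3_munit2 M3_munit2] M3_tpow[OF M3_munit],
      of j j 1 1 "j + 2" "j + 2" 3 3 2 2 "k - 1"] assms
  by (simp add: beta_def)

lemma beta_Suc: assumes "1 \<le> k" shows "beta (Suc k) j = beta k j \<otimes> munit 2 2"
proof -
  have "k = Suc (k - 1)" using assms by simp
  then have "tpow (munit 2 2) k = tpow (munit 2 2) (k - 1) \<otimes> munit 2 2"
    by (metis tpow_Suc_right[OF M3_munit])
  then show ?thesis
    by (simp add: beta_def tens_assoc[OF M3_closed(3)[OF M3_munit2 M3_munit2] M3_tpow[OF M3_munit]])
qed

text \<open>No lengths are assumed for \<open>u\<close> and \<open>v\<close>, so that entries can
  later be compared without side conditions. If the lengths do not fit, both sides are 0.\<close>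

lemma tens_munit_snoc:
  assumes "a \<in> M3 n"
  shows "(a \<otimes> munit i j) (u @ [p]) (v @ [q]) = (if p = i \<and> q = j then a u v else 0)"
proof -
  consider "length u < n" "n < Suc (length u)" | "length u = n" | "length u > n" | "n > Suc (length u)" "length u < n"
    | "n = Suc (length u)" by linarith
  then show ?thesis
  proof cases
    case 2
    have tu: "take (length u) (u @ [r]) = u" "drop (length u) (u @ [r]) = [r]" for r by auto
    show ?thesis
    proof (cases "length v = n")
      case True
      then show ?thesis using 2 by (auto simp: tens_apply[OF assms] munit_def)
    next
      case False
      then have "a u v = 0" by (intro M3_0[OF assms]) (simp add: words_iff)
      moreover have "a u (take n (v @ [q])) * munit i j [p] (drop n (v @ [q])) = 0"
      proof (cases "n \<le> length v")
        case True
        then have "length (drop n (v @ [q])) \<noteq> 1" using False by simp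
        then have "drop n (v @ [q]) \<noteq> [j]" by (metis length_Cons list.size(3) One_nat_def)
        then show ?thesis by (simp add: munit_def del: drop_append)
      next
        case False
        then have "drop n (v @ [q]) \<noteq> [j]" by simp
        then show ?thesis by (simp add: munit_def del: drop_append)
      qed
      ultimately show ?thesis using 2
        unfolding tens_apply[OF assms] by (auto simp del: take_append drop_append simp: tu)
    qed
  qed (use M3_0[OF assms, of u v] in \<open>auto simp: tens_apply[OF assms] munit_def words_iff\<close>)
qed

lemma tens_beta_1:
  assumes "y \<in> M3 n"
  shows "y \<otimes> beta 1 j = (y \<otimes> munit j j) \<otimes> munit 1 1 + (y \<otimes> munit (j + 2) (j + 2)) \<otimes> munit 3 3"
proof -
  have "beta 1 j = munit j j \<otimes> munit 1 1 + munit (j + 2) (j + 2) \<otimes> munit 3 3"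
    using tens_mid_0[OF M3_closed(3)[OF M3_munit2 M3_munit2]] by (simp add: beta_def)
  then show ?thesis by (simp add: tens_add_right tens_assoc[OF assms M3_munit])
qed

lemma sum_words_Suc: "sum f (words (Suc n)) = (\<Sum>u\<in>words n. \<Sum>p\<in>UNIV. f (u @ [p]))"
proof -
  have w: "words 1 = range (\<lambda>p. [p])" by (auto simp: words_def length_Suc_conv)
  have "sum f (words (n + 1)) = (\<Sum>u\<in>words n. \<Sum>q\<in>words 1. f (u @ q))" by (rule sum_words_add)
  then show ?thesis unfolding w by (simp add: sum.reindex inj_on_def)
qed

lemma wmat_snoc_eqI:
  assumes "a \<in> M3 (Suc n)" "b \<in> M3 (Suc n)" "\<And>u v p q. a (u @ [p]) (v @ [q]) = b (u @ [p]) (v @ [q])"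
  shows "a = b"
proof (intro ext)
  fix u v :: "3 list"
  show "a u v = b u v"
  proof (cases "u = [] \<or> v = []")
    case True
    then have "u \<notin> words (Suc n) \<or> v \<notin> words (Suc n)" by (auto simp: words_iff)
    then show ?thesis using M3_0[OF assms(1)] M3_0[OF assms(2)] by metis
  next
    case False
    then show ?thesis using assms(3) by (metis append_butlast_last_id)
  qed
qed

section \<open>Diagonal blocks with respect to the last tensor factor\<close>

definition blk :: "3 \<Rightarrow> wmat \<Rightarrow> wmat" where
  "blk p b = (\<lambda>u v. b (u @ [p]) (v @ [p]))"

definition ldiag :: "wmat \<Rightarrow> bool" where
  "ldiag b \<longleftrightarrow> (\<forall>u v p q. p \<noteq> q \<longrightarrow> b (u @ [p]) (v @ [q]) = 0)"

lemma M3_blk: "b \<in> M3 (Suc n) \<Longrightarrow> blk p b \<in> M3 n"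
  by (force simp: M3_def blk_def words_iff)

lemma blk_simps:
  "blk p (a + b) = blk p a + blk p b" "blk p (smul c a) = smul c (blk p a)"
  "blk p (madj a) = madj (blk p a)" "blk p 0 = 0"
  by (simp_all add: blk_def smul_def madj_def fun_eq_iff)

lemma ldiag_simps:
  "ldiag a \<Longrightarrow> ldiag b \<Longrightarrow> ldiag (a + b)" "ldiag a \<Longrightarrow> ldiag (smul c a)"
  "ldiag a \<Longrightarrow> ldiag (madj a)" "ldiag 0"
  by (auto simp: ldiag_def smul_def madj_def)

lemma mmul_snoc: 
  "mmul a b (u @ [p]) (v @ [q]) = (\<Sum>w\<in>words (length u). \<Sum>r\<in>UNIV. a (u @ [p]) (w @ [r]) * b (w @ [r]) (v @ [q]))"
  by (simp add: mmul_def sum_words_Suc)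

lemma blk_mmul: assumes "ldiag a" shows "blk p (mmul a b) = mmul (blk p a) (blk p b)"
proof -
  have "(\<Sum>r\<in>UNIV. a (u @ [p]) (w @ [r]) * b (w @ [r]) v) = a (u @ [p]) (w @ [p]) * b (w @ [p]) v" for u v w
    using assms by (subst sum.remove[of _ p]) (auto simp: ldiag_def intro!: sum.neutral)
  then show ?thesis unfolding blk_def mmul_snoc by (simp add: mmul_def)
qed

lemma ldiag_mmul: assumes "ldiag a" "ldiag b" shows "ldiag (mmul a b)"
  unfolding ldiag_def
proof (intro allI impI)
  fix u v and p q :: 3 assume "p \<noteq> q"
  then have "a (u @ [p]) (w @ [r]) * b (w @ [r]) (v @ [q]) = 0" for w r
    using assms by (cases "p = r") (auto simp: ldiag_def)
  then show "mmul a b (u @ [p]) (v @ [q]) = 0" unfolding mmul_snoc by (intro sum.neutral ballI) blast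
qed

lemma blk_mid: "blk p (mid (Suc n)) = mid n"
  by (auto simp: blk_def mid_def fun_eq_iff words_iff)

lemma ldiag_mid: "ldiag (mid n)"
  by (auto simp: ldiag_def mid_def)

text \<open>Both the unit (lemma \<open>mid_dmat\<close>) and the weights used later for lifting
  (\<open>wdiag\<close>) have this form.\<close>

definition dmat :: "nat \<Rightarrow> (3 list \<Rightarrow> complex) \<Rightarrow> wmat" where
  "dmat n h = (\<lambda>u v. if u = v \<and> u \<in> words n then h u else 0)"

lemma mid_dmat: "mid n = dmat n (\<lambda>_. 1)"
  by (simp add: mid_def dmat_def)

lemma M3_dmat: "dmat n h \<in> M3 n"
  by (auto simp: M3_def dmat_def)

lemma blk_tens_dmat:
  assumes "x \<in> M3 m" shows "blk p (x \<otimes> dmat (Suc n) h) = x \<otimes> dmat n (\<lambda>u. h (u @ [p]))"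
proof (intro ext)
  fix u v
  show "blk p (x \<otimes> dmat (Suc n) h) u v = (x \<otimes> dmat n (\<lambda>u. h (u @ [p]))) u v"
  proof (cases "m \<le> length u")
    case True
    show ?thesis
    proof (cases "m \<le> length v")
      case True
      then show ?thesis using \<open>m \<le> length u\<close>
        by (auto simp: blk_def tens_apply[OF assms] dmat_def words_iff)
    next
      case False
      then show ?thesis using \<open>m \<le> length u\<close> M3_0[OF assms, of "take m u" v]
        by (auto simp: blk_def tens_apply[OF assms] dmat_def words_iff)
    qed
  next
    case False
    then show ?thesis by (auto simp: blk_def tens_apply[OF assms] dmat_def words_iff)
  qed
qed

lemma ldiag_tens_dmat:
  assumes "x \<in> M3 m" shows "ldiag (x \<otimes> dmat (Suc n) h)"
  unfolding ldiag_def
proof (intro allI impI)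
  fix u v and p q :: 3 assume "p \<noteq> q"
  have "drop m (u @ [p]) \<noteq> drop m (v @ [q]) \<or> drop m (u @ [p]) = []"
  proof (cases "m \<le> length u \<and> m \<le> length v")
    case True
    then show ?thesis using \<open>p \<noteq> q\<close> by auto
  next
    case False
    then show ?thesis by (cases "m \<le> length u") auto
  qed
  then have "dmat (Suc n) h (drop m (u @ [p])) (drop m (v @ [q])) = 0"
    by (auto simp: dmat_def words_iff simp del: drop_append)
  then show "(x \<otimes> dmat (Suc n) h) (u @ [p]) (v @ [q]) = 0"
    by (simp only: tens_apply[OF assms] mult_zero_right if_cancel)
qed

lemma blk_tens_mid: "x \<in> M3 m \<Longrightarrow> blk p (x \<otimes> mid (Suc n)) = x \<otimes> mid n"
  by (simp add: mid_dmat blk_tens_dmat)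

lemma ldiag_tens_mid: "x \<in> M3 m \<Longrightarrow> ldiag (x \<otimes> mid (Suc n))"
  by (simp add: mid_dmat ldiag_tens_dmat)

text \<open>
  Membership in \<open>calA n\<close> (lemma \<open>calA_eq\<close>), read off blockwise from the last tensor factor.
\<close>

fun inA :: "nat \<Rightarrow> wmat \<Rightarrow> bool" where
  "inA 0 b \<longleftrightarrow> b \<in> M3 1 \<and> ldiag b"
| "inA (Suc n) b \<longleftrightarrow> b \<in> M3 (Suc (Suc n)) \<and> ldiag b \<and> inA n (blk 2 b) \<and> ldiag (blk 1 b) \<and>
     ldiag (blk 3 b) \<and> (\<forall>i. blk i (blk 1 b) = blk (i + 2) (blk 3 b))"

lemma inA_M3: "inA n b \<Longrightarrow> b \<in> M3 (Suc n)"
  by (cases n) auto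

lemma inA_0: "inA n 0"
proof (induction n)
  case 0
  show "inA 0 0" using M3_closed(1)[of 1] by (simp add: ldiag_simps)
next
  case (Suc n)
  then have "inA n 0" by (simp add: zero_fun_def)
  then show "inA (Suc n) 0" using M3_closed(1)[of "Suc (Suc n)"] by (simp add: blk_simps ldiag_simps)
qed

lemma inA_add: "inA n a \<Longrightarrow> inA n b \<Longrightarrow> inA n (a + b)"
  by (induction n arbitrary: a b) (auto simp: M3_closed blk_simps ldiag_simps)

lemma inA_smul: "inA n a \<Longrightarrow> inA n (smul c a)"
  by (induction n arbitrary: a) (auto simp: M3_closed blk_simps ldiag_simps)

lemma inA_madj: "inA n a \<Longrightarrow> inA n (madj a)"
  by (induction n arbitrary: a) (auto simp: M3_closed blk_simps ldiag_simps)

lemma inA_mid: "inA n (mid (Suc n))"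
  by (induction n) (simp_all add: M3_closed blk_mid ldiag_mid)

lemma inA_mmul: "inA n a \<Longrightarrow> inA n b \<Longrightarrow> inA n (mmul a b)"
  by (induction n arbitrary: a b) (auto simp: M3_mmul blk_mmul ldiag_mmul)

text \<open>On \<open>calA (m + p)\<close> the slice map to \<open>M3 (m + 1)\<close> is \<open>blk 2 ^^ p\<close>; its kernel is stable under \<open>M3 m\<close>.\<close>

lemma inA_mult_tens_mid:
  assumes x: "x \<in> M3 m"
  shows "inA (m + p) b \<Longrightarrow> (blk 2 ^^ p) b = 0 \<Longrightarrow>
    inA (m + p) (mmul (x \<otimes> mid (Suc p)) b) \<and> (blk 2 ^^ p) (mmul (x \<otimes> mid (Suc p)) b) = 0"
proof (induction p arbitrary: b)
  case 0
  have z: "mmul y 0 = 0" for y by (simp add: mmul_def fun_eq_iff)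
  have b: "b = 0" using 0 by (simp add: fun_eq_iff)
  show "inA (m + 0) (mmul (x \<otimes> mid (Suc 0)) b) \<and> (blk 2 ^^ 0) (mmul (x \<otimes> mid (Suc 0)) b) = 0"
    unfolding b z by (simp add: inA_0)
next
  case (Suc p)
  let ?c = "mmul (x \<otimes> mid (Suc (Suc p))) b"
  have "inA (m + p) (blk 2 b)" using Suc.prems(1) by simp
  moreover have "(blk 2 ^^ p) (blk 2 b) = 0"
    using Suc.prems(2) unfolding funpow_Suc_right comp_apply .
  ultimately have b: "inA (m + p) (blk 2 b)" "(blk 2 ^^ p) (blk 2 b) = 0" .
  have c: "blk q ?c = mmul (x \<otimes> mid (Suc p)) (blk q b)" for q
    by (simp add: blk_mmul ldiag_tens_mid[OF x] blk_tens_mid[OF x])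
  have "x \<otimes> mid (Suc (Suc p)) \<in> M3 (Suc (Suc (m + p)))"
    using M3_tens[OF x M3_closed(2), of "Suc (Suc p)"] by simp
  then have "inA (m + Suc p) ?c"
    using Suc.prems(1) Suc.IH[OF b]
    by (auto simp: c blk_mmul ldiag_tens_mid[OF x] blk_tens_mid[OF x] ldiag_mmul M3_mmul)
  moreover have "(blk 2 ^^ Suc p) ?c = 0"
    unfolding funpow_Suc_right comp_apply c using Suc.IH[OF b] by blast
  ultimately show "inA (m + Suc p) ?c \<and> (blk 2 ^^ Suc p) ?c = 0" ..
qed

text \<open>Compression to a block is not multiplicative on all matrices. It is so here because at
  every stage the left factor is block diagonal in the last tensor factor.\<close>

lemma blk_pow_mmul: "inA (n + p) a \<Longrightarrow> (blk 2 ^^ p) (mmul a b) = mmul ((blk 2 ^^ p) a) ((blk 2 ^^ p) b)"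
  by (induction p arbitrary: a b) (auto simp: funpow_swap1 blk_mmul)

lemma inA_blk_pow: "inA (n + p) a \<Longrightarrow> inA n ((blk 2 ^^ p) a)"
  by (induction p arbitrary: a) (auto simp: funpow_swap1)

lemma blk_pow_apply: "(blk 2 ^^ p) a u v = a (u @ replicate p 2) (v @ replicate p 2)"
proof (induction p arbitrary: a)
  case (Suc p)
  have "(blk 2 ^^ Suc p) a u v = (blk 2 a) (u @ replicate p 2) (v @ replicate p 2)"
    by (simp only: funpow_Suc_right comp_apply Suc)
  then show "(blk 2 ^^ Suc p) a u v = a (u @ replicate (Suc p) 2) (v @ replicate (Suc p) 2)"
    by (simp only: blk_def append_assoc replicate_append_same replicate_Suc)
qed simp

lemma slice_eq_blk: assumes "a \<in> M3 (n + p)" shows "slice n p a = (blk 2 ^^ p) a"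
  using M3_0[OF assms] by (auto simp: slice_def blk_pow_apply fun_eq_iff words_iff)


text \<open>\<open>beta 1 j\<close> is the sum of \<open>munit j j \<otimes> munit 1 1\<close> and
  \<open>munit (j + 2) (j + 2) \<otimes> munit 3 3\<close>. So block 2 of \<open>b\<close> is
  \<open>a\<close>, while blocks 1 and 3 carry the same matrices \<open>y j\<close>, at the diagonal
  positions \<open>j\<close> and \<open>j + 2\<close>. These are the conditions by which
  \<open>inA\<close> passes from \<open>n\<close> to \<open>Suc n\<close>.\<close>

lemma expansion_step:
  assumes a: "a \<in> M3 (Suc n)" and y: "\<And>j. y j \<in> M3 n"
  defines "b \<equiv> a \<otimes> munit 2 2 + (\<Sum>j\<in>UNIV. y j \<otimes> beta 1 j)"
  shows "b \<in> M3 (Suc (Suc n))" "ldiag b" "blk 2 b = a" "ldiag (blk 1 b)" "ldiag (blk 3 b)"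
    "blk j (blk 1 b) = y j" "blk (j + 2) (blk 3 b) = y j"
proof -
  have M: "y j \<otimes> munit i i \<in> M3 (Suc n)" for i j
    using M3_tens[OF y M3_munit] by simp
  have b1: "beta 1 j \<in> M3 (1 + 1)" for j using M3_beta[of 1 j] by simp
  have "y j \<otimes> beta 1 j \<in> M3 (Suc (Suc n))" for j
    using M3_tens[OF y b1] by simp
  then have "(\<Sum>j\<in>S. y j \<otimes> beta 1 j) \<in> M3 (Suc (Suc n))" for S
    by (rule M3_sum)
  then show "b \<in> M3 (Suc (Suc n))"
    using M3_tens[OF a M3_munit] unfolding b_def by (intro M3_closed(3)) simp_all
  have e: "b (u @ [p]) (v @ [q]) = (if p \<noteq> q then 0 else if p = 2 then a u v else
      if p = 1 then (\<Sum>j\<in>UNIV. (y j \<otimes> munit j j) u v) else (\<Sum>j\<in>UNIV. (y j \<otimes> munit (j + 2) (j + 2)) u v))" for u v p q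
    using exhaust_3[of p] exhaust_3[of q]
    unfolding b_def tens_beta_1[OF y] by (auto simp: tens_munit_snoc[OF a] sum_apply2 tens_munit_snoc[OF M])
  show "ldiag b" by (simp add: ldiag_def e)
  show "blk 2 b = a" by (simp add: blk_def e)
  have b1: "blk 1 b = (\<lambda>u v. \<Sum>j\<in>UNIV. (y j \<otimes> munit j j) u v)"
    and b3: "blk 3 b = (\<lambda>u v. \<Sum>j\<in>UNIV. (y j \<otimes> munit (j + 2) (j + 2)) u v)"
    by (simp_all add: blk_def e)
  show "ldiag (blk 1 b)" "ldiag (blk 3 b)"
    unfolding b1 b3 ldiag_def by (auto simp: tens_munit_snoc[OF y] intro!: sum.neutral)
  show "blk j (blk 1 b) = y j" "blk (j + 2) (blk 3 b) = y j"
    unfolding b1 b3 by (simp_all add: blk_def tens_munit_snoc[OF y] fun_eq_iff)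
qed

lemma wmat_blk_eqI:
  assumes "a \<in> M3 (Suc n)" "b \<in> M3 (Suc n)" "ldiag a" "ldiag b" "\<And>p. blk p a = blk p b"
  shows "a = b"
proof (rule wmat_snoc_eqI[OF assms(1,2)])
  fix u v p q
  show "a (u @ [p]) (v @ [q]) = b (u @ [p]) (v @ [q])"
  proof (cases "p = q")
    case True
    then show ?thesis using fun_cong[OF fun_cong[OF assms(5)[of p]], of u v] by (simp add: blk_def)
  next
    case False
    then show ?thesis using assms(3,4) by (simp add: ldiag_def)
  qed
qed

text \<open>The matrix rebuilt from the blocks of \<open>b\<close> has the same blocks as
  \<open>b\<close> by \<open>expansion_step\<close>, and a block diagonal matrix is determined by
  its blocks.\<close>

lemma expansion_unique:
  assumes b: "b \<in> M3 (Suc (Suc n))" "ldiag b" "ldiag (blk 1 b)" "ldiag (blk 3 b)"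
    and eq: "\<And>i. blk i (blk 1 b) = blk (i + 2) (blk 3 b)"
  shows "b = blk 2 b \<otimes> munit 2 2 + (\<Sum>j\<in>UNIV. blk j (blk 1 b) \<otimes> beta 1 j)"
proof -
  define c where "c = blk 2 b \<otimes> munit 2 2 + (\<Sum>j\<in>UNIV. blk j (blk 1 b) \<otimes> beta 1 j)"
  have M: "blk 2 b \<in> M3 (Suc n)" "blk j (blk 1 b) \<in> M3 n" for j
    by (rule M3_blk[OF b(1)], rule M3_blk[OF M3_blk[OF b(1)]])
  note s = expansion_step[of "blk 2 b" n "\<lambda>j. blk j (blk 1 b)", OF M, folded c_def]
  note Mb = M3_blk[OF b(1)] and Mc = M3_blk[OF s(1)]
  have 1: "blk 1 b = blk 1 c"
  proof (rule wmat_blk_eqI)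
    show "blk 1 b \<in> M3 (Suc n)" "blk 1 c \<in> M3 (Suc n)" by (rule Mb, rule Mc)
    show "ldiag (blk 1 b)" "ldiag (blk 1 c)" by (rule b(3), rule s(4))
    show "blk p (blk 1 b) = blk p (blk 1 c)" for p by (rule s(6)[symmetric])
  qed
  \<comment> \<open>Indices are residues mod 3, so every \<open>p\<close> has the form
    \<open>i + 2\<close> and the condition linking blocks 1 and 3 reaches all of
    \<open>blk 3 b\<close>.\<close>
  have p3: "blk (p - 2 + 2) (blk 3 b) = blk (p - 2 + 2) (blk 3 c)" for p
    unfolding eq[symmetric] s(7) ..
  have eq3: "blk p (blk 3 b) = blk p (blk 3 c)" for p using p3[of p] by simp
  have 3: "blk 3 b = blk 3 c"
  proof (rule wmat_blk_eqI)
    show "blk 3 b \<in> M3 (Suc n)" "blk 3 c \<in> M3 (Suc n)" by (rule Mb, rule Mc)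
    show "ldiag (blk 3 b)" "ldiag (blk 3 c)" by (rule b(4), rule s(5))
  qed (rule eq3)
  have "blk p b = blk p c" for p
    using exhaust_3[of p] 1 3 s(3) by auto
  then have "b = c" by (rule wmat_blk_eqI[OF b(1) s(1) b(2) s(2)])
  then show ?thesis unfolding c_def .
qed

definition expand :: "nat \<Rightarrow> (3 \<Rightarrow> complex) \<Rightarrow> (nat \<Rightarrow> 3 \<Rightarrow> wmat) \<Rightarrow> wmat" where
  "expand n x y = (\<Sum>j\<in>UNIV. smul (x j) (alpha n j)) + (\<Sum>k<n. \<Sum>j\<in>UNIV. y k j \<otimes> beta (n - k) j)"

lemma is_expansion_expand: "is_expansion n b x y \<longleftrightarrow> (\<forall>k<n. \<forall>j. y k j \<in> M3 k) \<and> b = expand n x y"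
  by (simp add: is_expansion_def expand_def)

text \<open>Coefficients keep their index \<open>k\<close> when \<open>n\<close> grows: the old
  terms are merely tensored with \<open>munit 2 2\<close>, and the new ones enter at
  \<open>k = n\<close>.\<close>

lemma expand_Suc:
  assumes "\<And>k j. k < n \<Longrightarrow> y k j \<in> M3 k"
  shows "expand (Suc n) x y = expand n x y \<otimes> munit 2 2 + (\<Sum>j\<in>UNIV. y n j \<otimes> beta 1 j)"
proof -
  have "y k j \<otimes> beta (Suc n - k) j = (y k j \<otimes> beta (n - k) j) \<otimes> munit 2 2" if "k < n" for k j
    using that beta_Suc[of "n - k" j] tens_assoc[OF assms[OF that] M3_beta[of "n - k"]]
    by (simp add: Suc_diff_le)
  then have "(\<Sum>k<n. \<Sum>j\<in>UNIV. y k j \<otimes> beta (Suc n - k) j)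
      = (\<Sum>k<n. \<Sum>j\<in>UNIV. y k j \<otimes> beta (n - k) j) \<otimes> munit 2 2"
    unfolding tens_sum by (intro sum.cong refl) simp
  moreover have "(\<Sum>j\<in>UNIV. smul (x j) (alpha (Suc n) j)) = (\<Sum>j\<in>UNIV. smul (x j) (alpha n j)) \<otimes> munit 2 2"
    unfolding tens_sum alpha_Suc tens_smul ..
  ultimately show ?thesis
    unfolding expand_def tens_add by (simp only: sum.lessThan_Suc diff_Suc_Suc Suc_diff_diff) 
      (simp only: Suc_diff_le[OF order_refl] diff_self_eq_0 add.assoc One_nat_def)
qed

lemma expand_0: "expand 0 x y = (\<lambda>u v. \<Sum>j\<in>UNIV. if u = [j] \<and> v = [j] then x j else 0)"
proof -
  have "alpha 0 j = munit j j" for j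
    using tens_mid_0[OF M3_munit, of j j] by (simp add: alpha_def)
  then show ?thesis
    unfolding expand_def fun_eq_iff by (auto simp: sum_apply2 smul_def munit_def intro!: sum.cong)
qed

text \<open>Each coefficient can be read off: strip trailing factors \<open>munit 2 2\<close> with
  \<open>blk 2\<close>, then select the last letters 1 and \<open>j\<close>. A single equivalence
  thus yields existence and uniqueness of expansions and explicit formulas for \<open>xi\<close> and
  \<open>eta\<close>.\<close>

lemma is_expansion_iff:
  "is_expansion n b x y \<longleftrightarrow> inA n b \<and> (\<forall>j. x j = b (j # replicate n 2) (j # replicate n 2)) \<and>
     (\<forall>k<n. \<forall>j. y k j = blk j (blk 1 ((blk 2 ^^ (n - Suc k)) b)))"
proof (induction n arbitrary: b)
  case 0
  have M: "expand 0 x y \<in> M3 1" "ldiag (expand 0 x y)" "expand 0 x y [j] [j] = x j" for j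
    unfolding expand_0 by (auto simp: M3_def words_iff ldiag_def sum.delta' intro!: sum.neutral)
      (metis (mono_tags, lifting) length_Cons list.size(3) sum.neutral One_nat_def)+
  show ?case (is "?l \<longleftrightarrow> ?r")
  proof
    assume ?l then show ?r using M by (simp add: is_expansion_expand)
  next
    assume r: ?r
    have "b = expand 0 x y"
    proof (rule wmat_blk_eqI[of _ 0])
      show "b \<in> M3 (Suc 0)" "expand 0 x y \<in> M3 (Suc 0)" "ldiag b" "ldiag (expand 0 x y)"
        using r M by simp_all
      fix p
      have "blk p b [] [] = blk p (expand 0 x y) [] []" using r M(3)[of p] by (simp add: blk_def)
      moreover have "blk p b \<in> M3 0" "blk p (expand 0 x y) \<in> M3 0"
        using r M by (auto intro!: M3_blk)
      ultimately show "blk p b = blk p (expand 0 x y)"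
        unfolding M3_def fun_eq_iff words_0 by (metis (mono_tags, lifting) mem_Collect_eq singletonD)
    qed
    then show ?l by (simp add: is_expansion_expand)
  qed
next
  case (Suc n)
  show ?case (is "?l \<longleftrightarrow> ?r")
  proof
    assume l: ?l
    then have y: "\<And>k j. k < Suc n \<Longrightarrow> y k j \<in> M3 k" and b: "b = expand (Suc n) x y"
      by (simp_all add: is_expansion_expand)
    have "is_expansion n (expand n x y) x y" using y by (simp add: is_expansion_expand)
    note IH = this[unfolded Suc.IH]
    have E: "expand n x y \<in> M3 (Suc n)" using IH inA_M3 by blast
    have b': "b = expand n x y \<otimes> munit 2 2 + (\<Sum>j\<in>UNIV. y n j \<otimes> beta 1 j)"
      unfolding b using y by (intro expand_Suc) simp
    note s = expansion_step[of _ n "y n", OF E y[of n, simplified], folded b']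
    have "inA (Suc n) b" using s IH by simp
    moreover have "x j = b (j # replicate (Suc n) 2) (j # replicate (Suc n) 2)" for j
    proof -
      have "x j = blk 2 b (j # replicate n 2) (j # replicate n 2)" using IH s(3) by simp
      then show ?thesis by (simp add: blk_def replicate_append_same)
    qed
    moreover have "y k j = blk j (blk 1 ((blk 2 ^^ (Suc n - Suc k)) b))" if "k < Suc n" for k j
    proof (cases "k = n")
      case True
      then show ?thesis using s(6) by simp
    next
      case False
      then have k: "k < n" and e: "Suc n - Suc k = Suc (n - Suc k)" using that by auto
      have "(blk 2 ^^ (Suc n - Suc k)) b = (blk 2 ^^ (n - Suc k)) (expand n x y)"
        unfolding e funpow_Suc_right comp_apply s(3) ..
      then show ?thesis using IH k by simp
    qed
    ultimately show ?r by blast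
  next
    assume r: ?r
    have x: "x j = blk 2 b (j # replicate n 2) (j # replicate n 2)" for j
      using r by (simp add: blk_def replicate_append_same)
    have yn: "y n j = blk j (blk 1 b)" for j using r by simp
    have y: "y k j = blk j (blk 1 ((blk 2 ^^ (n - Suc k)) (blk 2 b)))" if "k < n" for k j
    proof -
      have "Suc n - Suc k = Suc (n - Suc k)" using that by auto
      then have "(blk 2 ^^ (Suc n - Suc k)) b = (blk 2 ^^ (n - Suc k)) (blk 2 b)"
        by (simp only: funpow_Suc_right comp_apply)
      then show ?thesis using r that by (metis less_SucI)
    qed
    have "is_expansion n (blk 2 b) x y"
      unfolding Suc.IH using r x y by simp
    then have 1: "\<And>k j. k < n \<Longrightarrow> y k j \<in> M3 k" and 2: "blk 2 b = expand n x y"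
      by (simp_all add: is_expansion_expand)
    have "b \<in> M3 (Suc (Suc n))" using r by simp
    then have 3: "y n j \<in> M3 n" for j unfolding yn by (rule M3_blk[OF M3_blk])
    have "b = blk 2 b \<otimes> munit 2 2 + (\<Sum>j\<in>UNIV. blk j (blk 1 b) \<otimes> beta 1 j)"
      using r by (intro expansion_unique[of b n]) simp_all
    then have "b = expand (Suc n) x y"
      using expand_Suc[of n y x, OF 1] by (simp only: yn 2)
    moreover have "y k j \<in> M3 k" if "k < Suc n" for k j
      using 1 3 that by (cases "k = n") auto
    ultimately show ?l by (simp add: is_expansion_expand)
  qed
qed

lemma is_expansion_ex:
  assumes "inA n b"
  shows "is_expansion n b (\<lambda>j. b (j # replicate n 2) (j # replicate n 2))
     (\<lambda>k j. blk j (blk 1 ((blk 2 ^^ (n - Suc k)) b)))"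
  using assms by (simp add: is_expansion_iff)

lemma xi_eq: assumes "inA n b" shows "xi n j b = b (j # replicate n 2) (j # replicate n 2)"
  unfolding xi_def
proof (rule the_equality)
  show "\<exists>x y. is_expansion n b x y \<and> b (j # replicate n 2) (j # replicate n 2) = x j"
    using is_expansion_ex[OF assms] by blast
qed (auto simp: is_expansion_iff)

lemma eta_eq:
  assumes "inA n b" "k < n" shows "eta n k j b = blk j (blk 1 ((blk 2 ^^ (n - Suc k)) b))"
  unfolding eta_def
proof (rule the_equality)
  show "\<exists>x y. is_expansion n b x y \<and> blk j (blk 1 ((blk 2 ^^ (n - Suc k)) b)) = y k j"
    using is_expansion_ex[OF assms(1)] by blast
qed (use assms in \<open>auto simp: is_expansion_iff\<close>)

lemma calA_eq: "calA n = {b. inA n b}"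
proof -
  interpret vector_space smul by (rule vector_space_smul)
  let ?G = "range (alpha n) \<union> {x \<otimes> beta k j | x k j. 1 \<le> k \<and> k \<le> n \<and> x \<in> M3 (n - k)}"
  have sub: "subspace {b. inA n b}"
    by (auto simp: subspace_def inA_0 inA_add inA_smul)
  have G: "?G \<subseteq> {b. inA n b}"
  proof
    fix g assume "g \<in> ?G"
    then consider j where "g = alpha n j" | x k j where "g = x \<otimes> beta k j" "1 \<le> k" "k \<le> n" "x \<in> M3 (n - k)"
      by auto
    then show "g \<in> {b. inA n b}"
    proof cases
      case 1
      have "expand n (\<lambda>i. if i = j then 1 else 0) (\<lambda>k j. 0) = alpha n j"
        unfolding expand_def by (simp add: fun_eq_iff sum_apply2 smul_def tens_0 if_distrib[of "\<lambda>x. x * _"] cong: if_cong)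
      then have "is_expansion n g (\<lambda>i. if i = j then 1 else 0) (\<lambda>k j. 0)"
        using 1 M3_closed(1) by (simp add: is_expansion_expand)
      then show ?thesis by (simp add: is_expansion_iff)
    next
      case 2
      have "(\<Sum>k'<n. \<Sum>i\<in>UNIV. (if k' = n - k \<and> i = j then x else 0) \<otimes> beta (n - k') i) u v
         = (x \<otimes> beta k j) u v" for u v
      proof -
        have "(\<Sum>i\<in>UNIV. ((if k' = n - k \<and> i = j then x else 0) \<otimes> beta (n - k') i) u v)
          = (if k' = n - k then (x \<otimes> beta k j) u v else 0)" for k'
          using 2 by (subst sum.remove[of _ j]) (auto simp: tens_0 intro!: sum.neutral)
        then show ?thesis unfolding sum_apply2 using 2 by simp
      qed
      then have "expand n (\<lambda>i. 0) (\<lambda>k' i. if k' = n - k \<and> i = j then x else 0) = g"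
        unfolding expand_def 2(1) by (simp add: fun_eq_iff sum_apply2 smul_def)
      then have "is_expansion n g (\<lambda>i. 0) (\<lambda>k' i. if k' = n - k \<and> i = j then x else 0)"
        using 2 M3_closed(1) by (simp add: is_expansion_expand)
      then show ?thesis by (simp add: is_expansion_iff)
    qed
  qed
  have "b \<in> span ?G" if "inA n b" for b
  proof -
    obtain x y where "is_expansion n b x y" using is_expansion_ex[OF \<open>inA n b\<close>] by blast
    then have y: "\<And>k j. k < n \<Longrightarrow> y k j \<in> M3 k" and b: "b = expand n x y"
      by (simp_all add: is_expansion_expand)
    show ?thesis unfolding b expand_def
    proof (intro span_add span_sum span_scale)
      show "alpha n j \<in> span ?G" for j by (rule span_base) blast
      fix k j assume "k \<in> {..<n}"
      then show "y k j \<otimes> beta (n - k) j \<in> span ?G"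
        using y by (intro span_base UnI2 CollectI exI[of _ "y k j"] exI[of _ "n - k"] exI[of _ j]) auto
    qed
  qed
  moreover have "span ?G \<subseteq> {b. inA n b}" by (rule span_minimal[OF G sub])
  ultimately show ?thesis unfolding calA_def by blast
qed

section \<open>The slice maps\<close>

lemma uhf_cases: obtains a where "x = abs_uhf a" "a \<in> uhf_seq"
  using Quotient_rep[of x] by metis

lemma abs_uhf_simps:
  assumes "a \<in> uhf_seq"
  shows "scaleC c (abs_uhf a) = abs_uhf (\<lambda>n. smul c (a n))" "star (abs_uhf a) = abs_uhf (\<lambda>n. madj (a n))"
    "norm (abs_uhf a) = lim (\<lambda>n. opnorm n (a n))"
    "b \<in> uhf_seq \<Longrightarrow> abs_uhf a + abs_uhf b = abs_uhf (\<lambda>n. a n + b n)"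
    "b \<in> uhf_seq \<Longrightarrow> abs_uhf a * abs_uhf b = abs_uhf (\<lambda>n. mmul (a n) (b n))"
  using assms uhf_rel_refl
  by (simp_all add: plus_uhf.abs_eq times_uhf.abs_eq scaleC.abs_eq star.abs_eq norm_uhf.abs_eq)

lemma opnorm_tendsto: "a \<in> uhf_seq \<Longrightarrow> (\<lambda>n. opnorm n (a n)) \<longlonglongrightarrow> norm (abs_uhf a)"
  by (simp add: abs_uhf_simps norm_uhf_tendsto)

lemma iota_add: assumes "x \<in> M3 n" "y \<in> M3 n" shows "iota n (x + y) = iota n x + iota n y"
proof -
  have "const_seq n (x + y) = (\<lambda>m. const_seq n x m + const_seq n y m)"
    by (rule ext) (simp add: const_seq_def tens_add)
  then show ?thesis using assms by (simp add: iota_def abs_uhf_simps uhf_seq_const)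
qed

lemma iota_smul: assumes "x \<in> M3 n" shows "iota n (smul c x) = scaleC c (iota n x)"
proof -
  have "const_seq n (smul c x) = (\<lambda>m. smul c (const_seq n x m))"
    by (rule ext) (simp add: const_seq_def tens_smul, simp add: smul_def fun_eq_iff)
  then show ?thesis using assms by (simp add: iota_def abs_uhf_simps uhf_seq_const)
qed

lemma iota_madj: assumes "x \<in> M3 n" shows "iota n (madj x) = star (iota n x)"
proof -
  have "const_seq n (madj x) = (\<lambda>m. madj (const_seq n x m))"
    by (rule ext) (simp add: const_seq_def tens_madj[OF assms], simp add: madj_def fun_eq_iff)
  then show ?thesis using assms by (simp add: iota_def abs_uhf_simps uhf_seq_const)
qed

lemma iota_mmul: assumes "x \<in> M3 n" "y \<in> M3 n" shows "iota n (mmul x y) = iota n x * iota n y"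
proof -
  have "const_seq n (mmul x y) = (\<lambda>m. mmul (const_seq n x m) (const_seq n y m))"
    by (rule ext) (simp add: const_seq_def tens_mmul[OF assms], simp add: mmul_def fun_eq_iff)
  then show ?thesis using assms by (simp add: iota_def abs_uhf_simps uhf_seq_const)
qed

lemma uminus_smul: "- (x::wmat) = smul (-1) x"
  by (simp add: smul_def fun_eq_iff)

lemma uminus_scaleC: "- x = scaleC (-1) x"
  using scaleR_scaleC[of "-1" x] by simp

lemma iota_diff: assumes "x \<in> M3 n" "y \<in> M3 n" shows "iota n (x - y) = iota n x - iota n y"
proof -
  have "iota n (x + - y) = iota n x + iota n (- y)" using assms by (intro iota_add M3_closed(5))
  also have "iota n (- y) = - iota n y" unfolding uminus_smul iota_smul[OF assms(2)] uminus_scaleC[of "iota n y"] ..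
  finally show ?thesis by (simp only: diff_conv_add_uminus)
qed

lemma iota_mid: "iota n (mid n) = 1"
proof -
  have "uhf_rel (const_seq n (mid n)) mid"
    unfolding uhf_rel_def
  proof (intro conjI)
    show "const_seq n (mid n) \<in> uhf_seq" by (rule uhf_seq_const[OF M3_closed(2)])
    show "mid \<in> uhf_seq" by (rule uhf_seq_mid)
    have "opnorm m (const_seq n (mid n) m - mid m) = 0" if "m \<ge> n" for m
      using that by (simp add: const_seq_def tens_mid_mid)
    then have "\<forall>\<^sub>F m in sequentially. opnorm m (const_seq n (mid n) m - mid m) = 0"
      by (auto simp: eventually_sequentially)
    then show "(\<lambda>m. opnorm m (const_seq n (mid n) m - mid m)) \<longlonglongrightarrow> 0" by (rule tendsto_eventually)
  qed
  then show ?thesis unfolding iota_def one_uhf_def by (simp add: Quotient3_rel_abs[OF Quotient3_uhf])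
qed

text \<open>\<open>tau_inf\<close> and the entries of \<open>rho\<close> are defined by
  \<open>lim\<close>, which carries information only if the limit exists. Contractivity and
  compatibility with the embeddings make the values Cauchy; the threshold \<open>N\<close> admits
  slices, which are meaningful only from level \<open>m + 1\<close> on.\<close>

lemma uhf_functional_convergent:
  fixes F :: "nat \<Rightarrow> wmat \<Rightarrow> complex"
  assumes a: "a \<in> uhf_seq"
    and bound: "\<And>n x y. x \<in> M3 n \<Longrightarrow> y \<in> M3 n \<Longrightarrow> N \<le> n \<Longrightarrow> cmod (F n x - F n y) \<le> opnorm n (x - y)"
    and compat: "\<And>n k x. x \<in> M3 n \<Longrightarrow> N \<le> n \<Longrightarrow> F (n + k) (x \<otimes> mid k) = F n x"
  shows "convergent (\<lambda>n. F n (a n))"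
proof -
  have "Cauchy (\<lambda>n. F n (a n))"
  proof (rule metric_CauchyI)
    fix e :: real assume e: "e > 0"
    have "\<exists>K. \<forall>n\<ge>K. \<forall>k. opnorm (n + k) (a (n + k) - a n \<otimes> mid k) < e/2"
      using a half_gt_zero[OF e] unfolding uhf_seq_def mem_Collect_eq by blast
    then obtain K where K: "\<forall>n\<ge>K. \<forall>k. opnorm (n + k) (a (n + k) - a n \<otimes> mid k) < e/2" ..
    define M where "M = max K N"
    have *: "dist (F n (a n)) (F M (a M)) < e/2" if ge: "n \<ge> M" for n
    proof -
      obtain k where k: "n = M + k" using le_Suc_ex[OF ge] by blast
      have Mn: "N \<le> M" "K \<le> M" by (auto simp: M_def)
      have "F M (a M) = F (M + k) (a M \<otimes> mid k)"
        using compat[OF uhf_seq_M3[OF a] Mn(1)] by simp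
      then have "cmod (F n (a n) - F M (a M)) \<le> opnorm (M + k) (a (M + k) - a M \<otimes> mid k)"
        unfolding k using bound[OF uhf_seq_M3[OF a] M3_tens[OF uhf_seq_M3[OF a] M3_closed(2)], of M k] Mn by simp
      also have "\<dots> < e/2" using K Mn(2) by simp
      finally show ?thesis by (simp add: dist_norm)
    qed
    show "\<exists>M. \<forall>m\<ge>M. \<forall>n\<ge>M. dist (F m (a m)) (F n (a n)) < e"
    proof (intro exI allI impI)
      fix m n assume "M \<le> m" "M \<le> n"
      then show "dist (F m (a m)) (F n (a n)) < e"
        using *[of m] *[of n] dist_triangle2[of "F m (a m)" "F n (a n)" "F M (a M)"] by linarith
    qed
  qed
  then show ?thesis by (simp add: Cauchy_convergent_iff)
qed

lemma ntr_diff: "ntr n x - ntr n y = ntr n (x - y)"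
  by (simp add: ntr_def sum_subtractf diff_divide_distrib)

lemma tau_inf_tendsto: assumes "a \<in> uhf_seq" shows "(\<lambda>n. ntr n (a n)) \<longlonglongrightarrow> tau_inf (abs_uhf a)"
proof -
  have "convergent (\<lambda>n. ntr n (a n))"
    by (rule uhf_functional_convergent[OF assms, of 0]) (auto simp: ntr_diff cmod_ntr ntr_tens_mid)
  then show ?thesis using assms by (simp add: tau_inf.abs_eq uhf_rel_refl convergent_LIMSEQ_iff)
qed

lemma tau_inf_diff: "tau_inf (x - y) = tau_inf x - tau_inf y"
proof -
  obtain a b where ab: "x = abs_uhf a" "a \<in> uhf_seq" "y = abs_uhf b" "b \<in> uhf_seq" by (metis uhf_cases)
  have "x - y = abs_uhf (\<lambda>n. a n - b n)" using ab by (simp add: minus_uhf.abs_eq uhf_rel_refl)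
  then show ?thesis
    using LIMSEQ_unique[OF tau_inf_tendsto[OF uhf_seq_diff[OF ab(2,4)]]
      tendsto_diff[OF tau_inf_tendsto[OF ab(2)] tau_inf_tendsto[OF ab(4)], unfolded ntr_diff]] ab by simp
qed

lemma cmod_tau_inf: "cmod (tau_inf x) \<le> norm x"
proof -
  obtain a where a: "x = abs_uhf a" "a \<in> uhf_seq" by (rule uhf_cases)
  show ?thesis unfolding a(1)
    by (rule tendsto_le[OF _ opnorm_tendsto[OF a(2)] tendsto_norm[OF tau_inf_tendsto[OF a(2)]]])
       (simp_all add: cmod_ntr)
qed

lemma slice_diff: "slice n p (x - y) = slice n p x - slice n p y"
  by (simp add: slice_def fun_eq_iff)

lemma cmod_slice: "cmod (slice n p x u v) \<le> opnorm (n + p) x"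
  using opn_entry[of "u @ replicate p 2" "n + p" "v @ replicate p 2" x] by (auto simp: slice_def words_iff)

lemma rho_tendsto:
  assumes "a \<in> uhf_seq"
  shows "(\<lambda>p. slice (m + 1) p (a (p + (m + 1))) u v) \<longlonglongrightarrow> rho m (abs_uhf a) u v"
proof -
  have "convergent (\<lambda>n. slice (m + 1) (n - (m + 1)) (a n) u v)"
  proof (rule uhf_functional_convergent[OF assms, of "m + 1"])
    fix n x y assume "m + 1 \<le> n"
    then show "cmod (slice (m + 1) (n - (m + 1)) x u v - slice (m + 1) (n - (m + 1)) y u v) \<le> opnorm n (x - y)"
      using cmod_slice[of "m + 1" "n - (m + 1)" "x - y" u v] by (simp add: slice_diff)
  next
    fix n k x assume "m + 1 \<le> n" "x \<in> M3 n"
    then show "slice (m + 1) (n + k - (m + 1)) (x \<otimes> mid k) u v = slice (m + 1) (n - (m + 1)) x u v"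
      using slice_tens_mid[of x "m + 1" "n - (m + 1)" k] by simp
  qed
  then have "convergent (\<lambda>p. slice (m + 1) (p + (m + 1) - (m + 1)) (a (p + (m + 1))) u v)"
    unfolding convergent_def using LIMSEQ_ignore_initial_segment by blast
  then show ?thesis using assms by (simp add: rho.abs_eq uhf_rel_refl convergent_LIMSEQ_iff)
qed

lemma rho_add: "rho m (x + y) = rho m x + rho m y"
proof (intro ext)
  fix u v
  obtain a b where ab: "x = abs_uhf a" "a \<in> uhf_seq" "y = abs_uhf b" "b \<in> uhf_seq" by (metis uhf_cases)
  have "slice (m + 1) p (a k + b k) u v = slice (m + 1) p (a k) u v + slice (m + 1) p (b k) u v" for p k
    by (simp add: slice_def)
  then have "(\<lambda>p. slice (m + 1) p (a (p + (m + 1)) + b (p + (m + 1))) u v)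
      \<longlonglongrightarrow> rho m (abs_uhf a) u v + rho m (abs_uhf b) u v"
    using tendsto_add[OF rho_tendsto[OF ab(2), of m u v] rho_tendsto[OF ab(4), of m u v]] by simp
  from LIMSEQ_unique[OF rho_tendsto[OF uhf_seq_add[OF ab(2,4)]] this]
  show "rho m (x + y) u v = (rho m x + rho m y) u v" using ab by (simp add: abs_uhf_simps)
qed

lemma rho_scaleC: "rho m (scaleC c x) = smul c (rho m x)"
proof (intro ext)
  fix u v
  obtain a where a: "x = abs_uhf a" "a \<in> uhf_seq" by (rule uhf_cases)
  have "slice (m + 1) p (smul c (a k)) u v = c * slice (m + 1) p (a k) u v" for p k
    by (simp add: slice_def smul_def)
  then have "(\<lambda>p. slice (m + 1) p (smul c (a (p + (m + 1)))) u v) \<longlonglongrightarrow> c * rho m (abs_uhf a) u v"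
    using tendsto_mult_left[OF rho_tendsto[OF a(2), of m u v], of c] by simp
  from LIMSEQ_unique[OF rho_tendsto[OF uhf_seq_smul[OF a(2)]] this]
  show "rho m (scaleC c x) u v = smul c (rho m x) u v" using a by (simp add: abs_uhf_simps smul_def)
qed

lemma rho_star: "rho m (star x) = madj (rho m x)"
proof (intro ext)
  fix u v
  obtain a where a: "x = abs_uhf a" "a \<in> uhf_seq" by (rule uhf_cases)
  have "slice (m + 1) p (madj (a k)) u v = cnj (slice (m + 1) p (a k) v u)" for p k
    by (auto simp: slice_def madj_def)
  then have "(\<lambda>p. slice (m + 1) p (madj (a (p + (m + 1)))) u v) \<longlonglongrightarrow> cnj (rho m (abs_uhf a) v u)"
    using tendsto_cnj[OF rho_tendsto[OF a(2), of m v u]] by simp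
  from LIMSEQ_unique[OF rho_tendsto[OF uhf_seq_madj[OF a(2)]] this]
  show "rho m (star x) u v = madj (rho m x) u v" using a by (simp add: abs_uhf_simps madj_def)
qed

lemma rho_minus: "rho m (- x) = - rho m x"
  unfolding uminus_scaleC rho_scaleC uminus_smul ..

lemma rho_diff: "rho m (x - y) = rho m x - rho m y"
  using rho_add[of m x "- y"] by (simp add: rho_minus)

lemma M3_rho: "rho m x \<in> M3 (Suc m)"
proof -
  obtain a where a: "x = abs_uhf a" "a \<in> uhf_seq" by (rule uhf_cases)
  have "rho m x u v = 0" if "u \<notin> words (Suc m) \<or> v \<notin> words (Suc m)" for u v
  proof -
    have "(\<lambda>p. slice (m + 1) p (a (p + (m + 1))) u v) = (\<lambda>p. 0)" using that by (auto simp: slice_def)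
    then show ?thesis using rho_tendsto[OF a(2), of m u v] a by (simp add: LIMSEQ_const_iff)
  qed
  then show ?thesis unfolding M3_def by blast
qed

text \<open>The slice is a compression by an isometry: a vector is extended by 0 to the words that
  do not end in \<open>replicate p 2\<close>.\<close>

lemma opnorm_slice: "opnorm n (slice n p x) \<le> opnorm (n + p) x"
proof (rule opn_least)
  fix v :: "3 list \<Rightarrow> complex"
  let ?q = "replicate p (2::3)"
  let ?v = "\<lambda>u. if drop n u = ?q then v (take n u) else 0"
  have q: "?q \<in> words p" by (simp add: words_iff)
  have v: "vnorm n (\<lambda>w. ?v (w @ q)) = (if q = ?q then vnorm n v else 0)" for q
  proof -
    have "vnorm n (\<lambda>w. ?v (w @ q)) = vnorm n (\<lambda>w. if q = ?q then v w else 0)"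
      by (rule vnorm_cong) (simp add: words_iff)
    then show ?thesis by simp
  qed
  have "(vnorm (n + p) ?v)\<^sup>2 = (vnorm n v)\<^sup>2"
    unfolding vnorm_add_sq v using q by (simp add: if_distrib[of "\<lambda>x. x\<^sup>2"] cong: if_cong)
  then have vv: "vnorm (n + p) ?v = vnorm n v" by (simp add: power2_eq_iff_nonneg)
  have m: "mvec n (slice n p x) v u = mvec (n + p) x ?v (u @ ?q)" if "u \<in> words n" for u
  proof -
    have "(\<Sum>w'\<in>words p. x (u @ ?q) (w @ w') * ?v (w @ w')) = slice n p x u w * v w" if "w \<in> words n" for w
    proof -
      have "(\<Sum>w'\<in>words p. x (u @ ?q) (w @ w') * ?v (w @ w')) 
          = (\<Sum>w'\<in>words p. if w' = ?q then x (u @ ?q) (w @ ?q) * v w else 0)"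
        using that by (intro sum.cong) (auto simp: words_iff)
      then show ?thesis using q that \<open>u \<in> words n\<close> by (simp add: slice_def)
    qed
    then show ?thesis unfolding mvec_def sum_words_add by simp
  qed
  have "vnorm n (mvec n (slice n p x) v) = vnorm n (\<lambda>u. mvec (n + p) x ?v (u @ ?q))"
    by (rule vnorm_cong) (rule m)
  also have "\<dots> \<le> vnorm (n + p) (mvec (n + p) x ?v)"
  proof (rule power2_le_imp_le)
    show "(vnorm n (\<lambda>u. mvec (n + p) x ?v (u @ ?q)))\<^sup>2 \<le> (vnorm (n + p) (mvec (n + p) x ?v))\<^sup>2"
      unfolding vnorm_add_sq[of n p "mvec (n + p) x ?v"]
      by (rule member_le_sum[of ?q "words p" "\<lambda>q. (vnorm n (\<lambda>u. mvec (n + p) x ?v (u @ q)))\<^sup>2"]) (use q in auto)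
  qed simp
  also have "\<dots> \<le> opnorm (n + p) x * vnorm n v"
    using opn_bound[of "n + p" x ?v] unfolding vv .
  finally show "vnorm n (mvec n (slice n p x) v) \<le> opnorm (n + p) x * vnorm n v" .
qed simp

lemma opnorm_rho: "opnorm (Suc m) (rho m x) \<le> norm x"
proof -
  obtain a where a: "x = abs_uhf a" "a \<in> uhf_seq" by (rule uhf_cases)
  show ?thesis
  proof (rule opn_least)
    fix v :: "3 list \<Rightarrow> complex"
    let ?s = "\<lambda>p. slice (m + 1) p (a (p + (m + 1)))"
    have "(\<lambda>p. vnorm (Suc m) (mvec (Suc m) (?s p) v)) \<longlonglongrightarrow> vnorm (Suc m) (mvec (Suc m) (rho m x) v)"
      unfolding vnorm_def L2_set_def mvec_def a(1)
      by (intro tendsto_intros rho_tendsto a)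
    moreover have "(\<lambda>p. opnorm (p + (m + 1)) (a (p + (m + 1))) * vnorm (Suc m) v) \<longlonglongrightarrow> norm x * vnorm (Suc m) v"
      unfolding a(1) by (intro tendsto_intros LIMSEQ_ignore_initial_segment[OF opnorm_tendsto] a)
    moreover have "vnorm (Suc m) (mvec (Suc m) (?s p) v) \<le> opnorm (p + (m + 1)) (a (p + (m + 1))) * vnorm (Suc m) v" for p
    proof -
      have "vnorm (Suc m) (mvec (Suc m) (?s p) v) \<le> opnorm (Suc m) (?s p) * vnorm (Suc m) v" by (rule opn_bound)
      also have "\<dots> \<le> opnorm (p + (m + 1)) (a (p + (m + 1))) * vnorm (Suc m) v"
        using opnorm_slice[of "m + 1" p "a (p + (m + 1))"] by (intro mult_right_mono) (simp_all add: add.commute)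
      finally show ?thesis .
    qed
    ultimately show "vnorm (Suc m) (mvec (Suc m) (rho m x) v) \<le> norm x * vnorm (Suc m) v"
      by (intro LIMSEQ_le) blast+
  qed simp
qed

lemma norm_iota_rho: "norm (iota (Suc m) (rho m x)) \<le> norm x"
  using opnorm_rho[of m x] by (simp add: norm_iota[OF M3_rho])

lemma cmod_rho: "cmod (rho m x u v) \<le> norm x"
proof (cases "u \<in> words (Suc m) \<and> v \<in> words (Suc m)")
  case True
  then show ?thesis using opn_entry[of u "Suc m" v "rho m x"] opnorm_rho[of m x] by simp
next
  case False
  then have "rho m x u v = 0" using M3_0[OF M3_rho] by metis
  then show ?thesis by simp
qed

lemma tendsto_rho: assumes "b \<longlonglongrightarrow> x" shows "(\<lambda>n. rho m (b n) u v) \<longlonglongrightarrow> rho m x u v"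
proof -
  have "(\<lambda>n. norm (b n - x)) \<longlonglongrightarrow> 0" using assms tendsto_norm_zero LIM_zero by blast
  then have "(\<lambda>n. rho m (b n) u v - rho m x u v) \<longlonglongrightarrow> 0"
  proof (rule Lim_null_comparison[OF always_eventually, rotated], intro allI)
    show "norm (rho m (b n) u v - rho m x u v) \<le> norm (b n - x)" for n
      using cmod_rho[of m "b n - x" u v] by (simp add: rho_diff)
  qed
  then show ?thesis by (rule LIM_zero_cancel)
qed

lemma rho_iota_blk:
  assumes "x \<in> M3 (Suc (m + p))" shows "rho m (iota (Suc (m + p)) x) = (blk 2 ^^ p) x"
  using rho_iota[of x m p] slice_eq_blk[of x "Suc m" p] assms by simp

lemma blk_rho: "blk 2 (rho (Suc m) x) = rho m x"
proof (intro ext)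
  fix u v
  obtain a where a: "x = abs_uhf a" "a \<in> uhf_seq" by (rule uhf_cases)
  have "slice (Suc m + 1) p (a (p + (Suc m + 1))) (u @ [2]) (v @ [2])
      = slice (m + 1) (Suc p) (a (Suc p + (m + 1))) u v" for p
    by (simp add: slice_def words_iff replicate_append_same[symmetric])
  then have "(\<lambda>p. slice (Suc m + 1) p (a (p + (Suc m + 1))) (u @ [2]) (v @ [2])) \<longlonglongrightarrow> rho m x u v"
    using LIMSEQ_Suc[OF rho_tendsto[OF a(2), of m u v]] a by simp
  from LIMSEQ_unique[OF rho_tendsto[OF a(2)] this]
  show "blk 2 (rho (Suc m) x) u v = rho m x u v" by (simp add: blk_def a)
qed

lemma blk_pow_rho: "(blk 2 ^^ p) (rho (m + p) x) = rho m x"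
proof (induction p)
  case (Suc p)
  have "(blk 2 ^^ Suc p) (rho (m + Suc p) x) = (blk 2 ^^ p) (rho (m + p) x)"
    by (simp only: funpow_Suc_right comp_apply add_Suc_right blk_rho)
  then show ?case using Suc by simp
qed simp

section \<open>\<open>calA_inf\<close> as a closed algebra with involution, on which the slices are
  multiplicative\<close>

lemma calA_inf_iff_seq:
  "b \<in> calA_inf \<longleftrightarrow> (\<exists>x. (\<forall>n. inA n (x n)) \<and> (\<lambda>n. iota (Suc n) (x n)) \<longlonglongrightarrow> b)"
  by (simp add: calA_inf_def calA_eq)

lemma M3_lim:
  assumes "\<And>n. z n \<in> M3 k" "\<And>u v. (\<lambda>n. z n u v) \<longlonglongrightarrow> l u v" shows "l \<in> M3 k"
proof -
  have "l u v = 0" if "u \<notin> words k \<or> v \<notin> words k" for u v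
    using assms(2)[of u v] by (simp add: M3_0[OF assms(1) that] LIMSEQ_const_iff)
  then show ?thesis unfolding M3_def by blast
qed

lemma ldiag_lim:
  assumes "\<And>n. ldiag (z n)" "\<And>u v. (\<lambda>n. z n u v) \<longlonglongrightarrow> l u v" shows "ldiag l"
  unfolding ldiag_def
proof (intro allI impI)
  fix u v and p q :: 3 assume "p \<noteq> q"
  then have "z n (u @ [p]) (v @ [q]) = 0" for n using assms(1) by (simp add: ldiag_def)
  then show "l (u @ [p]) (v @ [q]) = 0"
    using assms(2)[of "u @ [p]" "v @ [q]"] by (simp add: LIMSEQ_const_iff)
qed

lemma blk_lim: "(\<And>u v. (\<lambda>n. z n u v) \<longlonglongrightarrow> l u v) \<Longrightarrow> (\<lambda>n. blk p (z n) u v) \<longlonglongrightarrow> blk p l u v"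
  by (simp add: blk_def)

lemma inA_lim:
  assumes "\<And>n. inA m (z n)" "\<And>u v. (\<lambda>n. z n u v) \<longlonglongrightarrow> l u v"
  shows "inA m l"
  using assms
proof (induction m arbitrary: z l)
  case 0
  then show ?case using M3_lim[of z 1 l] ldiag_lim[of z l] by simp
next
  case (Suc m)
  note c = Suc.prems(2)
  have z: "\<And>n. z n \<in> M3 (Suc (Suc m))" "\<And>n. ldiag (z n)" "\<And>n. inA m (blk 2 (z n))"
    "\<And>n. ldiag (blk 1 (z n))" "\<And>n. ldiag (blk 3 (z n))"
    "\<And>n i. blk i (blk 1 (z n)) = blk (i + 2) (blk 3 (z n))"
    using Suc.prems(1) by simp_all
  have "blk i (blk 1 l) = blk (i + 2) (blk 3 l)" for i
  proof (intro ext)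
    fix u v
    have "(\<lambda>n. blk i (blk 1 (z n)) u v) \<longlonglongrightarrow> blk i (blk 1 l) u v"
      "(\<lambda>n. blk (i + 2) (blk 3 (z n)) u v) \<longlonglongrightarrow> blk (i + 2) (blk 3 l) u v"
      by (intro blk_lim c)+
    then show "blk i (blk 1 l) u v = blk (i + 2) (blk 3 l) u v"
      unfolding z(6) by (rule LIMSEQ_unique)
  qed
  moreover have "inA m (blk 2 l)"
    by (rule Suc.IH[OF z(3) blk_lim[OF c]])
  moreover have "l \<in> M3 (Suc (Suc m))" by (rule M3_lim[OF z(1) c])
  moreover have "ldiag l" by (rule ldiag_lim[OF z(2) c])
  moreover have "ldiag (blk 1 l)" by (rule ldiag_lim[OF z(4) blk_lim[OF c]])
  moreover have "ldiag (blk 3 l)" by (rule ldiag_lim[OF z(5) blk_lim[OF c]])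
  ultimately show ?case by simp
qed

lemma rho_calA_inf: assumes "b \<in> calA_inf" shows "inA m (rho m b)"
proof -
  obtain x where x: "\<And>n. inA n (x n)" "(\<lambda>n. iota (Suc n) (x n)) \<longlonglongrightarrow> b"
    using assms by (auto simp: calA_inf_iff_seq)
  show ?thesis
  proof (rule inA_lim)
    show "inA m (rho m (iota (Suc (m + n)) (x (m + n))))" for n
      by (simp add: rho_iota_blk[OF inA_M3[OF x(1)]] inA_blk_pow[OF x(1)])
    have "(\<lambda>n. iota (Suc (m + n)) (x (m + n))) \<longlonglongrightarrow> b"
      using LIMSEQ_ignore_initial_segment[OF x(2), of m] by (simp add: add.commute)
    then show "(\<lambda>n. rho m (iota (Suc (m + n)) (x (m + n))) u v) \<longlonglongrightarrow> rho m b u v" for u v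
      by (rule tendsto_rho)
  qed
qed

text \<open>\<open>rho n\<close> is contractive and fixes \<open>calA n\<close>, so replacing an
  approximant \<open>x n\<close> by \<open>rho n b\<close> at most doubles the error. This gives a
  canonical approximating sequence and makes membership in \<open>calA_inf\<close> a condition on
  \<open>b\<close> alone.\<close>

lemma iota_rho_tendsto: assumes "b \<in> calA_inf" shows "(\<lambda>n. iota (Suc n) (rho n b)) \<longlonglongrightarrow> b"
proof -
  obtain x where x: "\<And>n. inA n (x n)" "(\<lambda>n. iota (Suc n) (x n)) \<longlonglongrightarrow> b"
    using assms by (auto simp: calA_inf_iff_seq)
  have r: "rho n (iota (Suc n) (x n)) = x n" for n
    using rho_iota_blk[of "x n" n 0] inA_M3[OF x(1)] by simp
  have b: "norm (iota (Suc n) (rho n b) - iota (Suc n) (x n)) \<le> norm (b - iota (Suc n) (x n))" for n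
  proof -
    have "iota (Suc n) (rho n b) - iota (Suc n) (x n) = iota (Suc n) (rho n (b - iota (Suc n) (x n)))"
      unfolding rho_diff r using iota_diff[OF M3_rho inA_M3[OF x(1)]] by simp
    then show ?thesis using norm_iota_rho by simp
  qed
  have "(\<lambda>n. b - iota (Suc n) (x n)) \<longlonglongrightarrow> b - b" by (intro tendsto_diff tendsto_const x)
  then have "(\<lambda>n. norm (b - iota (Suc n) (x n))) \<longlonglongrightarrow> 0" by (simp add: tendsto_norm_zero)
  then have "(\<lambda>n. iota (Suc n) (rho n b) - iota (Suc n) (x n)) \<longlonglongrightarrow> 0"
    by (rule Lim_null_comparison[OF always_eventually, rotated]) (simp add: b)
  from tendsto_add[OF this x(2)] show ?thesis by simp
qed

lemma calA_inf_iff: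
  "b \<in> calA_inf \<longleftrightarrow> (\<forall>n. inA n (rho n b)) \<and> (\<lambda>n. iota (Suc n) (rho n b)) \<longlonglongrightarrow> b"
proof
  show "b \<in> calA_inf \<Longrightarrow> (\<forall>n. inA n (rho n b)) \<and> (\<lambda>n. iota (Suc n) (rho n b)) \<longlonglongrightarrow> b"
    by (simp add: rho_calA_inf iota_rho_tendsto)
  show "(\<forall>n. inA n (rho n b)) \<and> (\<lambda>n. iota (Suc n) (rho n b)) \<longlonglongrightarrow> b \<Longrightarrow> b \<in> calA_inf"
    unfolding calA_inf_iff_seq by (rule exI[of _ "\<lambda>n. rho n b"])
qed

lemma closed_calA_inf: "closed calA_inf"
  unfolding closed_sequential_limits
proof (intro allI impI, elim conjE)
  fix b l assume b: "\<forall>n. b n \<in> calA_inf" and l: "b \<longlonglongrightarrow> l"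
  have "inA m (rho m l)" for m
    by (rule inA_lim[OF _ tendsto_rho[OF l]]) (use b rho_calA_inf in blast)
  moreover have "(\<lambda>n. iota (Suc n) (rho n l)) \<longlonglongrightarrow> l"
  proof (rule metric_LIMSEQ_I)
    fix e :: real assume e: "e > 0"
    then have "e / 3 > 0" by simp
    then have "\<forall>\<^sub>F i in sequentially. dist (b i) l < e / 3" by (rule tendstoD[OF l])
    then obtain i where i: "dist (b i) l < e / 3" by (auto simp: eventually_sequentially)
    have bi: "b i \<in> calA_inf" using b by blast
    obtain N where N: "\<And>n. n \<ge> N \<Longrightarrow> dist (iota (Suc n) (rho n (b i))) (b i) < e / 3"
      using tendstoD[OF iota_rho_tendsto[OF bi] \<open>e / 3 > 0\<close>] by (auto simp: eventually_sequentially)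
    have "dist (iota (Suc n) (rho n l)) l < e" if "n \<ge> N" for n
    proof -
      have "dist (iota (Suc n) (rho n (b i))) (iota (Suc n) (rho n l)) \<le> dist (b i) l"
        using norm_iota_rho[of n "b i - l"] by (simp add: dist_norm rho_diff iota_diff M3_rho)
      then show ?thesis
        using N[OF that] i dist_triangle[of "iota (Suc n) (rho n l)" l "iota (Suc n) (rho n (b i))"]
          dist_triangle[of "iota (Suc n) (rho n (b i))" l "b i"] by (simp add: dist_commute)
    qed
    then show "\<exists>N. \<forall>n\<ge>N. dist (iota (Suc n) (rho n l)) l < e" by blast
  qed
  ultimately show "l \<in> calA_inf" by (simp add: calA_inf_iff)
qed

lemma calA_inf_add: assumes "a \<in> calA_inf" "b \<in> calA_inf" shows "a + b \<in> calA_inf"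
  unfolding calA_inf_iff_seq
proof (intro exI conjI allI)
  show "inA n (rho n a + rho n b)" for n by (intro inA_add rho_calA_inf assms)
  show "(\<lambda>n. iota (Suc n) (rho n a + rho n b)) \<longlonglongrightarrow> a + b"
    unfolding iota_add[OF M3_rho M3_rho] by (intro tendsto_add iota_rho_tendsto assms)
qed

lemma bounded_linear_scaleC: "bounded_linear (scaleC c)"
  by (rule bounded_linear_intro[where K = "cmod c"])
     (simp_all add: scaleC_add scaleR_scaleC scaleC_scaleC norm_scaleC mult.commute)

lemma calA_inf_scaleC: assumes "a \<in> calA_inf" shows "scaleC c a \<in> calA_inf"
  unfolding calA_inf_iff_seq
proof (intro exI conjI allI)
  show "inA n (smul c (rho n a))" for n by (intro inA_smul rho_calA_inf assms)
  show "(\<lambda>n. iota (Suc n) (smul c (rho n a))) \<longlonglongrightarrow> scaleC c a"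
    unfolding iota_smul[OF M3_rho] by (intro bounded_linear.tendsto[OF bounded_linear_scaleC] iota_rho_tendsto assms)
qed

lemma calA_inf_star: assumes "a \<in> calA_inf" shows "star a \<in> calA_inf"
  unfolding calA_inf_iff_seq
proof (intro exI conjI allI)
  show "inA n (madj (rho n a))" for n by (intro inA_madj rho_calA_inf assms)
  show "(\<lambda>n. iota (Suc n) (madj (rho n a))) \<longlonglongrightarrow> star a"
    unfolding iota_madj[OF M3_rho] by (intro tendsto_star iota_rho_tendsto assms)
qed

lemma iota_mmul_rho_tendsto:
  assumes "a \<in> calA_inf" "b \<in> calA_inf"
  shows "(\<lambda>n. iota (Suc n) (mmul (rho n a) (rho n b))) \<longlonglongrightarrow> a * b"
  unfolding iota_mmul[OF M3_rho M3_rho] by (intro tendsto_mult iota_rho_tendsto assms)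

lemma calA_inf_mult: assumes "a \<in> calA_inf" "b \<in> calA_inf" shows "a * b \<in> calA_inf"
  unfolding calA_inf_iff_seq
proof (intro exI conjI allI)
  show "inA n (mmul (rho n a) (rho n b))" for n by (intro inA_mmul rho_calA_inf assms)
qed (rule iota_mmul_rho_tendsto[OF assms])

lemma calA_inf_1: "1 \<in> calA_inf"
  unfolding calA_inf_iff_seq
  by (intro exI[of _ "\<lambda>n. mid (Suc n)"]) (simp add: inA_mid iota_mid)

lemma rho_mult: assumes "a \<in> calA_inf" "b \<in> calA_inf" shows "rho m (a * b) = mmul (rho m a) (rho m b)"
proof (intro ext)
  fix u v
  have "(\<lambda>n. iota (Suc (m + n)) (mmul (rho (m + n) a) (rho (m + n) b))) \<longlonglongrightarrow> a * b"
    using LIMSEQ_ignore_initial_segment[OF iota_mmul_rho_tendsto[OF assms], of m] by (simp add: add.commute)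
  from tendsto_rho[OF this, of m u v]
  have "(\<lambda>n. mmul (rho m a) (rho m b) u v) \<longlonglongrightarrow> rho m (a * b) u v"
    by (simp add: rho_iota_blk[OF M3_mmul[OF M3_rho M3_rho]] blk_pow_mmul[OF rho_calA_inf[OF assms(1)]] blk_pow_rho)
  then show "rho m (a * b) u v = mmul (rho m a) (rho m b) u v" by (simp add: LIMSEQ_const_iff)
qed

lemma rho_1: "rho m 1 = mid (Suc m)"
  using rho_iota_blk[of "mid (Suc m)" m 0] by (simp add: iota_mid M3_closed)

section \<open>The kernels of the slice maps and their multipliers\<close>

definition ker_rho :: "nat \<Rightarrow> uhf set" where
  "ker_rho m = {b \<in> calA_inf. rho m b = 0}"

text \<open>The approximants \<open>rho n b\<close> also slice to 0 at level \<open>m\<close>, so by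
  \<open>inA_mult_tens_mid\<close> their products with \<open>x\<close> stay in
  \<open>calA n\<close> and in the kernel; both properties pass to the limit.\<close>

lemma ker_rho_mult_iota:
  assumes x: "x \<in> M3 m" and b: "b \<in> ker_rho m"
  shows "iota m x * b \<in> ker_rho m"
proof -
  have bA: "b \<in> calA_inf" and b0: "rho m b = 0" using b by (auto simp: ker_rho_def)
  \<comment> \<open>\<open>rho n b\<close> has \<open>n + 1\<close> tensor factors and
    \<open>x\<close> has \<open>m\<close>, whence the padding by \<open>Suc (n - m)\<close>. The
    value 0 below level \<open>m\<close> does not affect the limit.\<close>
  define c where "c n = (if m \<le> n then mmul (x \<otimes> mid (Suc (n - m))) (rho n b) else 0)" for n
  have c: "inA (m + p) (c (m + p)) \<and> (blk 2 ^^ p) (c (m + p)) = 0" for p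
    using inA_mult_tens_mid[OF x rho_calA_inf[OF bA] blk_pow_rho[of p m b, unfolded b0]] by (simp add: c_def)
  have cA: "inA n (c n)" for n
    using c[of "n - m"] inA_0[of n] by (cases "m \<le> n") (simp_all add: c_def)
  have i: "iota (Suc (m + p)) (c (m + p)) = iota m x * iota (Suc (m + p)) (rho (m + p) b)" for p
  proof -
    have "iota (Suc (m + p)) (c (m + p)) = iota (m + Suc p) (x \<otimes> mid (Suc p)) * iota (Suc (m + p)) (rho (m + p) b)"
      using iota_mmul[OF _ M3_rho[of "m + p" b], of "x \<otimes> mid (Suc p)"] M3_tens[OF x M3_closed(2), of "Suc p"]
      by (simp add: c_def)
    then show ?thesis using iota_tens_mid[OF x, of "Suc p"] by simp
  qed
  have lim: "(\<lambda>p. iota (Suc (m + p)) (c (m + p))) \<longlonglongrightarrow> iota m x * b"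
    unfolding i using LIMSEQ_ignore_initial_segment[OF iota_rho_tendsto[OF bA], of m]
    by (intro tendsto_mult tendsto_const) (simp add: add.commute)
  then have "(\<lambda>n. iota (Suc n) (c n)) \<longlonglongrightarrow> iota m x * b"
    using LIMSEQ_offset[of "\<lambda>n. iota (Suc n) (c n)" m] by (simp add: add.commute)
  then have "iota m x * b \<in> calA_inf" unfolding calA_inf_iff_seq using cA by blast
  moreover have "rho m (iota m x * b) = 0"
  proof (intro ext)
    fix u v
    have "rho m (iota (Suc (m + p)) (c (m + p))) u v = 0" for p
      using c[of p] rho_iota_blk[of "c (m + p)" m p] inA_M3[OF cA[of "m + p"]] by simp
    then show "rho m (iota m x * b) u v = 0 u v"
      using tendsto_rho[OF lim, of m u v] by (simp add: LIMSEQ_const_iff)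
  qed
  ultimately show ?thesis by (simp add: ker_rho_def)
qed

lemma tracial_ideal_ker_rho:
  assumes "tracial_state_on calA_inf \<tau>" shows "tracial_ideal calA_inf \<tau> (ker_rho m)"
proof unfold_locales
  show "closed (ker_rho m)"
    unfolding closed_sequential_limits
  proof (intro allI impI, elim conjE)
    fix b l assume b: "\<forall>n. b n \<in> ker_rho m" and l: "b \<longlonglongrightarrow> l"
    have "\<forall>n. b n \<in> calA_inf" using b by (simp add: ker_rho_def)
    then have "l \<in> calA_inf" using closed_calA_inf l unfolding closed_sequential_limits by blast
    moreover have "rho m l = 0"
    proof (intro ext)
      fix u v
      show "rho m l u v = 0 u v"
        using tendsto_rho[OF l, of m u v] b by (simp add: ker_rho_def LIMSEQ_const_iff)
    qed
    ultimately show "l \<in> ker_rho m" by (simp add: ker_rho_def)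
  qed
  have z: "mmul x 0 = 0" "smul c 0 = 0" "madj 0 = 0" for x c
    by (simp_all add: mmul_def smul_def madj_def fun_eq_iff)
  show "a + b \<in> ker_rho m" if "a \<in> ker_rho m" "b \<in> ker_rho m" for a b
    using that by (simp add: ker_rho_def calA_inf_add rho_add)
  show "0 \<in> ker_rho m"
    using calA_inf_scaleC[OF calA_inf_1, of 0] rho_diff[of m 1 1] scaleR_scaleC[of 0 1] by (simp add: ker_rho_def)
  show "a * b \<in> ker_rho m" if "a \<in> calA_inf" "b \<in> ker_rho m" for a b
    using that by (simp add: ker_rho_def calA_inf_mult rho_mult z)
  show "star a \<in> ker_rho m" if "a \<in> ker_rho m" for a
    using that by (simp add: ker_rho_def calA_inf_star rho_star z)
qed (simp_all add: closed_calA_inf calA_inf_1 calA_inf_add calA_inf_scaleC calA_inf_mult calA_inf_star assms,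
     auto simp: ker_rho_def)

section \<open>Lifting along the slice maps\<close>

lemma tens_dmat_append:
  assumes "x \<in> M3 n" "p \<in> words n" "q \<in> words k" "p' \<in> words n" "q' \<in> words k"
  shows "(x \<otimes> dmat k h) (p @ q) (p' @ q') = (if q = q' then x p p' * h q else 0)"
  using assms by (simp add: tens_apply[OF assms(1)] words_iff dmat_def)

lemma opnorm_tens_dmat:
  assumes x: "x \<in> M3 n" and h: "\<And>q. q \<in> words k \<Longrightarrow> cmod (h q) \<le> C" and C: "0 \<le> C"
  shows "opnorm (n + k) (x \<otimes> dmat k h) \<le> opnorm n x * C"
proof (rule opn_least)
  fix v
  have m: "mvec (n + k) (x \<otimes> dmat k h) v (p @ q) = mvec n x (\<lambda>p. h q * v (p @ q)) p"
    if "p \<in> words n" "q \<in> words k" for p q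
    unfolding mvec_def sum_words_add
    by (rule sum.cong)
      (use that x in \<open>auto simp: tens_dmat_append if_distrib[of "\<lambda>x. x * _"] mult.assoc cong: if_cong\<close>)
  have "(vnorm (n + k) (mvec (n + k) (x \<otimes> dmat k h) v))\<^sup>2
      = (\<Sum>q\<in>words k. (vnorm n (mvec n x (\<lambda>p. h q * v (p @ q))))\<^sup>2)"
    unfolding vnorm_add_sq
    by (rule sum.cong) (auto intro!: arg_cong[of _ _ "\<lambda>x. x\<^sup>2"] vnorm_cong simp: m)
  also have "\<dots> \<le> (\<Sum>q\<in>words k. (opnorm n x * C * vnorm n (\<lambda>p. v (p @ q)))\<^sup>2)"
  proof (intro sum_mono power_mono)
    fix q assume q: "q \<in> words k"
    have "vnorm n (mvec n x (\<lambda>p. h q * v (p @ q))) \<le> opnorm n x * (cmod (h q) * vnorm n (\<lambda>p. v (p @ q)))"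
      using opn_bound[of n x "\<lambda>p. h q * v (p @ q)"] by (simp add: vnorm_scale)
    also have "\<dots> \<le> opnorm n x * (C * vnorm n (\<lambda>p. v (p @ q)))"
      by (intro mult_left_mono mult_right_mono h q) auto
    finally show "vnorm n (mvec n x (\<lambda>p. h q * v (p @ q))) \<le> opnorm n x * C * vnorm n (\<lambda>p. v (p @ q))"
      by (simp add: mult.assoc)
  qed simp
  also have "\<dots> = (opnorm n x * C * vnorm (n + k) v)\<^sup>2"
    by (simp add: power_mult_distrib vnorm_add_sq sum_distrib_left)
  finally show "vnorm (n + k) (mvec (n + k) (x \<otimes> dmat k h) v) \<le> opnorm n x * C * vnorm (n + k) v"
    by (rule power2_le_imp_le) (simp add: C)
qed (use C in simp)

lemma madj_tens_dmat:
  assumes x: "x \<in> M3 n" shows "madj (x \<otimes> dmat k (\<lambda>q. of_real (h q))) = madj x \<otimes> dmat k (\<lambda>q. of_real (h q))"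
proof (intro ext)
  fix u v
  have M: "madj (x \<otimes> dmat k (\<lambda>q. of_real (h q))) \<in> M3 (n + k)" "madj x \<otimes> dmat k (\<lambda>q. of_real (h q)) \<in> M3 (n + k)"
    using M3_tens[OF x M3_dmat] M3_tens[OF M3_closed(7)[OF x] M3_dmat] M3_closed(7) by blast+
  show "madj (x \<otimes> dmat k (\<lambda>q. of_real (h q))) u v = (madj x \<otimes> dmat k (\<lambda>q. of_real (h q))) u v"
  proof (cases "u \<in> words (n + k) \<and> v \<in> words (n + k)")
    case True
    then show ?thesis
      unfolding tens_apply[OF M3_closed(7)[OF x]] by (auto simp: madj_def tens_apply[OF x] dmat_def words_iff)
  next
    case False
    then show ?thesis using M3_0[OF M(1)] M3_0[OF M(2)] by metis
  qed
qed

lemma ntr_tens_dmat: assumes x: "x \<in> M3 n"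
  shows "ntr (n + k) (x \<otimes> dmat k h) = ntr n x * ((\<Sum>q\<in>words k. h q) / 3 ^ k)"
proof -
  have "(\<Sum>u\<in>words (n + k). (x \<otimes> dmat k h) u u) = (\<Sum>p\<in>words n. \<Sum>q\<in>words k. x p p * h q)"
    unfolding sum_words_add by (intro sum.cong refl) (simp add: tens_dmat_append[OF x])
  then show ?thesis by (simp add: ntr_def power_add sum_product)
qed

text \<open>
  The weights of the lift of \<open>x \<in> calA m\<close>, on reversed words. A word \<open>u i 1\<close> or \<open>u i 3\<close> must get a
  weight independent of \<open>i\<close>; taking the mean of the weights of \<open>u 1\<close> and \<open>u 2\<close> halves the
  oscillation at each step, so that the weights converge uniformly.
\<close>

fun weight :: "3 list \<Rightarrow> real" where
  "weight [] = 1"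
| "weight [p] = (if p = 2 then 1 else 0)"
| "weight (p # i # u) = (if p = 2 then weight (i # u) else (weight (1 # u) + weight (2 # u)) / 2)"

lemma weight_bounds: "0 \<le> weight w \<and> weight w \<le> 1"
  by (induction w rule: weight.induct) auto

lemma weight_2: "weight (2 # u) = weight u"
  by (cases u) auto

lemma weight_3: "weight (3 # u) = weight (1 # u)"
  by (cases u) auto

lemma weight_cases: "weight (i # u) = weight (1 # u) \<or> weight (i # u) = weight (2 # u)"
  using exhaust_3[of i] by (auto simp: weight_3)

text \<open>\<open>weight (2 # i # u)\<close> is one of the two numbers whose mean is
  \<open>weight (1 # i # u)\<close>, so the new difference is half the old one.\<close>

lemma weight_oscillation: "\<bar>weight (1 # u) - weight (2 # u)\<bar> \<le> (1 / 2) ^ length u"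
proof (induction u)
  case (Cons i u)
  have "\<bar>weight (1 # i # u) - weight (2 # i # u)\<bar> = \<bar>weight (1 # u) - weight (2 # u)\<bar> / 2"
    using weight_cases[of i u] by (auto simp: weight_2 abs_if field_simps)
  then show ?case using Cons by simp
qed simp

lemma weight_step: "\<bar>weight (p # u) - weight u\<bar> \<le> (1 / 2) ^ length u"
proof (cases "p = 2")
  case True
  then show ?thesis by (simp add: weight_2)
next
  case False
  then have "weight (p # u) = weight (1 # u)" using exhaust_3[of p] by (auto simp: weight_3)
  then show ?thesis using weight_oscillation[of u] by (simp add: weight_2)
qed

definition wdiag :: "nat \<Rightarrow> wmat" where
  "wdiag p = dmat p (\<lambda>q. of_real (weight (rev q)))"

lemma blk_tens_wdiag: "x \<in> M3 n \<Longrightarrow> blk 2 (x \<otimes> wdiag (Suc p)) = x \<otimes> wdiag p"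
  by (simp add: wdiag_def blk_tens_dmat weight_2)

lemma blk_pow_tens_wdiag: assumes "x \<in> M3 n" shows "(blk 2 ^^ p) (x \<otimes> wdiag p) = x"
proof (induction p)
  case 0
  have "wdiag 0 = mid 0" by (auto simp: wdiag_def dmat_def mid_def fun_eq_iff)
  then show ?case using tens_mid_0[OF assms] by simp
next
  case (Suc p)
  then show ?case by (simp only: funpow_Suc_right comp_apply blk_tens_wdiag[OF assms])
qed

text \<open>In blocks 1 and 3 the weight replaces the preceding letter by a mean, so it does not
  depend on that letter and is the same in both blocks, which is the linking condition of
  \<open>inA\<close>. For \<open>p = 0\<close> there is no preceding weight letter, and these blocks
  are 0 because \<open>weight [q] = 0\<close> unless \<open>q = 2\<close>.\<close>

lemma inA_tens_wdiag: assumes x: "inA m x" shows "inA (m + p) (x \<otimes> wdiag p)"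
proof (induction p)
  case 0
  show ?case using blk_pow_tens_wdiag[OF inA_M3[OF x], of 0] x by simp
next
  case (Suc p)
  note xM = inA_M3[OF x]
  have b: "blk q (x \<otimes> wdiag (Suc p)) = x \<otimes> dmat p (\<lambda>u. of_real (weight (q # rev u)))" for q
    by (simp add: wdiag_def blk_tens_dmat[OF xM])
  have z: "x \<otimes> dmat 0 (\<lambda>u. of_real (weight (q # rev u))) = 0" if "q \<noteq> 2" for q
  proof -
    have "dmat 0 (\<lambda>u. complex_of_real (weight (q # rev u))) = 0" using that by (simp add: dmat_def fun_eq_iff)
    then show ?thesis by (simp only: tens_0_right)
  qed
  have ld: "ldiag (blk q (x \<otimes> wdiag (Suc p)))" if "q \<noteq> 2" for q
    unfolding b
  proof (cases p)
    case 0
    show "ldiag (x \<otimes> dmat p (\<lambda>u. of_real (weight (q # rev u))))" unfolding 0 z[OF that] by (rule ldiag_simps)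
  qed (simp add: ldiag_tens_dmat[OF xM])
  have eq: "blk i (blk 1 (x \<otimes> wdiag (Suc p))) = blk (i + 2) (blk 3 (x \<otimes> wdiag (Suc p)))" for i
    unfolding b
  proof (cases p)
    case 0
    have "x \<otimes> dmat 0 (\<lambda>u. complex_of_real (weight (1 # rev u))) = 0"
      "x \<otimes> dmat 0 (\<lambda>u. complex_of_real (weight (3 # rev u))) = 0" by (rule z, simp)+
    then show "blk i (x \<otimes> dmat p (\<lambda>u. complex_of_real (weight (1 # rev u))))
        = blk (i + 2) (x \<otimes> dmat p (\<lambda>u. complex_of_real (weight (3 # rev u))))"
      unfolding 0 by (simp only: blk_simps)
  qed (simp add: blk_tens_dmat[OF xM])
  have "x \<otimes> wdiag (Suc p) \<in> M3 (Suc (Suc (m + p)))"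
    using M3_tens[OF xM M3_dmat, of "Suc p"] by (simp add: wdiag_def)
  then show ?case
    using Suc ld[of 1] ld[of 3] eq by (simp add: blk_tens_wdiag[OF xM]) (simp add: wdiag_def ldiag_tens_dmat[OF xM])
qed

lemma dmat_tens_mid: "dmat p h \<otimes> mid (Suc 0) = dmat (Suc p) (\<lambda>w. h (butlast w))"
proof (rule wmat_snoc_eqI)
  show "dmat p h \<otimes> mid (Suc 0) \<in> M3 (Suc p)" using M3_tens[OF M3_dmat M3_closed(2), of p h "Suc 0"] by simp
  show "dmat (Suc p) (\<lambda>w. h (butlast w)) \<in> M3 (Suc p)" by (rule M3_dmat)
  fix u v :: "3 list" and a b :: 3
  show "(dmat p h \<otimes> mid (Suc 0)) (u @ [a]) (v @ [b]) = dmat (Suc p) (\<lambda>w. h (butlast w)) (u @ [a]) (v @ [b])"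
  proof (cases "length u = p \<and> length v = p")
    case True
    then show ?thesis unfolding tens_apply[OF M3_dmat] by (auto simp: dmat_def mid_def words_iff)
  next
    case False
    have "(dmat p h \<otimes> mid (Suc 0)) (u @ [a]) (v @ [b]) = 0"
      by (rule M3_0[of _ "Suc p"]) (use M3_tens[OF M3_dmat M3_closed(2), of p h "Suc 0"] False in \<open>auto simp: words_iff\<close>)
    moreover have "dmat (Suc p) (\<lambda>w. h (butlast w)) (u @ [a]) (v @ [b]) = 0"
      by (rule M3_0[OF M3_dmat]) (use False in \<open>auto simp: words_iff\<close>)
    ultimately show ?thesis by simp
  qed
qed

text \<open>Padding \<open>x\<close> with factors \<open>munit 2 2\<close> stays in
  \<open>calA (m + p)\<close>, but consecutive terms remain at distance
  \<open>opnorm (Suc m) x\<close>. With the weights, the differences decay like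
  \<open>(1 / 2) ^ p\<close>. The limit slices to \<open>x\<close> since words of 2s have weight 1.
  Weights between 0 and 1 increase neither norm nor trace, and since they are real they preserve
  self-adjointness.\<close>

lemma lift_exists:
  assumes x: "inA m x"
  obtains b where "b \<in> calA_inf" "rho m b = x" "norm b \<le> opnorm (Suc m) x"
    "madj x = x \<Longrightarrow> star b = b" "cmod (tau_inf b) \<le> cmod (ntr (Suc m) x)"
proof -
  note xM = inA_M3[OF x]
  define s where "s p = iota (Suc m + p) (x \<otimes> wdiag p)" for p
  have M: "x \<otimes> wdiag p \<in> M3 (Suc m + p)" for p
    unfolding wdiag_def by (rule M3_tens[OF xM M3_dmat])
  have w: "cmod (complex_of_real (weight q)) \<le> 1" for q using weight_bounds[of q] by simp
  have step: "norm (s (Suc p) - s p) \<le> opnorm (Suc m) x * (1 / 2) ^ p" for p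
  proof -
    have "(x \<otimes> wdiag p) \<otimes> mid (Suc 0) = x \<otimes> dmat (Suc p) (\<lambda>w. of_real (weight (rev (butlast w))))"
      unfolding wdiag_def by (simp add: tens_assoc[OF xM M3_dmat] dmat_tens_mid)
    moreover have "x \<otimes> dmat n h - x \<otimes> dmat n g = x \<otimes> dmat n (\<lambda>w. h w - g w)" for n h g
      by (auto simp: fun_eq_iff tens_apply[OF xM] dmat_def algebra_simps)
    ultimately have d: "x \<otimes> wdiag (Suc p) - (x \<otimes> wdiag p) \<otimes> mid (Suc 0)
       = x \<otimes> dmat (Suc p) (\<lambda>w. of_real (weight (rev w)) - of_real (weight (rev (butlast w))))"
      by (simp only: wdiag_def)
    have "norm (s (Suc p) - s p) = opnorm (Suc m + p + 1) (x \<otimes> wdiag (Suc p) - (x \<otimes> wdiag p) \<otimes> mid (Suc 0))"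
      using norm_iota_diff[OF M, of "x \<otimes> wdiag (Suc p)" p 1] M[of "Suc p"] by (simp add: s_def)
    also have "\<dots> = opnorm (Suc m + Suc p) (x \<otimes> dmat (Suc p) (\<lambda>w. of_real (weight (rev w)) - of_real (weight (rev (butlast w)))))"
      unfolding d by simp
    also have "\<dots> \<le> opnorm (Suc m) x * (1 / 2) ^ p"
    proof (rule opnorm_tens_dmat[OF xM])
      fix q :: "3 list" assume "q \<in> words (Suc p)"
      then obtain u a where q: "q = u @ [a]" "length u = p" by (metis words_iff length_Suc_conv_rev)
      show "cmod (of_real (weight (rev q)) - of_real (weight (rev (butlast q)))) \<le> (1 / 2) ^ p"
        using weight_step[of a "rev u"] q(2) unfolding q(1) of_real_diff[symmetric] norm_of_real by simp
    qed simp
    finally show ?thesis .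
  qed
  have "summable (\<lambda>p. s (Suc p) - s p)"
  proof (rule summable_norm_cancel, rule summable_comparison_test')
    show "summable (\<lambda>p. opnorm (Suc m) x * (1 / 2) ^ p)" by (intro summable_mult summable_geometric) simp
    show "norm (norm (s (Suc p) - s p)) \<le> opnorm (Suc m) x * (1 / 2) ^ p" for p using step by simp
  qed
  then obtain L where "(\<lambda>p. s (Suc p) - s p) sums L" by (auto simp: summable_def)
  then have "(\<lambda>N. s N - s 0) \<longlonglongrightarrow> L" unfolding sums_def by (simp add: sum_lessThan_telescope)
  from tendsto_add[OF this tendsto_const[of "s 0"]] have lim: "s \<longlonglongrightarrow> L + s 0" by simp
  define b where "b = L + s 0"
  note lim = lim[folded b_def]
  have sA: "inA (m + p) (x \<otimes> wdiag p)" for p by (rule inA_tens_wdiag[OF x])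
  have bA: "b \<in> calA_inf"
    unfolding calA_inf_iff_seq
  proof (intro exI conjI allI)
    let ?z = "\<lambda>n. if m \<le> n then x \<otimes> wdiag (n - m) else 0"
    show "inA n (?z n)" for n using sA[of "n - m"] inA_0[of n] by auto
    show "(\<lambda>n. iota (Suc n) (?z n)) \<longlonglongrightarrow> b"
      by (rule LIMSEQ_offset[of _ m]) (use lim in \<open>simp add: s_def[abs_def] add.commute\<close>)
  qed
  have "rho m b = x"
  proof (intro ext)
    fix u v
    have "rho m (s p) = x" for p
      using rho_iota_blk[of "x \<otimes> wdiag p" m p] M[of p] blk_pow_tens_wdiag[OF xM] by (simp add: s_def)
    then show "rho m b u v = x u v" using tendsto_rho[OF lim, of m u v] by (simp add: LIMSEQ_const_iff)
  qed
  moreover have "norm b \<le> opnorm (Suc m) x"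
  proof (rule tendsto_upperbound[OF tendsto_norm[OF lim]])
    have "norm (s p) \<le> opnorm (Suc m) x * 1" for p
      unfolding s_def norm_iota[OF M] unfolding wdiag_def by (rule opnorm_tens_dmat[OF xM]) (use w in auto)
    then show "\<forall>\<^sub>F p in sequentially. norm (s p) \<le> opnorm (Suc m) x" by simp
  qed simp
  moreover have "star b = b" if "madj x = x"
  proof (rule LIMSEQ_unique[OF tendsto_star[OF lim]])
    have "star (s p) = s p" for p
      unfolding s_def iota_madj[OF M, symmetric] by (simp add: wdiag_def madj_tens_dmat[OF xM] that)
    then show "(\<lambda>p. star (s p)) \<longlonglongrightarrow> b" using lim by simp
  qed
  moreover have "cmod (tau_inf b) \<le> cmod (ntr (Suc m) x)"
  proof -
    have t: "cmod (tau_inf (s p)) \<le> cmod (ntr (Suc m) x)" for p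
    proof -
      have "tau_inf (s p) = ntr (Suc m) x * ((\<Sum>q\<in>words p. of_real (weight (rev q))) / 3 ^ p)"
        unfolding s_def tau_inf_iota[OF M] unfolding wdiag_def by (rule ntr_tens_dmat[OF xM])
      moreover have "cmod (\<Sum>q\<in>words p. of_real (weight (rev q))) \<le> (\<Sum>q\<in>words p. 1)"
        by (rule sum_norm_le) (rule w)
      then have "cmod ((\<Sum>q\<in>words p. of_real (weight (rev q))) / 3 ^ p) \<le> 1"
        by (simp add: card_words norm_divide norm_power)
      ultimately show ?thesis by (simp only: norm_mult) (rule mult_left_le, simp_all)
    qed
    have d: "cmod (tau_inf b) \<le> cmod (ntr (Suc m) x) + norm (b - s p)" for p
    proof -
      have "tau_inf b = tau_inf (s p) + tau_inf (b - s p)" by (simp add: tau_inf_diff)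
      then have "cmod (tau_inf b) \<le> cmod (tau_inf (s p)) + cmod (tau_inf (b - s p))" by (metis norm_triangle_ineq)
      then show ?thesis using t[of p] cmod_tau_inf[of "b - s p"] by linarith
    qed
    have "(\<lambda>p. cmod (ntr (Suc m) x) + norm (b - s p)) \<longlonglongrightarrow> cmod (ntr (Suc m) x) + norm (b - b)"
      by (intro tendsto_intros lim)
    then show ?thesis by (intro tendsto_lowerbound[where F = sequentially and a = "cmod (tau_inf b)"]) (use d in auto)
  qed
  ultimately show ?thesis using that bA by blast
qed

section \<open>Coordinates on \<open>calA m\<close>\<close>

lemma M3_0_eqI: "a \<in> M3 0 \<Longrightarrow> b \<in> M3 0 \<Longrightarrow> a [] [] = b [] [] \<Longrightarrow> a = b"
proof (intro ext)
  fix u v assume "a \<in> M3 0" "b \<in> M3 0" "a [] [] = b [] []"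
  then show "a u v = b u v"
    using M3_0[of a 0 u v] M3_0[of b 0 u v] by (cases "u = [] \<and> v = []") auto
qed

text \<open>
  The direct summands of \<open>calA m\<close>: \<open>Inl j\<close> stands for the multiples of \<open>alpha m j\<close> and \<open>Inr (k, j)\<close>
  for the copy \<open>x \<otimes> beta (m - k) j\<close> of \<open>M3 k\<close>. This indexing does not depend on \<open>m\<close>.
\<close>

type_synonym summand = "3 + nat \<times> 3"

definition summands :: "nat \<Rightarrow> summand set" where
  "summands m = range Inl \<union> Inr ` ({..<m} \<times> UNIV)"

fun sdim :: "summand \<Rightarrow> nat" where
  "sdim (Inl j) = 0"
| "sdim (Inr (k, j)) = k"

fun coord :: "nat \<Rightarrow> summand \<Rightarrow> wmat \<Rightarrow> wmat" where
  "coord m (Inl j) x = blk j ((blk 2 ^^ m) x)"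
| "coord m (Inr (k, j)) x = blk j (blk 1 ((blk 2 ^^ (m - Suc k)) x))"

text \<open>For \<open>Inl j\<close> the coordinate is a scalar stored as an element of
  \<open>M3 0\<close>, whence the evaluation at \<open>[] []\<close>.\<close>

definition elem :: "nat \<Rightarrow> summand \<Rightarrow> wmat \<Rightarrow> wmat" where
  "elem m B y = expand m (\<lambda>j. if B = Inl j then y [] [] else 0) (\<lambda>k j. if B = Inr (k, j) then y else 0)"

lemma finite_summands [simp]: "finite (summands m)"
  by (simp add: summands_def)

lemma summands_cases:
  assumes "B \<in> summands m"
  obtains j where "B = Inl j" | k j where "B = Inr (k, j)" "k < m"
  using assms by (auto simp: summands_def)

lemma inA_coord_M3: assumes "inA m x" "B \<in> summands m" shows "coord m B x \<in> M3 (sdim B)"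
  using assms(2)
proof (cases rule: summands_cases)
  case (1 j)
  have "inA 0 ((blk 2 ^^ m) x)" using inA_blk_pow[of 0 m x] assms(1) by simp
  then show ?thesis using 1 M3_blk[of "(blk 2 ^^ m) x" 0 j] by simp
next
  case (2 k j)
  have "inA (Suc k) ((blk 2 ^^ (m - Suc k)) x)" using inA_blk_pow[of "Suc k" "m - Suc k" x] assms(1) 2 by simp
  then show ?thesis using 2 M3_blk[OF M3_blk[OF inA_M3]] by simp
qed

lemma is_expansion_coord:
  assumes "inA m b"
  shows "is_expansion m b x y \<longleftrightarrow> (\<forall>j. x j = coord m (Inl j) b [] []) \<and> (\<forall>k<m. \<forall>j. y k j = coord m (Inr (k, j)) b)"
proof -
  have "coord m (Inl j) b [] [] = b (j # replicate m 2) (j # replicate m 2)" for j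
    by (simp add: blk_def blk_pow_apply)
  then show ?thesis using assms by (simp add: is_expansion_iff)
qed

lemma coord_eqI:
  assumes "inA m a" "inA m b" "\<And>B. B \<in> summands m \<Longrightarrow> coord m B a = coord m B b"
  shows "a = b"
proof -
  obtain x y where e: "is_expansion m a x y" using is_expansion_ex[OF assms(1)] by blast
  have "coord m (Inl j) a = coord m (Inl j) b" for j by (rule assms(3)) (simp add: summands_def)
  moreover have "coord m (Inr (k, j)) a = coord m (Inr (k, j)) b" if "k < m" for k j
    by (rule assms(3)) (use that in \<open>auto simp: summands_def\<close>)
  ultimately have "is_expansion m b x y"
    using e unfolding is_expansion_coord[OF assms(1)] is_expansion_coord[OF assms(2)] by metis
  then show ?thesis using e by (simp add: is_expansion_expand)
qed

lemma is_expansion_elem: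
  assumes "B \<in> summands m" "y \<in> M3 (sdim B)"
  shows "is_expansion m (elem m B y) (\<lambda>j. if B = Inl j then y [] [] else 0) (\<lambda>k j. if B = Inr (k, j) then y else 0)"
  unfolding is_expansion_expand elem_def
  using assms M3_closed(1) by (auto split: if_splits)

lemma inA_elem: "B \<in> summands m \<Longrightarrow> y \<in> M3 (sdim B) \<Longrightarrow> inA m (elem m B y)"
  using is_expansion_elem by (simp add: is_expansion_iff)

lemma coord_elem:
  assumes "B \<in> summands m" "y \<in> M3 (sdim B)" "C \<in> summands m"
  shows "coord m C (elem m B y) = (if C = B then y else 0)"
  using assms(3)
proof (cases rule: summands_cases)
  case (1 j)
  have "coord m C (elem m B y) [] [] = (if B = Inl j then y [] [] else 0)"
    using is_expansion_elem[OF assms(1,2)] 1 unfolding is_expansion_coord[OF inA_elem[OF assms(1,2)]] by metis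
  then have "coord m C (elem m B y) [] [] = (if C = B then y else 0) [] []" using 1 by auto
  moreover have "(if C = B then y else 0) \<in> M3 0" "coord m C (elem m B y) \<in> M3 0"
    using 1 assms(2) M3_closed(1)[of 0] inA_coord_M3[OF inA_elem[OF assms(1,2)] assms(3)] by (auto split: if_splits)
  ultimately show ?thesis by (intro M3_0_eqI)
next
  case (2 k j)
  have "coord m C (elem m B y) = (if B = Inr (k, j) then y else 0)"
    using is_expansion_elem[OF assms(1,2)] 2 unfolding is_expansion_coord[OF inA_elem[OF assms(1,2)]] by metis
  then show ?thesis using 2 by auto
qed

lemma coord_add: "coord m B (a + b) = coord m B a + coord m B b"
  and coord_smul: "coord m B (smul c a) = smul c (coord m B a)"
  and coord_madj: "coord m B (madj a) = madj (coord m B a)"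
proof -
  have "(blk 2 ^^ p) (a + b) = (blk 2 ^^ p) a + (blk 2 ^^ p) b" "(blk 2 ^^ p) (smul c a) = smul c ((blk 2 ^^ p) a)"
    "(blk 2 ^^ p) (madj a) = madj ((blk 2 ^^ p) a)" for p
    by (simp_all add: fun_eq_iff blk_pow_apply smul_def madj_def)
  then show "coord m B (a + b) = coord m B a + coord m B b" "coord m B (smul c a) = smul c (coord m B a)"
    "coord m B (madj a) = madj (coord m B a)"
    by (cases "(m, B, a)" rule: coord.cases; simp add: blk_simps)+
qed

lemma coord_0: "coord m B 0 = 0"
proof -
  have "coord m B (smul 0 0) = smul 0 (coord m B 0)" by (rule coord_smul)
  then show ?thesis by (simp only: smul_0)
qed

lemma coord_mmul:
  assumes "inA m a" "B \<in> summands m"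
  shows "coord m B (mmul a b) = mmul (coord m B a) (coord m B b)"
  using assms(2)
proof (cases rule: summands_cases)
  case (1 j)
  have "inA 0 ((blk 2 ^^ m) a)" using inA_blk_pow[of 0 m a] assms(1) by simp
  then show ?thesis using 1 blk_pow_mmul[of 0 m a b] assms(1) by (simp add: blk_mmul)
next
  case (2 k j)
  have "inA (Suc k) ((blk 2 ^^ (m - Suc k)) a)" using inA_blk_pow[of "Suc k" "m - Suc k" a] assms(1) 2 by simp
  then show ?thesis using 2 blk_pow_mmul[of "Suc k" "m - Suc k" a b] assms(1) by (simp add: blk_mmul)
qed

lemma coord_mid:
  assumes "B \<in> summands m" shows "coord m B (mid (Suc m)) = mid (sdim B)"
proof -
  have *: "(blk 2 ^^ p) (mid (n + p)) = mid n" for p n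
  proof (induction p)
    case (Suc p)
    have "(blk 2 ^^ Suc p) (mid (n + Suc p)) = (blk 2 ^^ p) (mid (n + p))"
      by (simp only: funpow_Suc_right comp_apply add_Suc_right blk_mid)
    then show ?case using Suc by simp
  qed simp
  from assms show ?thesis
  proof (cases rule: summands_cases)
    case (1 j)
    then show ?thesis using *[of m "Suc 0"] by (simp add: blk_mid)
  next
    case (2 k j)
    then show ?thesis using *[of "m - Suc k" "Suc (Suc k)"] by (simp add: blk_mid)
  qed
qed

lemma coord_sum: "coord m B (\<Sum>i\<in>S. f i) = (\<Sum>i\<in>S. coord m B (f i))"
proof (rule infinite_finite_induct[of _ S])
  show "coord m B (\<Sum>i\<in>{}. f i) = (\<Sum>i\<in>{}. coord m B (f i))" by (simp only: sum.empty coord_0)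
  show "coord m B (\<Sum>i\<in>A. f i) = (\<Sum>i\<in>A. coord m B (f i))" if inf: "infinite A" for A
    unfolding sum.infinite[OF inf] by (rule coord_0)
  show "coord m B (sum f (insert x F)) = (\<Sum>i\<in>insert x F. coord m B (f i))"
    if F: "finite F" "x \<notin> F" "coord m B (sum f F) = (\<Sum>i\<in>F. coord m B (f i))" for x F
    unfolding sum.insert[OF F(1,2)] coord_add F(3) ..
qed

lemma inA_sum: "(\<And>i. i \<in> S \<Longrightarrow> inA m (f i)) \<Longrightarrow> inA m (\<Sum>i\<in>S. f i)"
proof (induction S rule: infinite_finite_induct)
  case (insert x F)
  have "inA m (f x + sum f F)" by (rule inA_add) (use insert in auto)
  then show "inA m (sum f (insert x F))" by (simp only: sum.insert[OF insert(1,2)])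
next
  case (infinite A)
  then show "inA m (sum f A)" by (simp only: sum.infinite inA_0 not_False_eq_True)
next
  case empty
  show "inA m (sum f {})" by (simp only: sum.empty inA_0)
qed

lemma sum_elem_coord:
  assumes "inA m x" shows "x = (\<Sum>B\<in>summands m. elem m B (coord m B x))"
proof (rule coord_eqI[OF assms])
  show "inA m (\<Sum>B\<in>summands m. elem m B (coord m B x))"
    by (intro inA_sum inA_elem inA_coord_M3 assms)
  fix C assume C: "C \<in> summands m"
  have "coord m C (\<Sum>B\<in>summands m. elem m B (coord m B x)) = (\<Sum>B\<in>summands m. if C = B then coord m B x else 0)"
    unfolding coord_sum using C by (intro sum.cong refl coord_elem inA_coord_M3 assms)
  also have "\<dots> = coord m C x" using C by (simp only: sum.delta finite_summands if_True eq_commute[of C])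
  finally show "coord m C x = coord m C (\<Sum>B\<in>summands m. elem m B (coord m B x))" by (rule sym)
qed

lemma elem_mmul:
  assumes B: "B \<in> summands m" and x: "x \<in> M3 (sdim B)" and y: "y \<in> M3 (sdim B)"
  shows "mmul (elem m B x) (elem m B y) = elem m B (mmul x y)"
proof -
  have z: "mmul 0 0 = 0" by (simp add: mmul_def fun_eq_iff)
  show ?thesis
    by (rule coord_eqI[of m]) (simp_all add: inA_mmul inA_elem M3_mmul coord_mmul coord_elem B x y z)
qed

lemma elem_add:
  assumes B: "B \<in> summands m" and x: "x \<in> M3 (sdim B)" and y: "y \<in> M3 (sdim B)"
  shows "elem m B x + elem m B y = elem m B (x + y)"
  by (rule coord_eqI[of m]) (auto simp: inA_add inA_elem M3_closed(3) coord_add coord_elem B x y)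

lemma elem_smul:
  assumes B: "B \<in> summands m" and x: "x \<in> M3 (sdim B)"
  shows "smul c (elem m B x) = elem m B (smul c x)"
proof -
  have z: "smul c 0 = 0" by (simp add: smul_def fun_eq_iff)
  show ?thesis
    by (rule coord_eqI[of m]) (simp_all add: inA_smul inA_elem M3_closed(6) coord_smul coord_elem B x z)
qed

lemma madj_mid: "madj (mid n) = mid n"
  by (auto simp: madj_def mid_def fun_eq_iff)

text \<open>The unit of a summand is a projection, and the C*-identity then gives
  \<open>c\<^sup>2 = c\<close> for its norm \<open>c\<close>.\<close>

lemma elem_mid:
  assumes B: "B \<in> summands m"
  shows "madj (elem m B (mid (sdim B))) = elem m B (mid (sdim B))"
    "mmul (elem m B (mid (sdim B))) (elem m B (mid (sdim B))) = elem m B (mid (sdim B))"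
    "opnorm (Suc m) (elem m B (mid (sdim B))) \<le> 1"
proof -
  let ?p = "elem m B (mid (sdim B))"
  have z: "madj 0 = 0" by (simp add: madj_def fun_eq_iff)
  show a: "madj ?p = ?p"
    by (rule coord_eqI[of m]) (simp_all add: inA_madj inA_elem M3_closed(2) coord_madj coord_elem B madj_mid z)
  show i: "mmul ?p ?p = ?p"
    using elem_mmul[OF B M3_closed(2) M3_closed(2)] by (simp add: mmul_mid_n[OF M3_closed(2)])
  have "(opnorm (Suc m) ?p)\<^sup>2 = opnorm (Suc m) ?p" using opn_cstar[of "Suc m" ?p] by (simp add: a i)
  then show "opnorm (Suc m) ?p \<le> 1" by (auto simp: power2_eq_square)
qed

section \<open>Traces of the units of the summands\<close>

lemma ntr_tens: assumes "x \<in> M3 n" shows "ntr (n + k) (x \<otimes> y) = ntr n x * ntr k y"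
proof -
  have "(\<Sum>u\<in>words (n + k). (x \<otimes> y) u u) = (\<Sum>p\<in>words n. \<Sum>q\<in>words k. x p p * y q q)"
    unfolding sum_words_add by (intro sum.cong refl) (simp add: tens_apply[OF assms] words_iff)
  then show ?thesis by (simp add: ntr_def power_add sum_product)
qed

lemma ntr_add: "ntr n (x + y) = ntr n x + ntr n y"
  by (simp add: ntr_def sum.distrib add_divide_distrib)

lemma ntr_smul: "ntr n (smul c x) = c * ntr n x"
  by (simp add: ntr_def smul_def sum_distrib_left)

lemma ntr_sum: "ntr n (\<Sum>i\<in>S. f i) = (\<Sum>i\<in>S. ntr n (f i))"
  unfolding ntr_def sum_apply2 sum_divide_distrib by (rule sum.swap)

lemma ntr_mid: "ntr n (mid n) = 1"
  by (simp add: ntr_def mid_def card_words)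

lemma ntr_munit: "ntr (Suc 0) (munit i i) = 1 / 3"
proof -
  have "(\<Sum>u\<in>words 1. munit i i u u) = (\<Sum>u\<in>words 1. if u = [i] then 1 else 0)"
    by (rule sum.cong) (auto simp: munit_def)
  also have "\<dots> = 1" by (simp add: words_iff)
  finally show ?thesis by (simp add: ntr_def)
qed

lemma ntr_tpow: "ntr n (tpow (munit 2 2) n) = (1 / 3) ^ n"
proof (induction n)
  case 0
  show ?case using ntr_mid[of 0] by simp
next
  case (Suc n)
  then show ?case using ntr_tens[OF M3_munit, of n 2 2 "tpow (munit 2 2) n"] by (simp add: ntr_munit)
qed

lemma ntr_alpha: "ntr (Suc n) (alpha n j) = (1 / 3) ^ Suc n"
  using ntr_tens[OF M3_munit, of n j j "tpow (munit 2 2) n"] by (simp add: alpha_def ntr_munit ntr_tpow)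

lemma ntr_beta: "ntr (Suc (Suc n)) (beta (Suc n) j) = 2 * (1 / 3) ^ Suc (Suc n)"
proof -
  let ?s = "munit j j \<otimes> munit 1 1 + munit (j + 2) (j + 2) \<otimes> munit 3 3"
  have m: "ntr 2 (munit i i \<otimes> munit k k) = 1 / 9" for i k
    using ntr_tens[OF M3_munit, of 1 i i "munit k k"] by (simp add: ntr_munit numeral_2_eq_2)
  have "ntr (2 + n) (?s \<otimes> tpow (munit 2 2) n) = ntr 2 ?s * (1 / 3) ^ n"
    unfolding ntr_tpow[symmetric] by (rule ntr_tens[OF M3_closed(3)[OF M3_munit2 M3_munit2]])
  then show ?thesis by (simp add: beta_def ntr_add m)
qed

text \<open>The trace is \<open>(1 / 3) ^ (m + 1)\<close> for \<open>Inl j\<close> and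
  \<open>2 * (1 / 3) ^ (m - k + 1)\<close> for \<open>Inr (k, j)\<close>. What matters is that the
  common bound tends to 0 when the summand is fixed and \<open>m\<close> grows.\<close>

lemma cmod_ntr_elem_mid:
  assumes "B \<in> summands m"
  shows "cmod (ntr (Suc m) (elem m B (mid (sdim B)))) \<le> (1 / 3) ^ (m - sdim B)"
proof -
  let ?x = "\<lambda>j. if B = Inl j then mid (sdim B) [] [] else 0"
  let ?y = "\<lambda>k j. if B = Inr (k, j) then mid (sdim B) else 0"
  have n: "ntr (Suc m) (elem m B (mid (sdim B)))
    = (\<Sum>j\<in>UNIV. ?x j * (1 / 3) ^ Suc m) + (\<Sum>k<m. \<Sum>j\<in>UNIV. ntr k (?y k j) * (2 * (1 / 3) ^ Suc (m - k)))"
  proof -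
    have "ntr (Suc m) (?y k j \<otimes> beta (m - k) j) = ntr k (?y k j) * (2 * (1 / 3) ^ Suc (m - k))" if "k < m" for k j
    proof -
      have M: "?y k j \<in> M3 k" using M3_closed(1)[of k] M3_closed(2)[of k] by auto
      have e: "m - k = Suc (m - k - 1)" "Suc m = k + Suc (m - k)" using that by auto
      have "ntr (Suc (m - k)) (beta (m - k) j) = 2 * (1 / 3) ^ Suc (m - k)"
        using ntr_beta[of "m - k - 1" j] unfolding e(1)[symmetric] .
      then show ?thesis using ntr_tens[OF M, of "Suc (m - k)" "beta (m - k) j"] unfolding e(2)[symmetric] by simp
    qed
    then show ?thesis
      unfolding elem_def expand_def ntr_add ntr_sum ntr_smul ntr_alpha
      by (intro arg_cong2[of _ _ _ _ "(+)"] sum.cong refl) (simp only: lessThan_iff)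
  qed
  have z: "ntr k 0 = 0" for k by (simp add: ntr_def)
  have c: "cmod ((1 / 3) ^ k) = (1 / 3) ^ k" for k by (simp add: norm_power norm_divide)
  from assms show ?thesis
  proof (cases rule: summands_cases)
    case (1 i)
    have "(\<Sum>j\<in>UNIV. ?x j * (1 / 3) ^ Suc m) = (\<Sum>j\<in>UNIV. if j = i then (1 / 3) ^ Suc m else 0)"
      using 1 by (intro sum.cong) (auto simp: mid_def)
    then have e: "ntr (Suc m) (elem m B (mid (sdim B))) = (1 / 3) ^ Suc m"
      unfolding n using 1 by (simp add: z)
    show ?thesis unfolding e c using 1 by simp
  next
    case (2 l i)
    have "(\<Sum>k<m. \<Sum>j\<in>UNIV. ntr k (?y k j) * (2 * (1 / 3) ^ Suc (m - k)))
       = (\<Sum>k<m. if k = l then 2 * (1 / 3) ^ Suc (m - l) else 0)"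
    proof (rule sum.cong)
      fix k
      have "(\<Sum>j\<in>UNIV. ntr k (?y k j) * (2 * (1 / 3) ^ Suc (m - k)))
         = (\<Sum>j\<in>UNIV. if j = i then (if k = l then 2 * (1 / 3) ^ Suc (m - l) else 0) else 0)"
        using 2 by (intro sum.cong) (auto simp: z ntr_mid)
      then show "(\<Sum>j\<in>UNIV. ntr k (?y k j) * (2 * (1 / 3) ^ Suc (m - k))) = (if k = l then 2 * (1 / 3) ^ Suc (m - l) else 0)"
        by simp
    qed simp
    also have "\<dots> = 2 * (1 / 3) ^ Suc (m - l)" using 2 by simp
    finally have e: "ntr (Suc m) (elem m B (mid (sdim B))) = 2 * (1 / 3) ^ Suc (m - l)"
      unfolding n using 2 by simp
    show ?thesis unfolding e norm_mult c using 2 by simp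
  qed
qed

section \<open>Splitting a tracial state along \<open>ker_rho m\<close>\<close>

text \<open>For matrix units, \<open>E u u * E u v = E u v\<close> while the reversed product is 0
  if \<open>u\<close> and \<open>v\<close> differ, and \<open>E u v * E v u = E u u\<close>. So
  \<open>g\<close> vanishes off the diagonal and is constant along it. Linearity is assumed on
  \<open>M3 n\<close> only, since the functionals in question are not controlled elsewhere.\<close>

lemma trace_unique:
  fixes g :: "wmat \<Rightarrow> complex"
  assumes add: "\<And>x y. x \<in> M3 n \<Longrightarrow> y \<in> M3 n \<Longrightarrow> g (x + y) = g x + g y"
    and scale: "\<And>c x. x \<in> M3 n \<Longrightarrow> g (smul c x) = c * g x"
    and comm: "\<And>x y. x \<in> M3 n \<Longrightarrow> y \<in> M3 n \<Longrightarrow> g (mmul x y) = g (mmul y x)"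
    and x: "x \<in> M3 n"
  shows "g x = ntr n x * g (mid n)"
proof -
  define E :: "3 list \<Rightarrow> 3 list \<Rightarrow> wmat" where "E u v = (\<lambda>p q. if p = u \<and> q = v then 1 else 0)" for u v
  have EM: "E u v \<in> M3 n" if "u \<in> words n" "v \<in> words n" for u v
    using that by (auto simp: E_def M3_def)
  have g0: "g 0 = 0" using scale[OF M3_closed(1), of 0] by (simp add: smul_0)
  have EE: "mmul (E u v) (E v' w) = (if v = v' then E u w else 0)" if "u \<in> words n" "v \<in> words n" for u v v' w
  proof (intro ext)
    fix p q
    have "(\<Sum>r\<in>words (length p). E u v p r * E v' w r q)
      = (\<Sum>r\<in>words (length p). if r = v then (if p = u \<and> q = w \<and> v = v' then 1 else 0) else 0)"
      by (rule sum.cong) (auto simp: E_def)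
    then show "mmul (E u v) (E v' w) p q = (if v = v' then E u w else 0) p q"
      using that by (auto simp: mmul_def E_def words_iff)
  qed
  have off: "g (E u v) = 0" if "u \<in> words n" "v \<in> words n" "u \<noteq> v" for u v
    using comm[OF EM[OF that(1,1)] EM[OF that(1,2)]] that by (simp add: EE g0)
  have diag: "g (E u u) = g (E v v)" if "u \<in> words n" "v \<in> words n" for u v
    using comm[OF EM[OF that] EM[OF that(2,1)]] that by (simp add: EE)
  define c where "c = g (E (replicate n 1) (replicate n 1))"
  have r: "replicate n 1 \<in> words n" by (simp add: words_iff)
  have gE: "g (E u v) = (if u = v then c else 0)" if "u \<in> words n" "v \<in> words n" for u v
    using off[OF that] diag[OF that(1) r] by (auto simp: c_def)
  have gsum: "g (\<Sum>i\<in>S. f i) = (\<Sum>i\<in>S. g (f i))" if f: "\<And>i. i \<in> S \<Longrightarrow> f i \<in> M3 n" and S: "finite S" for f :: "3 list \<Rightarrow> wmat" and S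
    using S f
  proof (induction S rule: finite_induct)
    case empty
    show "g (sum f {}) = (\<Sum>i\<in>{}. g (f i))" by (simp only: sum.empty g0)
  next
    case (insert i F)
    \<comment> \<open>\<open>M3_sum\<close> asks for membership at every index, so \<open>f\<close>
      is set to 0 outside \<open>F\<close>.\<close>
    have "sum f F = sum (\<lambda>j. if j \<in> F then f j else 0) F" by (rule sum.cong) auto
    also have "\<dots> \<in> M3 n" by (rule M3_sum) (use insert M3_closed(1) in auto)
    finally show "g (sum f (insert i F)) = (\<Sum>i\<in>insert i F. g (f i))"
      using insert add[of "f i" "sum f F"] by (simp only: sum.insert[OF insert(1,2)] insertI1 insertI2) 
  qed
  have val: "g z = (\<Sum>u\<in>words n. z u u) * c" if z: "z \<in> M3 n" for z
  proof -
    have "z = (\<Sum>u\<in>words n. \<Sum>v\<in>words n. smul (z u v) (E u v))"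
    proof (intro ext)
      fix p q
      have "(\<Sum>u\<in>words n. \<Sum>v\<in>words n. smul (z u v) (E u v)) p q
        = (\<Sum>u\<in>words n. \<Sum>v\<in>words n. if v = q then (if u = p then z p q else 0) else 0)"
        unfolding sum_apply2 smul_def E_def by (intro sum.cong refl) auto
      then show "z p q = (\<Sum>u\<in>words n. \<Sum>v\<in>words n. smul (z u v) (E u v)) p q"
        using M3_0[OF z, of p q] by (cases "q \<in> words n") auto
    qed
    then have "g z = g (\<Sum>u\<in>words n. \<Sum>v\<in>words n. smul (z u v) (E u v))" by simp
    also have "\<dots> = (\<Sum>u\<in>words n. g (\<Sum>v\<in>words n. smul (z u v) (E u v)))"
    proof (rule gsum)
      fix u assume u: "u \<in> words n"
      have "(\<Sum>v\<in>words n. smul (z u v) (E u v)) = (\<Sum>v\<in>words n. if v \<in> words n then smul (z u v) (E u v) else 0)"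
        by (rule sum.cong) auto
      also have "\<dots> \<in> M3 n" by (rule M3_sum) (auto intro!: M3_closed EM u)
      finally show "(\<Sum>v\<in>words n. smul (z u v) (E u v)) \<in> M3 n" .
    qed simp
    also have "\<dots> = (\<Sum>u\<in>words n. \<Sum>v\<in>words n. g (smul (z u v) (E u v)))"
      by (intro sum.cong refl gsum M3_closed(6) EM) auto
    also have "\<dots> = (\<Sum>u\<in>words n. \<Sum>v\<in>words n. if v = u then z u u * c else 0)"
      by (intro sum.cong refl) (auto simp: scale EM gE)
    finally show ?thesis by (simp add: sum_distrib_right)
  qed
  have "(\<Sum>u\<in>words n. mid n u u) = 3 ^ n" by (simp add: mid_def card_words)
  then have "g (mid n) = 3 ^ n * c" using val[OF M3_closed(2)] by simp
  then show ?thesis using val[OF x] by (simp add: ntr_def)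
qed

text \<open>The coordinate is taken at the lowest level that has the summand. By
  \<open>coord_rho\<close> all higher levels give the same matrix, so no level has to be
  mentioned.\<close>

fun ucoord :: "summand \<Rightarrow> uhf \<Rightarrow> wmat" where
  "ucoord (Inl j) b = blk j (rho 0 b)"
| "ucoord (Inr (k, j)) b = blk j (blk 1 (rho (Suc k) b))"

definition summand_trace :: "summand \<Rightarrow> uhf \<Rightarrow> complex" where
  "summand_trace B b = ntr (sdim B) (ucoord B b)"

lemma coord_rho: assumes "B \<in> summands m" shows "coord m B (rho m b) = ucoord B b"
  using assms
proof (cases rule: summands_cases)
  case (1 j)
  then show ?thesis using blk_pow_rho[of m 0 b] by simp
next
  case (2 k j)
  then show ?thesis using blk_pow_rho[of "m - Suc k" "Suc k" b] by simp
qed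

lemma mem_summands: "B \<in> summands (Suc (sdim B))"
  by (cases B rule: sdim.cases) (auto simp: summands_def)

lemma chi_eq: assumes "b \<in> calA_inf" shows "chi j b = summand_trace (Inl j) b"
  using xi_eq[OF rho_calA_inf[OF assms], of 0 j] by (simp add: chi_def summand_trace_def ntr_def blk_def)

lemma tau_fin_eq: assumes "b \<in> calA_inf" shows "tau_fin (Suc k) j b = summand_trace (Inr (k, j)) b"
  using eta_eq[OF rho_calA_inf[OF assms], of k "Suc k" j] by (simp add: tau_fin_def summand_trace_def)

lemma cmod_summand_trace: "cmod (summand_trace B b) \<le> norm b"
proof -
  have "cmod (ucoord B b u v) \<le> norm b" for u v
    by (cases B rule: sdim.cases) (simp_all add: blk_def cmod_rho)
  then have "cmod (\<Sum>u\<in>words (sdim B). ucoord B b u u) \<le> (\<Sum>u\<in>words (sdim B). norm b)"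
    by (intro sum_norm_le)
  then show ?thesis by (simp add: summand_trace_def ntr_def card_words norm_divide norm_power field_simps)
qed

lemma M3_ucoord: assumes "b \<in> calA_inf" shows "ucoord B b \<in> M3 (sdim B)"
  using inA_coord_M3[OF rho_calA_inf[OF assms] mem_summands] by (simp add: coord_rho[OF mem_summands])

lemma ucoord_mult:
  assumes "a \<in> calA_inf" "b \<in> calA_inf" shows "ucoord B (a * b) = mmul (ucoord B a) (ucoord B b)"
  unfolding coord_rho[OF mem_summands, symmetric] rho_mult[OF assms]
  by (rule coord_mmul[OF rho_calA_inf[OF assms(1)] mem_summands])

lemma ucoord_star: "ucoord B (star a) = madj (ucoord B a)"
  unfolding coord_rho[OF mem_summands, symmetric] rho_star by (rule coord_madj)

lemma ucoord_1: "ucoord B 1 = mid (sdim B)"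
  unfolding coord_rho[OF mem_summands, symmetric] rho_1 by (rule coord_mid[OF mem_summands])

lemma rho_eqI:
  assumes "a \<in> calA_inf" "b \<in> calA_inf" "\<And>B. B \<in> summands m \<Longrightarrow> ucoord B a = ucoord B b"
  shows "rho m a = rho m b"
  by (rule coord_eqI[OF rho_calA_inf[OF assms(1)] rho_calA_inf[OF assms(2)]]) (simp add: coord_rho assms(3))

text \<open>
  Taking the infimum discards the mass that \<open>\<tau>\<close> gives to \<open>star s * s\<close> outside the summand \<open>B\<close>.
\<close>

definition trace_coeff :: "(uhf \<Rightarrow> complex) \<Rightarrow> summand \<Rightarrow> real" where
  "trace_coeff \<tau> B = (INF s\<in>{s \<in> calA_inf. ucoord B (star s * s) = mid (sdim B)}. Re (\<tau> (star s * s)))"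

lemma trace_coeff_le:
  assumes "tracial_state_on calA_inf \<tau>" "s \<in> calA_inf" "ucoord B (star s * s) = mid (sdim B)"
  shows "trace_coeff \<tau> B \<le> Re (\<tau> (star s * s))"
proof -
  have "0 \<le> Re (\<tau> (star s * s))" if "s \<in> calA_inf" for s
    using assms(1) that unfolding tracial_state_on_def by (auto simp: nonneg_Reals_def)
  then show ?thesis unfolding trace_coeff_def using assms
    by (intro cINF_lower) (auto intro!: bdd_belowI[of _ 0])
qed

lemma trace_coeff_greatest:
  assumes "\<And>s. s \<in> calA_inf \<Longrightarrow> ucoord B (star s * s) = mid (sdim B) \<Longrightarrow> c \<le> Re (\<tau> (star s * s))"
  shows "c \<le> trace_coeff \<tau> B"
  unfolding trace_coeff_def
proof (rule cINF_greatest)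
  have "1 \<in> {s \<in> calA_inf. ucoord B (star s * s) = mid (sdim B)}" by (simp add: calA_inf_1 ucoord_1)
  then show "{s \<in> calA_inf. ucoord B (star s * s) = mid (sdim B)} \<noteq> {}" by blast
qed (use assms in auto)

lemma trace_coeff_nonneg:
  assumes "tracial_state_on calA_inf \<tau>" shows "0 \<le> trace_coeff \<tau> B"
  by (rule trace_coeff_greatest)
    (use assms in \<open>auto simp: tracial_state_on_def nonneg_Reals_def\<close>)

text \<open>The second conclusion measures how far the remainder \<open>f\<close> is from a multiple
  of a trace: \<open>f\<close> is contractive on the multipliers, and on \<open>M3 m\<close> it
  equals \<open>f 1\<close> times \<open>ntr m\<close>, where \<open>f 1\<close> is what the
  coefficients leave of the total mass 1.\<close>

lemma trace_split:
  assumes tr: "tracial_state_on calA_inf \<tau>"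
  obtains f where
    "\<And>b. b \<in> calA_inf \<Longrightarrow> \<tau> b = (\<Sum>B\<in>summands m. of_real (trace_coeff \<tau> B) * summand_trace B b) + f b"
    "\<And>b x. b \<in> calA_inf \<Longrightarrow> x \<in> M3 m \<Longrightarrow>
       cmod (f b - ntr m x * of_real (1 - (\<Sum>B\<in>summands m. trace_coeff \<tau> B))) \<le> norm (b - iota m x)"
    "(\<Sum>B\<in>summands m. trace_coeff \<tau> B) \<le> 1"
proof -
  interpret tracial_ideal calA_inf \<tau> "ker_rho m" by (rule tracial_ideal_ker_rho[OF tr])
  obtain t f where t: "\<And>n. t n \<in> appr"
    and lim: "\<And>x. x \<in> multipliers \<Longrightarrow> (\<lambda>n. \<tau> (cut (t n) * x)) \<longlonglongrightarrow> f x"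
    and f_add: "\<And>x y. x \<in> multipliers \<Longrightarrow> y \<in> multipliers \<Longrightarrow> f (x + y) = f x + f y"
    and f_scale: "\<And>x c. x \<in> multipliers \<Longrightarrow> f (scaleC c x) = c * f x"
    and f_comm: "\<And>x y. x \<in> multipliers \<Longrightarrow> y \<in> multipliers \<Longrightarrow> f (x * y) = f (y * x)"
    and f_bound: "\<And>x. x \<in> multipliers \<Longrightarrow> cmod (f x) \<le> norm x"
    and f_I: "\<And>b. b \<in> ker_rho m \<Longrightarrow> f b = \<tau> b"
    using ideal_part by blast
  have tA: "t n \<in> calA_inf" for n by (rule appr_A[OF t])
  define \<omega> where "\<omega> b = \<tau> b - f b" for b
  note mA = multipliers_A
  have w_add: "\<omega> (a + b) = \<omega> a + \<omega> b" if "a \<in> calA_inf" "b \<in> calA_inf" for a b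
    using that by (simp add: \<omega>_def tau_add f_add mA)
  have w_scale: "\<omega> (scaleC c a) = c * \<omega> a" if "a \<in> calA_inf" for a c
    using that by (simp add: \<omega>_def tau_scaleC f_scale mA algebra_simps)
  have w_comm: "\<omega> (a * b) = \<omega> (b * a)" if "a \<in> calA_inf" "b \<in> calA_inf" for a b
    using that tau_commute[of a b] f_comm[of a b] by (simp add: \<omega>_def mA)
  have w_eq: "\<omega> a = \<omega> b" if "a \<in> calA_inf" "b \<in> calA_inf" "rho m a = rho m b" for a b
  proof -
    have k: "a - b \<in> ker_rho m" using that by (simp add: ker_rho_def diff_A rho_diff)
    have "\<omega> ((a - b) + b) = \<omega> (a - b) + \<omega> b" using that by (intro w_add diff_A)
    moreover have "\<omega> (a - b) = 0" using f_I[OF k] by (simp add: \<omega>_def)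
    ultimately show ?thesis by simp
  qed
  have w_lim: "(\<lambda>n. \<tau> (star (t n) * t n * b)) \<longlonglongrightarrow> \<omega> b" if b: "b \<in> calA_inf" for b
  proof -
    have "\<tau> b - \<tau> (cut (t n) * b) = \<tau> (star (t n) * t n * b)" for n
      using b tA[of n] by (simp add: cut_def left_diff_distrib tau_diff A_intros)
    moreover have "(\<lambda>n. \<tau> b - \<tau> (cut (t n) * b)) \<longlonglongrightarrow> \<omega> b"
      unfolding \<omega>_def by (intro tendsto_diff tendsto_const lim mA b)
    ultimately show ?thesis by simp
  qed
  have f1: "f 1 = 1 - \<omega> 1" by (simp add: \<omega>_def tau_one)
  have f1_nonneg: "0 \<le> Re (f 1)"
  proof (rule tendsto_lowerbound[OF tendsto_Re[OF lim[OF mA[OF one_A]]]])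
    show "\<forall>\<^sub>F n in sequentially. 0 \<le> Re (\<tau> (cut (t n) * 1))"
      using mass_le_1[OF t] by (simp add: mass_cut[OF t])
  qed simp
  \<comment> \<open>\<open>L\<close> merely chooses lifts and is not claimed to be linear. By
    \<open>w_eq\<close> the value \<open>\<omega> (L x)\<close> depends on \<open>x\<close> alone,
    which makes it linear and tracial in \<open>x\<close>.\<close>
  have "\<exists>L. \<forall>x. inA m x \<longrightarrow> L x \<in> calA_inf \<and> rho m (L x) = x \<and> norm (L x) \<le> opnorm (Suc m) x \<and> (madj x = x \<longrightarrow> star (L x) = L x)"
  proof (rule choice, intro allI)
    fix x
    show "\<exists>b. inA m x \<longrightarrow> b \<in> calA_inf \<and> rho m b = x \<and> norm b \<le> opnorm (Suc m) x \<and> (madj x = x \<longrightarrow> star b = b)"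
      by (cases "inA m x") (metis lift_exists)+
  qed
  then obtain L where L: "\<And>x. inA m x \<Longrightarrow> L x \<in> calA_inf" "\<And>x. inA m x \<Longrightarrow> rho m (L x) = x"
    "\<And>x. inA m x \<Longrightarrow> norm (L x) \<le> opnorm (Suc m) x" "\<And>x. inA m x \<Longrightarrow> madj x = x \<Longrightarrow> star (L x) = L x"
    by blast
  have w_L_add: "\<omega> (L (x + y)) = \<omega> (L x) + \<omega> (L y)" if "inA m x" "inA m y" for x y
  proof -
    have "\<omega> (L (x + y)) = \<omega> (L x + L y)"
      by (rule w_eq) (simp_all add: that L inA_add add_A rho_add)
    then show ?thesis using that by (simp add: w_add L)
  qed
  have w_L_scale: "\<omega> (L (smul c x)) = c * \<omega> (L x)" if "inA m x" for x c
  proof -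
    have "\<omega> (L (smul c x)) = \<omega> (scaleC c (L x))"
      by (rule w_eq) (simp_all add: that L inA_smul scaleC_A rho_scaleC)
    then show ?thesis using that by (simp add: w_scale L)
  qed
  have w_L_comm: "\<omega> (L (mmul x y)) = \<omega> (L (mmul y x))" if "inA m x" "inA m y" for x y
  proof -
    have "\<omega> (L (mmul a b)) = \<omega> (L a * L b)" if "inA m a" "inA m b" for a b
      by (rule w_eq) (simp_all add: that L inA_mmul mult_A rho_mult)
    then show ?thesis using that w_comm[of "L x" "L y"] by (simp add: L)
  qed
  have w_L_0: "\<omega> (L 0) = 0" using w_L_scale[OF inA_0, of 0] by (simp add: smul_0)
  have w_L_sum: "\<omega> (L (\<Sum>i\<in>S. h i)) = (\<Sum>i\<in>S. \<omega> (L (h i)))" if S: "finite S" and h: "\<And>i. i \<in> S \<Longrightarrow> inA m (h i)"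
    for h :: "summand \<Rightarrow> wmat" and S
    using S h
  proof (induction S rule: finite_induct)
    case empty
    show "\<omega> (L (sum h {})) = (\<Sum>i\<in>{}. \<omega> (L (h i)))" by (simp only: sum.empty w_L_0)
  next
    case (insert i F)
    have "inA m (sum h F)" by (rule inA_sum) (use insert in auto)
    moreover have "inA m (h i)" using insert by auto
    moreover have "\<omega> (L (sum h F)) = (\<Sum>i\<in>F. \<omega> (L (h i)))" using insert by auto
    ultimately show "\<omega> (L (sum h (insert i F))) = (\<Sum>i\<in>insert i F. \<omega> (L (h i)))"
      using w_L_add[of "h i" "sum h F"] by (simp only: sum.insert[OF insert(1,2)])
  qed
  \<comment> \<open>\<open>trace_coeff\<close> does not mention \<open>m\<close>; this identity is
    therefore what makes the coefficients independent of the level.\<close>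
  have unit: "\<omega> (L (elem m B (mid (sdim B)))) = of_real (trace_coeff \<tau> B)" if B: "B \<in> summands m" for B
  proof -
    let ?p = "elem m B (mid (sdim B))"
    have pA: "inA m ?p" by (rule inA_elem[OF B M3_closed(2)])
    define g where "g = L ?p"
    have g: "g \<in> calA_inf" "rho m g = ?p" "norm g \<le> 1" "star g = g"
      using L[OF pA] elem_mid[OF B] by (auto simp: g_def)
    have gc: "ucoord C g = (if C = B then mid (sdim B) else 0)" if "C \<in> summands m" for C
      using coord_elem[OF B M3_closed(2) that] coord_rho[OF that, of g] g(2) by simp
    have wg: "\<omega> (g * g) = \<omega> g"
      by (rule w_eq) (simp_all add: g mult_A rho_mult elem_mid(2)[OF B])
    have m0: "mmul 0 y = 0" "mmul y 0 = 0" for y by (simp_all add: mmul_def fun_eq_iff)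
    have mm: "mmul (mid n) (mid n) = mid n" for n by (rule mmul_mid_n[OF M3_closed(2)])
    have tg: "\<tau> (star (t n) * t n * (g * g)) = \<tau> (star (g * star (t n)) * (g * star (t n)))" for n
    proof -
      have "\<tau> (star (t n) * (t n * (g * g))) = \<tau> (t n * (g * g) * star (t n))"
        by (intro tau_commute A_intros tA g)
      then show ?thesis by (simp add: star_mult g(4) mult.assoc)
    qed
    \<comment> \<open>The elements \<open>g * star (t n)\<close> compete in the infimum, and by
      traciality their values tend to \<open>\<omega> (g * g)\<close>.\<close>
    have lower: "trace_coeff \<tau> B \<le> Re (\<omega> g)"
    proof -
      have "trace_coeff \<tau> B \<le> Re (\<tau> (star (t n) * t n * (g * g)))" for n
        unfolding tg
      proof (rule trace_coeff_le[OF tr])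
        show "g * star (t n) \<in> calA_inf" by (intro A_intros tA g)
        have "rho m (t n) = rho m 1"
        proof -
          have "t n - 1 \<in> ker_rho m" using t[of n] by (simp add: appr_def)
          then show ?thesis by (simp add: ker_rho_def rho_diff)
        qed
        then have "ucoord B (t n) = ucoord B 1" unfolding coord_rho[OF B, symmetric] by simp
        then have tc: "ucoord B (t n) = mid (sdim B)" by (simp add: ucoord_1)
        show "ucoord B (star (g * star (t n)) * (g * star (t n))) = mid (sdim B)"
          using gc[OF B] by (simp add: star_mult g ucoord_mult A_intros tA ucoord_star tc madj_mid mm)
      qed
      then have "trace_coeff \<tau> B \<le> Re (\<omega> (g * g))"
        by (intro tendsto_lowerbound[OF tendsto_Re[OF w_lim]] mult_A g) auto
      then show ?thesis by (simp add: wg)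
    qed
    \<comment> \<open>Replacing a competitor \<open>s\<close> by \<open>s * g\<close> does not
      increase its value, and \<open>star (s * g) * (s * g)\<close> has the same slice as
      \<open>g\<close>. It remains to use that \<open>\<omega>\<close> is at most
      \<open>\<tau>\<close> on positive elements.\<close>
    have upper: "Re (\<omega> g) \<le> trace_coeff \<tau> B"
    proof (rule trace_coeff_greatest)
      fix s assume s: "s \<in> calA_inf" "ucoord B (star s * s) = mid (sdim B)"
      let ?a = "s * g"
      have aA: "?a \<in> calA_inf" by (intro A_intros s g)
      have sa: "star ?a * ?a = g * (star s * s) * g" by (simp add: star_mult g mult.assoc)
      have "rho m (star ?a * ?a) = rho m g"
      proof (rule rho_eqI)
        fix C assume C: "C \<in> summands m"
        have "ucoord C (star ?a * ?a) = mmul (mmul (ucoord C g) (ucoord C (star s * s))) (ucoord C g)"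
          unfolding sa by (simp add: ucoord_mult A_intros s g)
        then show "ucoord C (star ?a * ?a) = ucoord C g"
          using gc[OF C] s(2) by (simp add: mm m0)
      qed (intro A_intros s g)+
      then have "\<omega> (star ?a * ?a) = \<omega> g" by (intro w_eq A_intros s g)
      moreover have "Re (\<omega> (star ?a * ?a)) \<le> Re (\<tau> (star ?a * ?a))"
      proof (rule tendsto_upperbound[OF tendsto_Re[OF w_lim]])
        have "Re (\<tau> (star (t n) * t n * (star ?a * ?a))) \<le> Re (\<tau> (star ?a * ?a))" for n
        proof -
          have "\<tau> (?a * (star (t n) * t n * star ?a)) = \<tau> (star (t n) * t n * star ?a * ?a)"
            by (intro tau_commute A_intros tA s g)
          moreover have "\<tau> (?a * star ?a) = \<tau> (star ?a * ?a)" by (intro tau_commute A_intros s g)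
          ultimately show ?thesis
            using tau_one_minus_star_mult[of "star ?a" "t n"] t[of n] aA tA[of n]
            by (simp add: appr_def star_A mult.assoc)
        qed
        then show "\<forall>\<^sub>F n in sequentially. Re (\<tau> (star (t n) * t n * (star ?a * ?a))) \<le> Re (\<tau> (star ?a * ?a))"
          by simp
      qed (intro A_intros s g, simp)
      moreover have "Re (\<tau> (star ?a * ?a)) \<le> Re (\<tau> (star s * s))"
      proof -
        have "\<tau> (star ?a * ?a) = \<tau> (?a * star ?a)" by (intro tau_commute A_intros s g)
        also have "?a * star ?a = star (star s) * (star g * g) * star s" by (simp add: star_mult g mult.assoc)
        finally have "Re (\<tau> (star ?a * ?a)) \<le> Re (\<tau> (star (star s) * star s))"
          using tau_one_minus_star_mult[of "star s" g] s g by (simp add: star_A)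
        also have "\<tau> (star (star s) * star s) = \<tau> (star s * star (star s))" by (intro tau_commute A_intros s)
        finally show ?thesis by simp
      qed
      ultimately show "Re (\<omega> g) \<le> Re (\<tau> (star s * s))" by simp
    qed
    have "Im (\<omega> (g * g)) = 0"
    proof (rule LIMSEQ_unique[OF tendsto_Im[OF w_lim]])
      show "g * g \<in> calA_inf" by (intro A_intros g)
      have "Im (\<tau> (star (t n) * t n * (g * g))) = 0" for n
        unfolding tg by (rule tau_star_mult(2)) (intro A_intros g tA)
      then show "(\<lambda>n. Im (\<tau> (star (t n) * t n * (g * g)))) \<longlonglongrightarrow> 0" by simp
    qed
    then have "Im (\<omega> g) = 0" by (simp only: wg)
    then show ?thesis using lower upper unfolding g_def[symmetric] by (simp add: complex_eq_iff)
  qed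
  have w_formula: "\<omega> b = (\<Sum>B\<in>summands m. of_real (trace_coeff \<tau> B) * summand_trace B b)" if b: "b \<in> calA_inf" for b
  proof -
    have "\<omega> b = \<omega> (L (rho m b))"
      by (rule w_eq) (simp_all add: b L rho_calA_inf)
    also have "\<dots> = \<omega> (L (\<Sum>B\<in>summands m. elem m B (coord m B (rho m b))))"
      using sum_elem_coord[OF rho_calA_inf[OF b]] by simp
    also have "\<dots> = (\<Sum>B\<in>summands m. \<omega> (L (elem m B (coord m B (rho m b)))))"
      by (intro w_L_sum inA_elem inA_coord_M3 rho_calA_inf b) simp
    also have "\<dots> = (\<Sum>B\<in>summands m. of_real (trace_coeff \<tau> B) * summand_trace B b)"
    proof (rule sum.cong)
      fix B assume B: "B \<in> summands m"
      have "\<omega> (L (elem m B (ucoord B b))) = ntr (sdim B) (ucoord B b) * \<omega> (L (elem m B (mid (sdim B))))"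
      proof (rule trace_unique[where g = "\<lambda>y. \<omega> (L (elem m B y))"])
        fix x y assume xy: "x \<in> M3 (sdim B)" "y \<in> M3 (sdim B)"
        show "\<omega> (L (elem m B (x + y))) = \<omega> (L (elem m B x)) + \<omega> (L (elem m B y))"
          unfolding elem_add[OF B xy, symmetric] by (intro w_L_add inA_elem B xy)
        show "\<omega> (L (elem m B (mmul x y))) = \<omega> (L (elem m B (mmul y x)))"
          unfolding elem_mmul[OF B xy, symmetric] elem_mmul[OF B xy(2,1), symmetric]
          by (intro w_L_comm inA_elem B xy)
      next
        fix c x assume x: "x \<in> M3 (sdim B)"
        show "\<omega> (L (elem m B (smul c x))) = c * \<omega> (L (elem m B x))"
          unfolding elem_smul[OF B x, symmetric] by (intro w_L_scale inA_elem B x)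
      qed (rule M3_ucoord[OF b])
      then show "\<omega> (L (elem m B (coord m B (rho m b)))) = of_real (trace_coeff \<tau> B) * summand_trace B b"
        by (simp add: coord_rho[OF B] unit[OF B] summand_trace_def)
    qed simp
    finally show ?thesis .
  qed
  have w1: "\<omega> 1 = of_real (\<Sum>B\<in>summands m. trace_coeff \<tau> B)"
    by (simp add: w_formula one_A summand_trace_def ucoord_1 ntr_mid)
  \<comment> \<open>Multiplication from the right is reduced to multiplication from the left by the
    involution.\<close>
  have iota_mult: "iota m x \<in> multipliers" if x: "x \<in> M3 m" for x
  proof -
    have "b * iota m x \<in> ker_rho m" if b: "b \<in> ker_rho m" for b
    proof -
      have "iota m (madj x) * star b \<in> ker_rho m"
        by (intro ker_rho_mult_iota M3_closed(7) x star_I b)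
      then have "star (iota m (madj x) * star b) \<in> ker_rho m" by (rule star_I)
      then show ?thesis by (simp add: star_mult iota_madj[OF x])
    qed
    then show ?thesis using ker_rho_mult_iota[OF x] by (simp add: multipliers_def)
  qed
  have f_iota: "f (iota m x) = ntr m x * f 1" if x: "x \<in> M3 m" for x
    using trace_unique[where g = "\<lambda>x. f (iota m x)" and n = m and x = x]
    by (simp add: x iota_add iota_smul iota_mmul iota_mid f_add f_scale f_comm iota_mult)
  show ?thesis
  proof (rule that[of f])
    show "\<tau> b = (\<Sum>B\<in>summands m. of_real (trace_coeff \<tau> B) * summand_trace B b) + f b" if "b \<in> calA_inf" for b
      using w_formula[OF that] unfolding \<omega>_def by (simp only: diff_eq_eq)
    show "cmod (f b - ntr m x * of_real (1 - (\<Sum>B\<in>summands m. trace_coeff \<tau> B))) \<le> norm (b - iota m x)"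
      if b: "b \<in> calA_inf" and x: "x \<in> M3 m" for b x
    proof -
      have m: "b \<in> multipliers" "scaleC (-1) (iota m x) \<in> multipliers"
        by (intro mA b multipliers_scaleC iota_mult x)+
      have e: "b - iota m x = b + scaleC (-1) (iota m x)" unfolding uminus_scaleC[symmetric] by simp
      have "f (b - iota m x) = f b - f (iota m x)"
        unfolding e f_add[OF m] f_scale[OF iota_mult[OF x]] by simp
      moreover have "b - iota m x \<in> multipliers" unfolding e by (rule multipliers_add[OF m])
      moreover have "f (iota m x) = ntr m x * of_real (1 - (\<Sum>B\<in>summands m. trace_coeff \<tau> B))"
        by (simp add: f_iota[OF x] f1 w1)
      ultimately show ?thesis using f_bound[of "b - iota m x"] by simp
    qed
    show "(\<Sum>B\<in>summands m. trace_coeff \<tau> B) \<le> 1"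
      using f1_nonneg by (simp add: f1 w1)
  qed
qed

section \<open>Existence and uniqueness of the decomposition\<close>

abbreviation idx :: "(nat \<times> 3) set" where
  "idx \<equiv> {1..} \<times> UNIV"

text \<open>\<open>tau_fin m j\<close> reads a coefficient in \<open>M3 (m - 1)\<close>, so the
  summand \<open>Inr (k, j)\<close> belongs to the index \<open>(Suc k, j)\<close>.\<close>

lemma sum_summands:
  "(\<Sum>B\<in>summands m. h B) = (\<Sum>j\<in>UNIV. h (Inl j)) + (\<Sum>(n, j)\<in>{1..m} \<times> UNIV. h (Inr (n - 1, j)))"
proof -
  have "(\<Sum>B\<in>summands m. h B) = sum h (range Inl) + sum h (Inr ` ({..<m} \<times> UNIV))"
    unfolding summands_def by (rule sum.union_disjoint) auto
  also have "sum h (range Inl) = (\<Sum>j\<in>UNIV. h (Inl j))" by (simp add: sum.reindex)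
  also have "sum h (Inr ` ({..<m} \<times> UNIV)) = (\<Sum>p\<in>{..<m} \<times> UNIV. h (Inr p))" by (simp add: sum.reindex)
  also have "\<dots> = (\<Sum>(n, j)\<in>{1..m} \<times> UNIV. h (Inr (n - 1, j)))"
    by (rule sum.reindex_bij_witness[where i = "\<lambda>(n, j). (n - 1, j)" and j = "\<lambda>(k, j). (Suc k, j)"]) auto
  finally show ?thesis .
qed

text \<open>These boxes are cofinal among the finite subsets of \<open>idx\<close>, so an unordered
  sum is the limit of the partial sums that come from \<open>summands m\<close>.\<close>

lemma filterlim_idx: "filterlim (\<lambda>m. {1..m} \<times> (UNIV :: 3 set)) (finite_subsets_at_top idx) sequentially"
  unfolding filterlim_finite_subsets_at_top
proof (intro allI impI, elim conjE)
  fix X :: "(nat \<times> 3) set" assume X: "finite X" "X \<subseteq> idx"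
  show "\<forall>\<^sub>F m in sequentially. finite ({1..m} \<times> (UNIV :: 3 set)) \<and> X \<subseteq> {1..m} \<times> UNIV \<and> {1..m} \<times> UNIV \<subseteq> idx"
    unfolding eventually_sequentially
  proof (intro exI allI impI conjI)
    fix m assume m: "Max (insert 0 (fst ` X)) \<le> m"
    have "fst p \<le> m" if "p \<in> X" for p
      using Max_ge[of "insert 0 (fst ` X)" "fst p"] X(1) that m by auto
    then show "X \<subseteq> {1..m} \<times> UNIV" using X(2) by auto
  qed auto
qed

lemma infsum_idx_tendsto:
  fixes h :: "nat \<times> 3 \<Rightarrow> 'a :: {comm_monoid_add, t2_space}"
  assumes "h summable_on idx" shows "(\<lambda>m. sum h ({1..m} \<times> UNIV)) \<longlonglongrightarrow> infsum h idx"
  using has_sum_infsum[OF assms] filterlim_compose[OF _ filterlim_idx] unfolding has_sum_def by blast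

lemma tau_fin_summable:
  assumes lm: "\<forall>m\<ge>1. \<forall>j. 0 \<le> lm m j" "(\<lambda>(m, j). lm m j) summable_on idx" and b: "b \<in> calA_inf"
    and S: "S \<subseteq> idx"
  shows "(\<lambda>(m, j). of_real (lm m j) * tau_fin m j b) summable_on S"
    "cmod (infsum (\<lambda>(m, j). of_real (lm m j) * tau_fin m j b) S) \<le> infsum (\<lambda>(m, j). lm m j) S * norm b"
proof -
  have s: "(\<lambda>(m, j). lm m j) summable_on S" by (rule summable_on_subset_banach[OF lm(2) S])
  then have s': "(\<lambda>p. (\<lambda>(m, j). lm m j) p * norm b) summable_on S" by (rule summable_on_cmult_left)
  have bound: "norm ((\<lambda>(m, j). of_real (lm m j) * tau_fin m j b) p) \<le> (\<lambda>(m, j). lm m j) p * norm b" if pS: "p \<in> S" for p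
  proof -
    obtain m j where p: "p = (m, j)" "1 \<le> m" using pS S by (cases p) auto
    then have "tau_fin m j b = summand_trace (Inr (m - 1, j)) b" using tau_fin_eq[OF b, of "m - 1" j] by simp
    then show ?thesis using p lm(1) by (simp add: norm_mult mult_left_mono cmod_summand_trace)
  qed
  have "(\<lambda>p. norm ((\<lambda>(m, j). of_real (lm m j) * tau_fin m j b) p)) summable_on S"
    by (rule Infinite_Sum.abs_summable_on_comparison_test'[OF s' bound])
  then show sm: "(\<lambda>(m, j). of_real (lm m j) * tau_fin m j b) summable_on S" by (rule Infinite_Sum.abs_summable_summable)
  show "cmod (infsum (\<lambda>(m, j). of_real (lm m j) * tau_fin m j b) S) \<le> infsum (\<lambda>(m, j). lm m j) S * norm b"
    using norm_infsum_le[OF has_sum_infsum[OF sm] has_sum_infsum[OF s'] bound]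
    by (simp add: infsum_cmult_left')
qed

lemma decomposition_exists:
  assumes tr: "tracial_state_on calA_inf \<phi>"
  shows "\<exists>l_inf l lm. is_decomposition \<phi> l_inf l lm"
proof -
  let ?c = "trace_coeff \<phi>"
  define l where "l j = ?c (Inl j)" for j
  define lm where "lm m j = ?c (Inr (m - 1, j))" for m j
  define total where "total = (\<Sum>j\<in>UNIV. l j) + infsum (\<lambda>(m, j). lm m j) idx"
  have pos: "0 \<le> ?c B" for B by (rule trace_coeff_nonneg[OF tr])
  have N: "(\<Sum>B\<in>summands m. ?c B) = (\<Sum>j\<in>UNIV. l j) + (\<Sum>(m, j)\<in>{1..m} \<times> UNIV. lm m j)" for m
    unfolding sum_summands l_def lm_def ..
  have le1: "(\<Sum>B\<in>summands m. ?c B) \<le> 1" for m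
    using trace_split[OF tr, of m] by blast
  have sm: "(\<lambda>(m, j). lm m j) summable_on idx"
  proof (rule nonneg_bdd_above_summable_on)
    show "0 \<le> (\<lambda>(m, j). lm m j) p" for p by (cases p) (simp add: lm_def pos)
    show "bdd_above (sum (\<lambda>(m, j). lm m j) ` {F. F \<subseteq> idx \<and> finite F})"
    proof (rule bdd_aboveI2)
      fix X assume "X \<in> {F. F \<subseteq> idx \<and> finite F}"
      then have X: "finite X" "X \<subseteq> idx" by auto
      then obtain m where m: "X \<subseteq> {1..m} \<times> UNIV"
        using filterlim_idx unfolding filterlim_finite_subsets_at_top eventually_sequentially by (meson order_refl)
      have "sum (\<lambda>(m, j). lm m j) X \<le> sum (\<lambda>(m, j). lm m j) ({1..m} \<times> UNIV)"
        by (rule sum_mono2[OF _ m]) (auto simp: lm_def pos)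
      also have "\<dots> \<le> (\<Sum>B\<in>summands m. ?c B)"
        unfolding N by (simp add: sum_nonneg l_def pos)
      also have "\<dots> \<le> 1" by (rule le1)
      finally show "sum (\<lambda>(m, j). lm m j) X \<le> 1" .
    qed
  qed
  have N_lim: "(\<lambda>m. \<Sum>B\<in>summands m. ?c B) \<longlonglongrightarrow> total"
    unfolding N total_def by (intro tendsto_add tendsto_const infsum_idx_tendsto sm)
  have total: "total \<le> 1"
    by (rule tendsto_upperbound[OF N_lim]) (simp_all add: le1)
  have lm_pos: "\<forall>m\<ge>1. \<forall>j. 0 \<le> lm m j" by (simp add: lm_def pos)
  have main: "\<phi> a = of_real (1 - total) * tau_inf a + (\<Sum>j\<in>UNIV. of_real (l j) * chi j a)
       + infsum (\<lambda>(m, j). of_real (lm m j) * tau_fin m j a) idx" if a: "a \<in> calA_inf" for a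
  proof -
    define R where "R m = (\<Sum>B\<in>summands m. of_real (?c B) * summand_trace B a)" for m
    define R_lim where "R_lim = (\<Sum>j\<in>UNIV. of_real (l j) * chi j a)
       + infsum (\<lambda>(m, j). of_real (lm m j) * tau_fin m j a) idx"
    have R_eq: "R m = (\<Sum>j\<in>UNIV. of_real (l j) * chi j a) + (\<Sum>(m, j)\<in>{1..m} \<times> UNIV. of_real (lm m j) * tau_fin m j a)" for m
      unfolding R_def sum_summands
    proof (intro arg_cong2[of _ _ _ _ "(+)"] sum.cong refl)
      fix p assume "p \<in> {1..m} \<times> (UNIV :: 3 set)"
      then obtain n j where p: "p = (Suc n, j)" by (cases p) (auto dest!: Suc_le_D)
      show "(case p of (n, j) \<Rightarrow> of_real (?c (Inr (n - 1, j))) * summand_trace (Inr (n - 1, j)) a)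
          = (case p of (m, j) \<Rightarrow> of_real (lm m j) * tau_fin m j a)"
        unfolding p by (simp add: lm_def tau_fin_eq[OF a])
    qed (simp add: l_def chi_eq[OF a])
    have R: "(\<lambda>m. R m) \<longlonglongrightarrow> R_lim"
      unfolding R_lim_def R_eq
      by (intro tendsto_add tendsto_const infsum_idx_tendsto tau_fin_summable(1)[OF lm_pos sm a order_refl])
    \<comment> \<open>One slice \<open>rho n a\<close> close to \<open>a\<close> serves for all
      \<open>m > n\<close>, since padding it with units puts it into \<open>M3 m\<close> without
      moving it in the UHF algebra. Half of \<open>e\<close> pays for the remainder
      \<open>f\<close>, the other half for the distance between the trace of the slice and
      \<open>tau_inf a\<close>.\<close>
    have bound: "cmod (\<phi> a - R_lim - tau_inf a * of_real (1 - total)) \<le> e" if e: "e > 0" for e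
    proof -
      have "e / 2 > 0" using e by simp
      then have "\<forall>\<^sub>F n in sequentially. dist (iota (Suc n) (rho n a)) a < e / 2"
        by (rule tendstoD[OF iota_rho_tendsto[OF a]])
      then obtain n where n: "dist (iota (Suc n) (rho n a)) a < e / 2"
        by (auto simp: eventually_sequentially)
      let ?x = "rho n a"
      have t: "cmod (ntr (Suc n) ?x - tau_inf a) \<le> e / 2"
        using cmod_tau_inf[of "iota (Suc n) ?x - a"] n by (simp add: tau_inf_diff tau_inf_iota M3_rho dist_norm)
      have "cmod (\<phi> a - R m - tau_inf a * of_real (1 - (\<Sum>B\<in>summands m. ?c B))) \<le> e" if m: "Suc n \<le> m" for m
      proof -
        define k where "k = m - Suc n"
        have mk: "m = Suc n + k" using m by (simp add: k_def)
        let ?y = "?x \<otimes> mid k" and ?N = "1 - (\<Sum>B\<in>summands m. ?c B)"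
        have y: "?y \<in> M3 m" "iota m ?y = iota (Suc n) ?x" "ntr m ?y = ntr (Suc n) ?x"
          unfolding mk by (intro M3_tens M3_rho M3_closed(2) iota_tens_mid ntr_tens_mid)+
        show ?thesis
        proof (rule trace_split[OF tr, of m])
          fix f
          assume f': "\<And>b. b \<in> calA_inf \<Longrightarrow> \<phi> b = (\<Sum>B\<in>summands m. of_real (?c B) * summand_trace B b) + f b"
              "\<And>b x. b \<in> calA_inf \<Longrightarrow> x \<in> M3 m \<Longrightarrow> cmod (f b - ntr m x * of_real ?N) \<le> norm (b - iota m x)"
          have f: "\<phi> a = R m + f a" "cmod (f a - ntr m ?y * of_real ?N) \<le> norm (a - iota m ?y)"
            unfolding R_def by (rule f'(1)[OF a], rule f'(2)[OF a y(1)])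
          have N01: "\<bar>?N\<bar> \<le> 1" using le1[of m] sum_nonneg[of "summands m" ?c] pos by simp
          have "\<phi> a - R m - tau_inf a * of_real ?N
              = (f a - ntr m ?y * of_real ?N) + (ntr (Suc n) ?x - tau_inf a) * of_real ?N"
            unfolding f(1) y(3) by (simp add: algebra_simps)
          then have "cmod (\<phi> a - R m - tau_inf a * of_real ?N)
              \<le> cmod (f a - ntr m ?y * of_real ?N) + cmod (ntr (Suc n) ?x - tau_inf a) * \<bar>?N\<bar>"
            by (metis norm_triangle_ineq norm_mult norm_of_real)
          also have "\<dots> \<le> e / 2 + e / 2 * 1"
            by (intro add_mono mult_mono N01 t order_trans[OF f(2)])
              (use n e in \<open>auto simp: y(2) dist_norm norm_minus_commute less_imp_le\<close>)
          finally show "cmod (\<phi> a - R m - tau_inf a * of_real ?N) \<le> e" by simp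
        qed
      qed
      then have "\<forall>\<^sub>F m in sequentially. cmod (\<phi> a - R m - tau_inf a * of_real (1 - (\<Sum>B\<in>summands m. ?c B))) \<le> e"
        unfolding eventually_sequentially by blast
      moreover have "(\<lambda>m. cmod (\<phi> a - R m - tau_inf a * of_real (1 - (\<Sum>B\<in>summands m. ?c B))))
         \<longlonglongrightarrow> cmod (\<phi> a - R_lim - tau_inf a * of_real (1 - total))"
        by (intro tendsto_intros R N_lim)
      ultimately show ?thesis by (intro tendsto_upperbound) auto
    qed
    have "cmod (\<phi> a - R_lim - tau_inf a * of_real (1 - total)) \<le> 0"
    proof (rule field_le_epsilon)
      fix e :: real assume "0 < e"
      then show "cmod (\<phi> a - R_lim - tau_inf a * of_real (1 - total)) \<le> 0 + e"
        unfolding add_0_left by (rule bound)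
    qed
    then have "\<phi> a - R_lim = tau_inf a * of_real (1 - total)" by simp
    then have "\<phi> a = tau_inf a * of_real (1 - total) + R_lim" by (simp only: diff_eq_eq)
    then show ?thesis by (simp only: R_lim_def add.assoc mult.commute[of "tau_inf a"])
  qed
  have "is_decomposition \<phi> (1 - total) l lm"
    unfolding is_decomposition_def
    using total sm lm_pos main tau_fin_summable(1)[OF lm_pos sm _ order_refl]
    by (auto simp: l_def pos total_def)
  then show ?thesis by blast
qed

section \<open>Uniqueness of the coefficients\<close>

fun coeff_at :: "(3 \<Rightarrow> real) \<Rightarrow> (nat \<Rightarrow> 3 \<Rightarrow> real) \<Rightarrow> summand \<Rightarrow> real" where
  "coeff_at l lm (Inl j) = l j"
| "coeff_at l lm (Inr (k, j)) = lm (Suc k) j"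

text \<open>All coordinates of \<open>g\<close> up to level \<open>m\<close> vanish except the unit
  at \<open>B\<close>, so these terms contribute exactly the coefficient of \<open>B\<close>. What
  remains is the \<open>tau_inf\<close> term and the tail, which is bounded by its total weight
  because \<open>norm g \<le> 1\<close>.\<close>

lemma decomposition_coeff:
  assumes D: "is_decomposition \<phi> l_inf l lm" and B: "B \<in> summands m"
    and g: "g \<in> calA_inf" "rho m g = elem m B (mid (sdim B))" "norm g \<le> 1"
  shows "cmod (\<phi> g - of_real (coeff_at l lm B)) \<le> l_inf * cmod (tau_inf g)
    + (infsum (\<lambda>(m, j). lm m j) idx - (\<Sum>(m, j)\<in>{1..m} \<times> UNIV. lm m j))"
proof -
  let ?c = "coeff_at l lm"
  let ?F = "{1..m} \<times> (UNIV :: 3 set)" and ?lm = "\<lambda>(m, j). lm m j" and ?t = "\<lambda>(m, j). of_real (lm m j) * tau_fin m j g"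
  have D': "0 \<le> l_inf" "\<forall>m\<ge>1. \<forall>j. 0 \<le> lm m j" "?lm summable_on idx"
    "\<phi> g = of_real l_inf * tau_inf g + (\<Sum>j\<in>UNIV. of_real (l j) * chi j g) + infsum ?t idx"
    using D g(1) unfolding is_decomposition_def by auto
  have F: "?F \<subseteq> idx" "idx - ?F \<subseteq> idx" "finite ?F" by auto
  note sm = tau_fin_summable[OF D'(2,3) g(1)]
  have idx: "idx = ?F \<union> (idx - ?F)" using F by blast
  have split: "infsum ?t idx = sum ?t ?F + infsum ?t (idx - ?F)"
    using infsum_Un_disjoint[OF sm(1)[OF F(1)] sm(1)[OF F(2)]] F idx by simp
  have split_lm: "infsum ?lm (idx - ?F) = infsum ?lm idx - sum ?lm ?F"
    using infsum_Un_disjoint[OF summable_on_subset_banach[OF D'(3) F(1)] summable_on_subset_banach[OF D'(3) F(2)]] F idx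
    by simp
  have tr: "summand_trace C g = (if C = B then 1 else 0)" if C: "C \<in> summands m" for C
  proof -
    have "ucoord C g = (if C = B then mid (sdim B) else 0)"
      using coord_elem[OF B M3_closed(2) C] coord_rho[OF C, of g] g(2) by simp
    then show ?thesis by (simp add: summand_trace_def ntr_mid, simp add: ntr_def)
  qed
  have "(\<Sum>j\<in>UNIV. of_real (l j) * chi j g) + sum ?t ?F = (\<Sum>C\<in>summands m. of_real (?c C) * summand_trace C g)"
    unfolding sum_summands
  proof (intro arg_cong2[of _ _ _ _ "(+)"] sum.cong refl)
    fix p assume "p \<in> ?F"
    then obtain n j where p: "p = (Suc n, j)" by (cases p) (auto dest!: Suc_le_D)
    show "?t p = (case p of (n, j) \<Rightarrow> of_real (?c (Inr (n - 1, j))) * summand_trace (Inr (n - 1, j)) g)"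
      unfolding p by (simp add: tau_fin_eq[OF g(1)])
  qed (simp add: chi_eq[OF g(1)])
  also have "\<dots> = (\<Sum>C\<in>summands m. if C = B then of_real (?c B) else 0)"
    by (rule sum.cong) (auto simp: tr)
  also have "\<dots> = of_real (?c B)" using B by simp
  finally have e: "(\<Sum>j\<in>UNIV. of_real (l j) * chi j g) + sum ?t ?F = of_real (?c B)" .
  have "\<phi> g = of_real l_inf * tau_inf g + ((\<Sum>j\<in>UNIV. of_real (l j) * chi j g) + sum ?t ?F) + infsum ?t (idx - ?F)"
    unfolding D'(4) split by (simp only: add.assoc)
  then have "\<phi> g - of_real (?c B) = of_real l_inf * tau_inf g + infsum ?t (idx - ?F)"
    unfolding e by simp
  then have "cmod (\<phi> g - of_real (?c B)) \<le> l_inf * cmod (tau_inf g) + cmod (infsum ?t (idx - ?F))"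
    using norm_triangle_ineq[of "of_real l_inf * tau_inf g" "infsum ?t (idx - ?F)"] D'(1) by (simp add: norm_mult)
  moreover have "cmod (infsum ?t (idx - ?F)) \<le> infsum ?lm idx - sum ?lm ?F"
  proof -
    have "0 \<le> infsum ?lm (idx - ?F)" by (rule infsum_nonneg) (use D'(2) in auto)
    then have "infsum ?lm (idx - ?F) * norm g \<le> infsum ?lm (idx - ?F)" using g(3) by (simp add: mult_left_le)
    then show ?thesis using sm(2)[OF F(2)] split_lm by linarith
  qed
  ultimately show ?thesis by linarith
qed

lemma decomposition_unique:
  assumes D: "is_decomposition \<phi> l_inf l lm" and D': "is_decomposition \<phi> l_inf' l' lm'"
  shows "l_inf = l_inf' \<and> l = l' \<and> (\<forall>m\<ge>1. lm m = lm' m)"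
proof -
  let ?c = coeff_at
  let ?tail = "\<lambda>lm m. infsum (\<lambda>(m, j). lm m j) idx - (\<Sum>(m, j)\<in>{1..m} \<times> UNIV. lm m j :: real)"
  have p: "0 \<le> l_inf" "0 \<le> l_inf'" "(\<lambda>(m, j). lm m j) summable_on idx" "(\<lambda>(m, j). lm' m j) summable_on idx"
    using D D' by (auto simp: is_decomposition_def)
  have eq: "?c l lm B = ?c l' lm' B" for B
  proof -
    \<comment> \<open>The test element \<open>g\<close> changes with \<open>m\<close>, while the
      coefficients compared do not, so it suffices that this error tends to 0.\<close>
    let ?e = "\<lambda>m. (l_inf + l_inf') * (1 / 3) ^ (m - sdim B) + ?tail lm m + ?tail lm' m"
    have "\<bar>?c l lm B - ?c l' lm' B\<bar> \<le> ?e m" if m: "Suc (sdim B) \<le> m" for m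
    proof -
      have B: "B \<in> summands m" using mem_summands[of B] m by (auto simp: summands_def)
      obtain g where g: "g \<in> calA_inf" "rho m g = elem m B (mid (sdim B))"
          "norm g \<le> opnorm (Suc m) (elem m B (mid (sdim B)))"
          "cmod (tau_inf g) \<le> cmod (ntr (Suc m) (elem m B (mid (sdim B))))"
        using lift_exists[OF inA_elem[OF B M3_closed(2)]] by metis
      have n: "norm g \<le> 1" using g(3) elem_mid(3)[OF B] by linarith
      have t: "cmod (tau_inf g) \<le> (1 / 3) ^ (m - sdim B)" using g(4) cmod_ntr_elem_mid[OF B] by linarith
      have "cmod (of_real (?c l lm B) - of_real (?c l' lm' B))
        \<le> cmod (\<phi> g - of_real (?c l lm B)) + cmod (\<phi> g - of_real (?c l' lm' B))"
        using norm_triangle_ineq4[of "\<phi> g - of_real (?c l' lm' B)" "\<phi> g - of_real (?c l lm B)"] by simp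
      then have "\<bar>?c l lm B - ?c l' lm' B\<bar> \<le> cmod (\<phi> g - of_real (?c l lm B)) + cmod (\<phi> g - of_real (?c l' lm' B))"
        unfolding of_real_diff[symmetric] norm_of_real .
      also have "\<dots> \<le> (l_inf * cmod (tau_inf g) + ?tail lm m) + (l_inf' * cmod (tau_inf g) + ?tail lm' m)"
        by (intro add_mono decomposition_coeff[OF D B g(1,2) n] decomposition_coeff[OF D' B g(1,2) n])
      also have "\<dots> = (l_inf + l_inf') * cmod (tau_inf g) + ?tail lm m + ?tail lm' m" by (simp add: algebra_simps)
      also have "\<dots> \<le> ?e m" using mult_left_mono[OF t, of "l_inf + l_inf'"] p(1,2) by simp
      finally show ?thesis .
    qed
    then have ev: "\<forall>\<^sub>F m in sequentially. \<bar>?c l lm B - ?c l' lm' B\<bar> \<le> ?e m"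
      unfolding eventually_sequentially by blast
    have "(\<lambda>m. (1 / 3 :: real) ^ (m - sdim B)) \<longlonglongrightarrow> 0"
      by (rule LIMSEQ_offset[of _ "sdim B"]) (simp add: LIMSEQ_power_zero)
    moreover have "(\<lambda>m. ?tail lm m) \<longlonglongrightarrow> infsum (\<lambda>(m, j). lm m j) idx - infsum (\<lambda>(m, j). lm m j) idx"
      "(\<lambda>m. ?tail lm' m) \<longlonglongrightarrow> infsum (\<lambda>(m, j). lm' m j) idx - infsum (\<lambda>(m, j). lm' m j) idx"
      by (intro tendsto_diff tendsto_const infsum_idx_tendsto p)+
    ultimately have "?e \<longlonglongrightarrow> (l_inf + l_inf') * 0 + (infsum (\<lambda>(m, j). lm m j) idx - infsum (\<lambda>(m, j). lm m j) idx)
        + (infsum (\<lambda>(m, j). lm' m j) idx - infsum (\<lambda>(m, j). lm' m j) idx)"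
      by (intro tendsto_add tendsto_mult tendsto_const)
    then have "?e \<longlonglongrightarrow> 0" by simp
    then have "\<bar>?c l lm B - ?c l' lm' B\<bar> \<le> 0" using ev by (rule tendsto_lowerbound) simp
    then show ?thesis by simp
  qed
  have l: "l = l'" using eq[of "Inl _"] by (simp add: fun_eq_iff)
  have lm: "lm m = lm' m" if "m \<ge> 1" for m
    using eq[of "Inr (m - 1, _)"] that by (simp add: fun_eq_iff)
  \<comment> \<open>The test elements do not isolate \<open>l_inf\<close>; it is recovered from the
    normalization once all other coefficients agree.\<close>
  have "infsum (\<lambda>(m, j). lm m j) idx = infsum (\<lambda>(m, j). lm' m j) idx"
    by (rule infsum_cong) (auto simp: lm)
  then have "l_inf = l_inf'" using D D' l by (simp add: is_decomposition_def)
  then show ?thesis using l lm by blast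
qed

theorem proposition3p17:
  fixes \<phi> :: "uhf \<Rightarrow> complex"
  assumes "tracial_state_on calA_inf \<phi>"
  shows "(\<exists>l_inf l lm. is_decomposition \<phi> l_inf l lm) \<and>
    (\<forall>l_inf l lm l_inf' l' lm'.
       is_decomposition \<phi> l_inf l lm \<longrightarrow> is_decomposition \<phi> l_inf' l' lm' \<longrightarrow>
       l_inf = l_inf' \<and> l = l' \<and> (\<forall>m\<ge>1. lm m = lm' m))"
  using decomposition_exists[OF assms] decomposition_unique by blast

end
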